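(* Let $N\ge3$, $s\in(0,\frac N2)$ and $\alpha\in(0,N)$, and put $2^*_s=\frac{2N}{N-2s}$, $2^*_\alpha=\frac{2N-\alpha}{N-2s}$. There exists $C_3>0$ such that for all $\iota$ and $\vartheta$ satisfying $\frac{2}{2^*_s}\le\iota<1$ and $1\le\vartheta<2^*_s$, we have $$\left(\int_{\mathbb{R}^N}\int_{\mathbb{R}^N}\frac{|u(x)|^{2^*_\alpha}|u(y)|^{2^*_\alpha}}{|x-y|^\alpha}\,\mathrm{d}x\,\mathrm{d}y\right)^{\frac{1}{2^*_\alpha}}\le C_3\,\|u\|_D^{2\iota}\,\|u\|_{\mathcal{L}^{\vartheta,\frac{\vartheta(N-2s)}{2}}(\mathbb{R}^N)}^{2(1-\iota)}$$ for any $u\in D^{s,2}(\mathbb{R}^N)$.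
   Context: $D^{s,2}(\mathbb{R}^N)$ is the completion of $C_0^\infty(\mathbb{R}^N)$ with respect to the norm $\|u\|_D=\|(-\Delta)^{s/2}u\|_{L^2(\mathbb{R}^N)}$. For $p\in[1,\infty)$ and $\varpi\in(0,N]$, the Morrey norm is defined by $$\|u\|^p_{\mathcal{L}^{p,\varpi}(\mathbb{R}^N)}=\sup_{R>0,\,x\in\mathbb{R}^N}R^{\varpi-N}\int_{B(x,R)}|u(y)|^p\,\mathrm{d}y .$$ *)

theory Defs
  imports "HOL-Analysis.Analysis"
begin

text \<open>Real powers on the extended nonnegative reals, with \<open>\<infinity>\<^sup>a = \<infinity>\<close>. This convention is
  intended for exponents \<open>a > 0\<close>, the only ones used below.\<close>

definition ennpowr :: "ennreal \<Rightarrow> real \<Rightarrow> ennreal"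
  where "ennpowr x a = (if x = \<infinity> then \<infinity> else ennreal (enn2real x powr a))"

definition Lp_norm :: "real \<Rightarrow> (real ^ 'n \<Rightarrow> 'b::real_normed_vector) \<Rightarrow> ennreal"
  where "Lp_norm p f = ennpowr (\<integral>\<^sup>+x. ennreal (norm (f x) powr p) \<partial>lebesgue) (1 / p)"

definition morrey_norm :: "real \<Rightarrow> real \<Rightarrow> (real ^ 'n \<Rightarrow> real) \<Rightarrow> ennreal"
  where "morrey_norm p w u =
    ennpowr (SUP R\<in>{0<..}. SUP x. ennreal (R powr (w - real CARD('n))) *
               (\<integral>\<^sup>+y\<in>ball x R. ennreal (\<bar>u y\<bar> powr p) \<partial>lebesgue)) (1 / p)"

definition partial_deriv :: "'n \<Rightarrow> (real ^ 'n \<Rightarrow> real) \<Rightarrow> real ^ 'n \<Rightarrow> real"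
  where "partial_deriv i f x = frechet_derivative f (at x) (axis i 1)"

text \<open>Smoothness: every iterated partial derivative (of any order, including order 0) is
  Frechet differentiable everywhere; in particular all of them are continuous.\<close>

definition test_function :: "(real ^ 'n \<Rightarrow> real) \<Rightarrow> bool"
  where "test_function f \<longleftrightarrow>
    (\<forall>is x. foldr partial_deriv is f differentiable (at x)) \<and>
    compact (closure {x. f x \<noteq> 0})"

definition fourier :: "(real ^ 'n \<Rightarrow> complex) \<Rightarrow> real ^ 'n \<Rightarrow> complex"
  where "fourier f \<xi> = (\<integral>x. cis (- (x \<bullet> \<xi>)) * f x \<partial>lebesgue)"

definition inv_fourier :: "(real ^ 'n \<Rightarrow> complex) \<Rightarrow> real ^ 'n \<Rightarrow> complex"
  where "inv_fourier g x =
    complex_of_real (1 / (2 * pi) ^ CARD('n)) * (\<integral>\<xi>. cis (x \<bullet> \<xi>) * g \<xi> \<partial>lebesgue)"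

text \<open>\<open>frac_laplacian \<sigma> f\<close> is \<open>(-\<Delta>)\<^sup>\<sigma> f\<close>, the operator with Fourier symbol
  \<open>\<bar>\<xi>\<bar>\<^bsup>2\<sigma>\<^esup>\<close>. It is only applied to test functions and \<open>\<sigma> > 0\<close>, where both
  Fourier integrals converge absolutely.\<close>

definition frac_laplacian :: "real \<Rightarrow> (real ^ 'n \<Rightarrow> real) \<Rightarrow> real ^ 'n \<Rightarrow> complex"
  where "frac_laplacian \<sigma> f =
    inv_fourier (\<lambda>\<xi>. complex_of_real (norm \<xi> powr (2 * \<sigma>)) *
                      fourier (\<lambda>x. complex_of_real (f x)) \<xi>)"

definition D_norm_test :: "real \<Rightarrow> (real ^ 'n \<Rightarrow> real) \<Rightarrow> ennreal"
  where "D_norm_test s f = Lp_norm 2 (frac_laplacian (s / 2) f)"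

definition sobolev_exponent :: "'n::finite itself \<Rightarrow> real \<Rightarrow> real"
  where "sobolev_exponent _ s = 2 * real CARD('n) / (real CARD('n) - 2 * s)"

definition hls_exponent :: "'n::finite itself \<Rightarrow> real \<Rightarrow> real \<Rightarrow> real"
  where "hls_exponent _ s \<alpha> = (2 * real CARD('n) - \<alpha>) / (real CARD('n) - 2 * s)"

text \<open>The completion \<open>D\<^bsup>s,2\<^esup>\<close> is realised as a space of functions in the usual way: by the
  Sobolev inequality a Cauchy sequence of test functions for the \<open>D\<close>-norm converges in
  \<open>L\<^sup>p\<close>, \<open>p = 2N/(N-2s)\<close>, and its class in the completion is identified with the limit.
  \<open>D_completing s \<phi> u\<close> says that \<open>\<phi>\<close> is such a Cauchy sequence and that \<open>u\<close> is its limit.\<close>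

definition D_completing :: "real \<Rightarrow> (nat \<Rightarrow> real ^ 'n \<Rightarrow> real) \<Rightarrow> (real ^ 'n \<Rightarrow> real) \<Rightarrow> bool"
  where "D_completing s \<phi> u \<longleftrightarrow>
    (\<forall>k. test_function (\<phi> k)) \<and>
    (\<forall>e>0. \<exists>M. \<forall>m\<ge>M. \<forall>n\<ge>M. D_norm_test s (\<lambda>x. \<phi> m x - \<phi> n x) < ennreal e) \<and>
    (\<lambda>k. Lp_norm (sobolev_exponent TYPE('n) s) (\<lambda>x. \<phi> k x - u x)) \<longlonglongrightarrow> 0"

definition D_space :: "real \<Rightarrow> (real ^ 'n \<Rightarrow> real) set"
  where "D_space s = {u \<in> borel_measurable lebesgue. \<exists>\<phi>. D_completing s \<phi> u}"

text \<open>The norm of the completion: the limit of the norms along a Cauchy sequence representing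
  \<open>u\<close>. For \<open>0 < s < N/2\<close> the limit exists and is the same for all representing sequences, so
  the choice is immaterial.\<close>

definition D_norm :: "real \<Rightarrow> (real ^ 'n \<Rightarrow> real) \<Rightarrow> ennreal"
  where "D_norm s u = lim (\<lambda>k. D_norm_test s ((SOME \<phi>. D_completing s \<phi> u) k))"

end

theory Submission
  imports Defs "HOL-Probability.Probability"
begin

text \<open>
  Put \<open>p = 2N/(N-2s)\<close> and \<open>w = (N-2s)/2\<close>. By the Hardy-Littlewood-Sobolev inequality the left-hand side
  is at most \<open>C \<parallel>u\<parallel>\<^sub>p\<^sup>2\<close>, so everything reduces to the refined Sobolev inequality
  \<open>\<parallel>u\<parallel>\<^sub>p\<^sup>p \<le> C M\<^bsup>p-2\<^esup> \<parallel>u\<parallel>\<^sub>D\<^sup>2\<close> with \<open>M\<close> the Morrey norm with exponents \<open>1, w\<close>. Up to constants that do not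
  depend on \<open>\<theta>\<close>, \<open>M\<close> is dominated both by the Morrey norm with exponents \<open>\<theta>, \<theta>w\<close> and by \<open>\<parallel>u\<parallel>\<^sub>p\<close>.
  The two resulting bounds are \<open>\<iota> = 2/p\<close> and \<open>\<iota> = 1\<close>; the cases in between follow by interpolation,
  with a constant uniform in \<open>\<iota>\<close>.

  For a test function the refined inequality is obtained by splitting at each level \<open>\<lambda>\<close>. A Gaussian
  mean at scale \<open>t\<close> is bounded by \<open>C M t\<^bsup>-w/2\<^esup>\<close>; choosing \<open>t\<close> so that this is \<open>\<lambda>/2\<close>, the set where
  \<open>\<bar>f\<bar> > \<lambda>\<close> is controlled by the \<open>L\<^sup>2\<close> norm of the high frequency part, and Plancherel together with
  integration in \<open>\<lambda>\<close> gives back the weight \<open>\<bar>\<xi>\<bar>\<^bsup>2s\<^esup>\<close>.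
\<close>


section \<open>The Hardy-Littlewood-Sobolev inequality on the diagonal\<close>

text \<open>Among the Morrey bounds that scale alike, exponent 1 is the weakest: truncation on each
  ball derives it from any exponent with a constant that does not see the exponent, hence uniformity
  in \<theta>. The refined inequality therefore contains the ordinary Sobolev inequality, which
  appears once a finite power of the L^p norm is divided out. Uniformity in \<iota> comes from
  having one constant \<open>C \<ge> 1\<close> in both bounds, which a geometric mean cannot
  enlarge.

  The obstacle in passing to the completion is that the Morrey bound is known for \<open>u\<close>
  and not for the test functions that approximate it. The approximation takes place in L^p, however,
  and by the same truncation an L^p error \<delta> costs only a multiple of \<delta> in the Morrey
  bound. The refined inequality thus survives the limit without any density statement in Morrey
  spaces.\<close>

lemma term_le_suminf_ennreal: "(f k :: ennreal) \<le> (\<Sum>k. f k)"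
  using sum_le_suminf[of f "{k}"] by simp

lemma nn_integral_lborel_affine:
  fixes f :: "'a::euclidean_space \<Rightarrow> ennreal"
  assumes [measurable]: "f \<in> borel_measurable borel" and "c \<noteq> 0"
  shows "(\<integral>\<^sup>+x. f x \<partial>lborel) = ennreal (\<bar>c\<bar> ^ DIM('a)) * (\<integral>\<^sup>+x. f (t + c *\<^sub>R x) \<partial>lborel)"
  by (subst lborel_affine[OF assms(2), of t])
     (simp add: nn_integral_density nn_integral_distr nn_integral_cmult)

lemma dyadic_shell:
  fixes r :: real
  assumes "r \<ge> 1"
  obtains k :: nat where "2 ^ k \<le> r" "r < 2 ^ Suc k"
proof -
  define k where "k = nat \<lfloor>log 2 r\<rfloor>"
  have l: "0 \<le> log 2 r" using assms by simp
  have k: "real k \<le> log 2 r" "log 2 r < real k + 1" unfolding k_def using l by linarith+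
  have "2 powr real k \<le> r" using k(1) assms by (simp add: le_log_iff)
  moreover have "r < 2 powr (real (Suc k))" using k(2) assms by (simp add: log_less_iff add.commute)
  ultimately show ?thesis using that by (simp add: powr_realpow del: of_nat_Suc)
qed

text \<open>Cut the space into dyadic shells. The shell with index \<open>k\<close> inside the unit
  ball contributes a multiple of \<open>(2 powr (\<beta> - N)) ^ k\<close>, the one outside a
  multiple of \<open>(2 powr (N - \<gamma>)) ^ k\<close>, and both series are geometric. The
  exponent \<beta> may be negative; this occurs in the level integral below, where
  \<open>\<beta> = 3 - p\<close>.\<close>

lemma nn_integral_radial_powr_finite:
  fixes \<beta> \<gamma> :: real
  assumes "\<beta> < DIM('a::euclidean_space)" "DIM('a) < \<gamma>"
  shows "(\<integral>\<^sup>+z. ennreal (if norm (z::'a) < 1 then norm z powr - \<beta> else norm z powr - \<gamma>) \<partial>lborel) < \<infinity>"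
proof -
  define N where "N = real DIM('a)"
  define \<omega> where "\<omega> = unit_ball_vol N"
  have \<omega>: "\<omega> \<ge> 0" unfolding \<omega>_def N_def by simp
  \<comment> \<open>On the shell between \<open>(1/2) ^ Suc k\<close> and \<open>(1/2) ^ k\<close>
    the power is largest at the inner radius if \<beta> is nonnegative and at the outer one
    otherwise; the factor \<open>2 powr \<bar>\<beta>\<bar>\<close> covers both. Balls replace
    shells, which changes constants only.\<close>
  define f where "f k z = ennreal (2 powr \<bar>\<beta>\<bar> * (2 powr \<beta>) ^ k) * indicator (cball (0::'a) ((1/2)^k)) z" for k z
  define g where "g k z = ennreal ((2 powr - \<gamma>) ^ k) * indicator (ball (0::'a) (2 ^ Suc k)) z" for k z
  have f_int: "(\<integral>\<^sup>+z. f k z \<partial>lborel) = ennreal (2 powr \<bar>\<beta>\<bar> * \<omega> * (2 powr (\<beta> - N)) ^ k)" for k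
  proof -
    have "(\<integral>\<^sup>+z. f k z \<partial>lborel) = ennreal (2 powr \<bar>\<beta>\<bar> * (2 powr \<beta>) ^ k) * ennreal (\<omega> * ((1/2)^k)^DIM('a))"
      unfolding f_def by (simp add: nn_integral_cmult_indicator emeasure_cball \<omega>_def N_def)
    also have "\<dots> = ennreal (2 powr \<bar>\<beta>\<bar> * (2 powr \<beta>) ^ k * (\<omega> * ((1/2)^k)^DIM('a)))"
      by (rule ennreal_mult[symmetric]) (use \<omega> in auto)
    also have "((1/2)^k)^DIM('a) = ((2 powr - N)^k :: real)"
      unfolding N_def by (simp add: powr_minus powr_realpow power_mult[symmetric] power_inverse mult.commute field_simps)
    also have "2 powr \<bar>\<beta>\<bar> * (2 powr \<beta>) ^ k * (\<omega> * (2 powr - N)^k) = 2 powr \<bar>\<beta>\<bar> * \<omega> * (2 powr (\<beta> - N)) ^ k"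
      by (simp add: powr_diff powr_minus field_simps power_mult_distrib[symmetric])
    finally show ?thesis .
  qed
  have g_int: "(\<integral>\<^sup>+z. g k z \<partial>lborel) = ennreal (\<omega> * 2 ^ DIM('a) * (2 powr (N - \<gamma>)) ^ k)" for k
  proof -
    have "(\<integral>\<^sup>+z. g k z \<partial>lborel) = ennreal ((2 powr - \<gamma>) ^ k) * ennreal (\<omega> * (2 ^ Suc k)^DIM('a))"
      unfolding g_def by (simp add: nn_integral_cmult_indicator emeasure_ball \<omega>_def N_def)
    also have "\<dots> = ennreal ((2 powr - \<gamma>) ^ k * (\<omega> * (2 ^ Suc k)^DIM('a)))"
      by (rule ennreal_mult[symmetric]) (use \<omega> in auto)
    also have "(2 ^ Suc k)^DIM('a) = (2 ^ DIM('a) * (2 powr N)^k :: real)"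
      unfolding N_def by (simp add: powr_realpow power_mult[symmetric] mult.commute field_simps power_add power_mult_distrib)
    also have "(2 powr - \<gamma>) ^ k * (\<omega> * (2 ^ DIM('a) * (2 powr N)^k)) = \<omega> * 2 ^ DIM('a) * (2 powr (N - \<gamma>)) ^ k"
      by (simp add: powr_diff powr_minus field_simps power_mult_distrib[symmetric])
    finally show ?thesis .
  qed
  have le: "ennreal (if norm z < 1 then norm z powr - \<beta> else norm z powr - \<gamma>)
      \<le> (\<Sum>k. f k z) + (\<Sum>k. g k z)" for z
  \<comment> \<open>At the origin the left side is 0 because \<open>0 powr a = 0\<close> for every
    \<open>a\<close>; only \<open>z \<noteq> 0\<close> has to be placed in a shell.\<close>
  proof (cases "z = 0")
    case False
    show ?thesis
    proof (cases "norm z < 1")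
      case True
      then have "1 / norm z \<ge> 1" using False by simp
      then obtain k where k: "2 ^ k \<le> 1 / norm z" "1 / norm z < 2 ^ Suc k" by (rule dyadic_shell)
      have up: "norm z \<le> (1/2)^k" using k(1) False by (simp add: field_simps power_divide)
      have lo: "(1/2)^Suc k < norm z" using k(2) False by (simp add: field_simps power_divide)
      have in_ball: "z \<in> cball 0 ((1/2)^k)" using up by simp
      have lo': "(1/2)^Suc k \<le> norm z" using lo by simp
      have "norm z powr - \<beta> \<le> 2 powr \<bar>\<beta>\<bar> * (2 powr \<beta>) ^ k"
      proof (cases "\<beta> \<ge> 0")
        case True
        have "norm z powr - \<beta> \<le> ((1/2)^Suc k) powr - \<beta>"
          using lo' True by (intro powr_mono2') auto
        also have "\<dots> = (2 powr (real (Suc k))) powr \<beta>"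
          by (subst powr_realpow) (auto simp: powr_minus power_divide powr_divide field_simps)
        also have "\<dots> = 2 powr \<bar>\<beta>\<bar> * (2 powr \<beta>) ^ k"
          using True by (simp add: powr_powr powr_realpow[symmetric] powr_add[symmetric] algebra_simps)
        finally show ?thesis .
      next
        case b: False
        have "norm z powr - \<beta> \<le> ((1/2)^k) powr - \<beta>"
          using in_ball b by (intro powr_mono2) auto
        also have "\<dots> = (2 powr (real k)) powr \<beta>"
          by (subst powr_realpow) (auto simp: powr_minus power_divide powr_divide field_simps)
        also have "\<dots> = (2 powr \<beta>) ^ k"
          by (simp add: powr_powr powr_realpow[symmetric] algebra_simps)
        also have "\<dots> \<le> 2 powr \<bar>\<beta>\<bar> * (2 powr \<beta>) ^ k"
          using ge_one_powr_ge_zero[of 2 "\<bar>\<beta>\<bar>"] by (intro mult_le_cancel_right1[THEN iffD2]) auto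
        finally show ?thesis .
      qed
      then have "ennreal (norm z powr - \<beta>) \<le> f k z"
        using in_ball by (simp add: f_def)
      also have "\<dots> \<le> (\<Sum>k. f k z)" by (rule term_le_suminf_ennreal)
      finally show ?thesis using True by (simp add: add_increasing2)
    next
      case z: False
      then obtain k where k: "2 ^ k \<le> norm z" "norm z < 2 ^ Suc k" using dyadic_shell[of "norm z"] by auto
      have "norm z powr - \<gamma> \<le> (2^k) powr - \<gamma>" using k(1) assms by (intro powr_mono2') auto
      also have "\<dots> = (2 powr - \<gamma>) ^ k" by (simp add: powr_realpow[symmetric] powr_powr mult.commute)
      finally have "ennreal (norm z powr - \<gamma>) \<le> g k z" using k by (simp add: g_def)
      also have "\<dots> \<le> (\<Sum>k. g k z)" by (rule term_le_suminf_ennreal)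
      finally show ?thesis using z by (simp add: add_increasing)
    qed
  qed simp
  have [measurable]: "f k \<in> borel_measurable borel" "g k \<in> borel_measurable borel" for k
    unfolding f_def[abs_def] g_def[abs_def]
    by (intro borel_measurable_times_ennreal borel_measurable_indicator borel_measurable_const borel_closed closed_cball borel_open open_ball)+
  have fin: "(\<Sum>k. \<integral>\<^sup>+z. f k z \<partial>lborel) < \<infinity>" "(\<Sum>k. \<integral>\<^sup>+z. g k z \<partial>lborel) < \<infinity>"
  proof -
    have "summable (\<lambda>k. 2 powr \<bar>\<beta>\<bar> * \<omega> * (2 powr (\<beta> - N)) ^ k)"
      using assms by (intro summable_mult summable_geometric) (simp add: N_def powr_less_one)
    then show "(\<Sum>k. \<integral>\<^sup>+z. f k z \<partial>lborel) < \<infinity>"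
      unfolding f_int by (simp only: infinity_ennreal_def less_top[symmetric]) (rule ennreal_suminf_neq_top, use \<omega> in auto)
    have "summable (\<lambda>k. \<omega> * 2 ^ DIM('a) * (2 powr (N - \<gamma>)) ^ k)"
      using assms by (intro summable_mult summable_geometric) (simp add: N_def powr_less_one)
    then show "(\<Sum>k. \<integral>\<^sup>+z. g k z \<partial>lborel) < \<infinity>"
      unfolding g_int by (simp only: infinity_ennreal_def less_top[symmetric]) (rule ennreal_suminf_neq_top, use \<omega> in auto)
  qed
  have "(\<integral>\<^sup>+z. ennreal (if norm (z::'a) < 1 then norm z powr - \<beta> else norm z powr - \<gamma>) \<partial>lborel)
      \<le> (\<integral>\<^sup>+z. (\<Sum>k. f k z) + (\<Sum>k. g k z) \<partial>lborel)"
    by (intro nn_integral_mono le)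
  also have "\<dots> = (\<Sum>k. \<integral>\<^sup>+z. f k z \<partial>lborel) + (\<Sum>k. \<integral>\<^sup>+z. g k z \<partial>lborel)"
    by (simp add: nn_integral_add nn_integral_suminf)
  also have "\<dots> < \<infinity>" using fin by simp
  finally show ?thesis .
qed


text \<open>Compare \<open>b\<close> with \<open>a powr (q - 1)\<close>: on either side of this
  curve one of the two summands already dominates the product. This is Young's inequality for
  conjugate exponents with cruder constants.\<close>

lemma young_capped:
  fixes a b q :: real
  assumes "0 \<le> a" "0 \<le> b" "q > 1"
  shows "a * b \<le> a powr q + b powr (q / (q - 1))"
proof (cases "b \<le> a powr (q - 1)")
  case True
  then have "a * b \<le> a * a powr (q - 1)" using assms by (intro mult_left_mono) auto
  also have "\<dots> = a powr q" using assms by (cases "a = 0") (auto simp: powr_diff)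
  finally show ?thesis by (simp add: add_increasing2)
next
  case False
  then have b: "b > 0" using assms by (smt (verit) powr_ge_zero)
  have "a = (a powr (q - 1)) powr (1 / (q - 1))" using assms by (simp add: powr_powr)
  also have "\<dots> \<le> b powr (1 / (q - 1))" using False assms by (intro powr_mono2) auto
  finally have "a * b \<le> b powr (1 / (q - 1)) * b powr 1" using b by simp
  also have "\<dots> = b powr (q / (q - 1))"
    using assms by (subst powr_add[symmetric]) (simp add: field_simps)
  finally show ?thesis by (simp add: add_increasing)
qed

text \<open>The part of the potential coming from points where \<open>f\<close> is at most its value at \<open>y\<close> is already
  bounded pointwise; the diagonal form of the inequality below needs no more than this.\<close>

lemma riesz_potential_sublevel:
  fixes \<alpha> :: real
  defines "N \<equiv> real DIM('a::euclidean_space)"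
  defines "q \<equiv> 2 * N / (2 * N - \<alpha>)"
  assumes \<alpha>: "0 < \<alpha>" "\<alpha> < N"
  obtains C where "C > 0" "\<And>f :: 'a \<Rightarrow> real. \<And>A y. \<lbrakk>f \<in> borel_measurable borel; \<And>x. 0 \<le> f x; 0 < A;
     (\<integral>\<^sup>+x. ennreal (f x powr q) \<partial>lborel) \<le> ennreal A; 0 < f y\<rbrakk> \<Longrightarrow>
     (\<integral>\<^sup>+x. ennreal (if f x \<le> f y then f x / norm (x - y) powr \<alpha> else 0) \<partial>lborel)
        \<le> ennreal (C * A powr (1 - \<alpha> / N) * f y powr (q - 1))"
proof -
  have N: "N > 0" unfolding N_def by simp
  \<comment> \<open>The majorant of the kernel once \<open>f\<close> is divided by
    \<open>f y\<close> and lengths by the radius \<open>r\<close>. Inside the unit ball it is the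
    kernel itself; outside, Young's inequality raises the kernel to the conjugate exponent
    \<open>q / (q - 1)\<close>, which turns \<alpha> into \<open>2 * N\<close> and makes it
    integrable at infinity.\<close>
  define K where "K z = (if norm z < 1 then norm z powr - \<alpha> else norm z powr - (2 * N))" for z :: 'a
  have [measurable]: "K \<in> borel_measurable borel" unfolding K_def by measurable
  have "(\<integral>\<^sup>+z. ennreal (K z) \<partial>lborel) < \<infinity>"
    unfolding K_def using \<alpha> N by (intro nn_integral_radial_powr_finite) (auto simp: N_def)
  then obtain \<kappa> where \<kappa>: "\<kappa> \<ge> 0" "(\<integral>\<^sup>+z. ennreal (K z) \<partial>lborel) = ennreal \<kappa>"
    by (metis less_top_ennreal infinity_ennreal_def)
  have q: "q > 1" unfolding q_def using \<alpha> N by (simp add: field_simps)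
  have q': "\<alpha> * (q / (q - 1)) = 2 * N" unfolding q_def using \<alpha> N by (simp add: field_simps)
  have main: "(\<integral>\<^sup>+x. ennreal (if f x \<le> f y then f x / norm (x - y) powr \<alpha> else 0) \<partial>lborel)
        \<le> ennreal ((1 + \<kappa>) * A powr (1 - \<alpha> / N) * f y powr (q - 1))"
    if [measurable]: "f \<in> borel_measurable borel" and f0: "\<And>x. 0 \<le> f x" and A: "0 < A"
      and fA: "(\<integral>\<^sup>+x. ennreal (f x powr q) \<partial>lborel) \<le> ennreal A" and y: "0 < f y"
    for f :: "'a \<Rightarrow> real" and A y
  proof -
    define b where "b = f y"
    have b: "b > 0" using y by (simp add: b_def)
    \<comment> \<open>With \<open>r powr N = A / b powr q\<close> the integral of
      \<open>(f x / b) powr q\<close> and that of the rescaled kernel are both bounded by multiples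
      of \<open>r powr N\<close>, so the near and the far part are balanced.\<close>
    define r where "r = (A / b powr q) powr (1 / N)"
    have r: "r > 0" unfolding r_def using A b by simp
    have rN: "r powr N = A / b powr q" unfolding r_def using N A b by (simp add: powr_powr)
    have pt: "(if f x \<le> f y then f x / norm (x - y) powr \<alpha> else 0)
       \<le> b * r powr - \<alpha> * ((1 / b powr q) * f x powr q + K ((x - y) /\<^sub>R r))" for x
    \<comment> \<open>Points with \<open>f x > f y\<close> contribute 0, and so does
      \<open>x = y\<close>: there \<open>0 powr \<alpha> = 0\<close>, and division by 0 gives
      0.\<close>
    proof (cases "f x \<le> f y \<and> x \<noteq> y")
      case True
      define a where "a = f x / b"
      define B where "B = (r / norm (x - y)) powr \<alpha>"
      have n: "norm (x - y) > 0" using True by simp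
      have a: "0 \<le> a" "a \<le> 1" using True f0[of x] b by (auto simp: a_def b_def)
      have B: "B > 0" using n r by (simp add: B_def)
      have eq: "f x / norm (x - y) powr \<alpha> = b * r powr - \<alpha> * (a * B)"
        using b r n by (simp add: a_def B_def powr_divide powr_minus field_simps)
      have nr: "norm ((x - y) /\<^sub>R r) = norm (x - y) / r" using r by (simp add: divide_inverse_commute)
      have "a * B \<le> a powr q + K ((x - y) /\<^sub>R r)"
      \<comment> \<open>Near \<open>y\<close> the bound \<open>a \<le> 1\<close>, which comes from
        the sublevel restriction, suffices; farther away Young's inequality trades the slowly
        decaying kernel for a power of \<open>f\<close>.\<close>
      proof (cases "norm (x - y) < r")
        case l: True
        have "K ((x - y) /\<^sub>R r) = (norm (x - y) / r) powr - \<alpha>"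
          using l r unfolding K_def nr by simp
        also have "\<dots> = B" using n r by (simp add: B_def powr_minus powr_divide)
        finally have "a * B \<le> K ((x - y) /\<^sub>R r)" using a B by (simp add: mult_left_le_one_le)
        then show ?thesis by (simp add: add_increasing)
      next
        case l: False
        have "K ((x - y) /\<^sub>R r) = (norm (x - y) / r) powr - (2 * N)"
          using l r unfolding K_def nr by simp
        also have "\<dots> = (r / norm (x - y)) powr (2 * N)" using n r by (simp add: powr_minus powr_divide)
        also have "\<dots> = B powr (q / (q - 1))" unfolding B_def by (simp add: powr_powr q' del: times_divide_eq_right)
        finally show ?thesis using young_capped[of a B q] a B q by simp
      qed
      moreover have "a powr q = (1 / b powr q) * f x powr q" using f0[of x] b by (simp add: a_def powr_divide)
      ultimately have "b * r powr - \<alpha> * (a * B) \<le> b * r powr - \<alpha> * ((1 / b powr q) * f x powr q + K ((x - y) /\<^sub>R r))"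
        using b by (intro mult_left_mono) auto
      then show ?thesis using True eq by simp
    next
      case False
      then show ?thesis using b by (auto simp: K_def intro!: mult_nonneg_nonneg)
    qed
    have "(\<integral>\<^sup>+x. ennreal (if f x \<le> f y then f x / norm (x - y) powr \<alpha> else 0) \<partial>lborel)
      \<le> (\<integral>\<^sup>+x. ennreal (b * r powr - \<alpha>) * (ennreal (1 / b powr q) * ennreal (f x powr q) + ennreal (K ((x - y) /\<^sub>R r))) \<partial>lborel)"
    proof (intro nn_integral_mono)
      fix x
      have K0: "0 \<le> K ((x - y) /\<^sub>R r)" by (simp add: K_def)
      show "ennreal (if f x \<le> f y then f x / norm (x - y) powr \<alpha> else 0)
        \<le> ennreal (b * r powr - \<alpha>) * (ennreal (1 / b powr q) * ennreal (f x powr q) + ennreal (K ((x - y) /\<^sub>R r)))"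
        using pt[of x] b K0 by (simp add: ennreal_mult[symmetric] ennreal_plus[symmetric] ennreal_leI del: ennreal_plus)
    qed
    also have "\<dots> = ennreal (b * r powr - \<alpha>) * (ennreal (1 / b powr q) * (\<integral>\<^sup>+x. ennreal (f x powr q) \<partial>lborel)
        + (\<integral>\<^sup>+x. ennreal (K ((x - y) /\<^sub>R r)) \<partial>lborel))"
      by (simp add: nn_integral_cmult nn_integral_add)
    also have "(\<integral>\<^sup>+x. ennreal (K ((x - y) /\<^sub>R r)) \<partial>lborel) = ennreal (r powr N * \<kappa>)"
      using nn_integral_lborel_affine[of "\<lambda>x. ennreal (K ((x - y) /\<^sub>R r))" r y] r \<kappa>
      by (simp add: N_def powr_realpow ennreal_mult)
    also have "ennreal (b * r powr - \<alpha>) * (ennreal (1 / b powr q) * (\<integral>\<^sup>+x. ennreal (f x powr q) \<partial>lborel) + ennreal (r powr N * \<kappa>))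
      \<le> ennreal (b * r powr - \<alpha>) * (ennreal (1 / b powr q) * ennreal A + ennreal (r powr N * \<kappa>))"
      by (intro mult_left_mono add_right_mono fA) auto
    also have "\<dots> = ennreal (b * r powr - \<alpha> * (r powr N + r powr N * \<kappa>))"
      using b A \<kappa>(1) by (simp add: rN ennreal_mult[symmetric] ennreal_plus[symmetric] del: ennreal_plus)
    also have "b * r powr - \<alpha> * (r powr N + r powr N * \<kappa>) = (1 + \<kappa>) * (b * r powr (N - \<alpha>))"
      using r by (simp add: powr_diff powr_minus field_simps)
    also have "r powr (N - \<alpha>) = A powr (1 - \<alpha> / N) * b powr (- q * (1 - \<alpha> / N))"
    proof -
      have e: "1 / N * (N - \<alpha>) = 1 - \<alpha> / N" using N by (simp add: diff_divide_distrib)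
      have e2: "q / N * (N - \<alpha>) = q * (1 - \<alpha> / N)" using N by (simp add: divide_simps)
      show ?thesis unfolding r_def using A b
        by (simp add: powr_powr e e2 powr_divide powr_minus_divide del: mult_1 times_divide_eq_left)
    qed
    also have "b * (A powr (1 - \<alpha> / N) * b powr (- q * (1 - \<alpha> / N))) = A powr (1 - \<alpha> / N) * b powr (1 - q * (1 - \<alpha> / N))"
      using b by (simp add: diff_conv_add_uminus powr_add del: add_uminus_conv_diff)
    also have "1 - q * (1 - \<alpha> / N) = q - 1"
      unfolding q_def using \<alpha> N by (simp add: field_simps)
    finally show ?thesis by (simp add: b_def mult.assoc)
  qed
  show thesis by (rule that[of "1 + \<kappa>"]) (use \<kappa> main in auto)
qed

text \<open>By symmetry of the kernel, the pairs with \<open>f x \<le> f y\<close> carry at least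
  half of the integral. On them the inner integral is bounded by a multiple of
  \<open>f y powr (q - 1)\<close>, and the outer factor \<open>f y\<close> completes this to
  \<open>f y powr q\<close>, which integrates to at most \<open>A\<close>.\<close>

theorem hardy_littlewood_sobolev_diagonal:
  fixes \<alpha> :: real
  defines "N \<equiv> real DIM('a::euclidean_space)"
  defines "q \<equiv> 2 * N / (2 * N - \<alpha>)"
  assumes \<alpha>: "0 < \<alpha>" "\<alpha> < N"
  obtains C where "C > 0" "\<And>f :: 'a \<Rightarrow> real. \<And>A. \<lbrakk>f \<in> borel_measurable borel; \<And>x. 0 \<le> f x; 0 < A;
     (\<integral>\<^sup>+x. ennreal (f x powr q) \<partial>lborel) \<le> ennreal A\<rbrakk> \<Longrightarrow>
     (\<integral>\<^sup>+y. \<integral>\<^sup>+x. ennreal (f x * f y / norm (x - y) powr \<alpha>) \<partial>lborel \<partial>lborel) \<le> ennreal (C * A powr (2 / q))"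
proof -
  have N: "N > 0" unfolding N_def by simp
  have q: "q > 1" unfolding q_def using \<alpha> N by (simp add: field_simps)
  obtain C where C: "C > 0" and sub: "\<And>f :: 'a \<Rightarrow> real. \<And>A y. \<lbrakk>f \<in> borel_measurable borel; \<And>x. 0 \<le> f x; 0 < A;
     (\<integral>\<^sup>+x. ennreal (f x powr q) \<partial>lborel) \<le> ennreal A; 0 < f y\<rbrakk> \<Longrightarrow>
     (\<integral>\<^sup>+x. ennreal (if f x \<le> f y then f x / norm (x - y) powr \<alpha> else 0) \<partial>lborel)
        \<le> ennreal (C * A powr (1 - \<alpha> / N) * f y powr (q - 1))"
    using riesz_potential_sublevel[where 'a='a, of \<alpha>, folded N_def, folded q_def, OF \<alpha>] by blast
  have main: "(\<integral>\<^sup>+y. \<integral>\<^sup>+x. ennreal (f x * f y / norm (x - y) powr \<alpha>) \<partial>lborel \<partial>lborel) \<le> ennreal (2 * C * A powr (2 / q))"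
    if [measurable]: "f \<in> borel_measurable borel" and f0: "\<And>x. 0 \<le> f x" and A: "0 < A"
      and fA: "(\<integral>\<^sup>+x. ennreal (f x powr q) \<partial>lborel) \<le> ennreal A"
    for f :: "'a \<Rightarrow> real" and A
  proof -
    define G where "G x y = ennreal (if f x \<le> f y then f x * f y / norm (x - y) powr \<alpha> else 0)" for x y
    have [measurable]: "case_prod G \<in> borel_measurable (lborel \<Otimes>\<^sub>M lborel)" unfolding G_def by measurable
    have [measurable]: "case_prod (\<lambda>x y. G y x) \<in> borel_measurable (lborel \<Otimes>\<^sub>M lborel)" unfolding G_def by measurable
    have half: "(\<integral>\<^sup>+y. \<integral>\<^sup>+x. G x y \<partial>lborel \<partial>lborel) \<le> ennreal (C * A powr (2 / q))"
    proof -
      have e: "1 - \<alpha> / N + 1 = 2 / q" unfolding q_def using \<alpha> N by (simp add: divide_simps)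
      have "(\<integral>\<^sup>+x. G x y \<partial>lborel) \<le> ennreal (C * A powr (1 - \<alpha> / N)) * ennreal (f y powr q)" for y
      proof (cases "f y = 0")
        case True
        then have "G x y = 0" for x by (simp add: G_def)
        then show ?thesis by simp
      next
        case False
        then have y: "f y > 0" using f0[of y] by simp
        have "(\<integral>\<^sup>+x. G x y \<partial>lborel) = (\<integral>\<^sup>+x. ennreal (f y) * ennreal (if f x \<le> f y then f x / norm (x - y) powr \<alpha> else 0) \<partial>lborel)"
          using f0 by (intro nn_integral_cong) (auto simp: G_def ennreal_mult[symmetric] mult.commute)
        also have "\<dots> = ennreal (f y) * (\<integral>\<^sup>+x. ennreal (if f x \<le> f y then f x / norm (x - y) powr \<alpha> else 0) \<partial>lborel)"
          by (rule nn_integral_cmult) measurable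
        also have "\<dots> \<le> ennreal (f y) * ennreal (C * A powr (1 - \<alpha> / N) * f y powr (q - 1))"
          by (intro mult_left_mono sub) (use y f0 A fA in auto)
        also have "\<dots> = ennreal (C * A powr (1 - \<alpha> / N)) * ennreal (f y powr q)"
          using y C by (simp add: ennreal_mult[symmetric] powr_diff field_simps)
        finally show ?thesis .
      qed
      then have "(\<integral>\<^sup>+y. \<integral>\<^sup>+x. G x y \<partial>lborel \<partial>lborel) \<le> (\<integral>\<^sup>+y. ennreal (C * A powr (1 - \<alpha> / N)) * ennreal (f y powr q) \<partial>lborel)"
        by (intro nn_integral_mono)
      also have "\<dots> = ennreal (C * A powr (1 - \<alpha> / N)) * (\<integral>\<^sup>+y. ennreal (f y powr q) \<partial>lborel)"
        by (rule nn_integral_cmult) measurable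
      also have "\<dots> \<le> ennreal (C * A powr (1 - \<alpha> / N)) * ennreal A" by (intro mult_left_mono fA) auto
      also have "\<dots> = ennreal (C * (A powr (1 - \<alpha> / N) * A powr 1))" using A C by (simp add: ennreal_mult[symmetric])
      also have "A powr (1 - \<alpha> / N) * A powr 1 = A powr (2 / q)"
        unfolding powr_add[symmetric] e ..
      finally show ?thesis .
    qed
    have "(\<integral>\<^sup>+y. \<integral>\<^sup>+x. ennreal (f x * f y / norm (x - y) powr \<alpha>) \<partial>lborel \<partial>lborel)
      \<le> (\<integral>\<^sup>+y. \<integral>\<^sup>+x. G x y + G y x \<partial>lborel \<partial>lborel)"
      using f0 by (intro nn_integral_mono) (auto simp: G_def norm_minus_commute mult.commute)
    also have "\<dots> = (\<integral>\<^sup>+y. (\<integral>\<^sup>+x. G x y \<partial>lborel) + (\<integral>\<^sup>+x. G y x \<partial>lborel) \<partial>lborel)"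
      by (intro nn_integral_cong nn_integral_add) (simp_all add: G_def)
    also have "\<dots> = (\<integral>\<^sup>+y. \<integral>\<^sup>+x. G x y \<partial>lborel \<partial>lborel) + (\<integral>\<^sup>+y. \<integral>\<^sup>+x. G y x \<partial>lborel \<partial>lborel)"
      by (intro nn_integral_add) measurable
    also have "(\<integral>\<^sup>+y. \<integral>\<^sup>+x. G y x \<partial>lborel \<partial>lborel) = (\<integral>\<^sup>+y. \<integral>\<^sup>+x. G x y \<partial>lborel \<partial>lborel)"
      by (rule lborel_pair.Fubini') measurable
    finally have "(\<integral>\<^sup>+y. \<integral>\<^sup>+x. ennreal (f x * f y / norm (x - y) powr \<alpha>) \<partial>lborel \<partial>lborel)
       \<le> ennreal (C * A powr (2 / q)) + ennreal (C * A powr (2 / q))"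
      using half by (meson add_mono order_trans)
    then show ?thesis using C by (simp add: ennreal_plus[symmetric] algebra_simps del: ennreal_plus)
  qed
  show thesis by (rule that[of "2 * C"]) (use C main in auto)
qed


section \<open>Fourier inversion and the Plancherel identity\<close>

text \<open>The exponent has the sign of \<open>inv_fourier\<close>, and there is no normalising
  constant. For a test function, \<open>fourier\<close> is its value at \<open>- \<xi>\<close>, so
  one operator serves both directions. Applying it twice reflects the argument and multiplies by
  \<open>(2 * pi) ^ DIM('a)\<close>, which explains the arguments \<open>- x\<close> and
  \<open>- \<eta>\<close> below.\<close>

definition fourier_transform :: "('a::euclidean_space \<Rightarrow> complex) \<Rightarrow> 'a \<Rightarrow> complex"
  where "fourier_transform h x = (\<integral>\<xi>. cis (x \<bullet> \<xi>) * h \<xi> \<partial>lborel)"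

lemma cis_borel_measurable [measurable]: "cis \<in> borel_measurable borel"
  by (intro borel_measurable_continuous_onI continuous_intros)

lemma cnj_borel_measurable [measurable]: "cnj \<in> borel_measurable borel"
  by (intro borel_measurable_continuous_onI continuous_intros)

lemma lborel_integral_affine:
  fixes f :: "'a::euclidean_space \<Rightarrow> 'b::{banach, second_countable_topology}"
  assumes [measurable]: "f \<in> borel_measurable borel" and "c \<noteq> 0"
  shows "(\<integral>x. f x \<partial>lborel) = (\<bar>c\<bar> ^ DIM('a)) *\<^sub>R (\<integral>x. f (t + c *\<^sub>R x) \<partial>lborel)"
  by (subst lborel_affine[OF assms(2), of t]) (simp add: integral_density integral_distr)

lemma lborel_integrable_affine:
  fixes f :: "'a::euclidean_space \<Rightarrow> 'b::{banach, second_countable_topology}"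
  assumes f: "integrable lborel f" and c: "c \<noteq> 0"
  shows "integrable lborel (\<lambda>x. f (t + c *\<^sub>R x))"
proof -
  have [measurable]: "f \<in> borel_measurable borel" using f by simp
  have "(\<integral>\<^sup>+x. ennreal (norm (f x)) \<partial>lborel) < \<infinity>" using f by (simp add: integrable_iff_bounded)
  then have "ennreal (\<bar>c\<bar> ^ DIM('a)) * (\<integral>\<^sup>+x. ennreal (norm (f (t + c *\<^sub>R x))) \<partial>lborel) < \<infinity>"
    using nn_integral_lborel_affine[of "\<lambda>x. ennreal (norm (f x))" c t] c by simp
  then have "(\<integral>\<^sup>+x. ennreal (norm (f (t + c *\<^sub>R x))) \<partial>lborel) < \<infinity>"
    using c by (auto simp: ennreal_mult_less_top)
  then show ?thesis by (simp add: integrable_iff_bounded)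
qed

lemma integrable_cis_mult:
  assumes "integrable lborel h"
  shows "integrable lborel (\<lambda>\<xi>::'a::euclidean_space. cis (x \<bullet> \<xi>) * h \<xi>)"
  by (rule Bochner_Integration.integrable_bound[OF assms]) (use assms in \<open>auto simp: norm_mult\<close>)

lemma norm_fourier_transform_le:
  "norm (fourier_transform h x) \<le> (\<integral>\<xi>. norm (h \<xi>) \<partial>lborel)"
  unfolding fourier_transform_def
  by (rule order_trans[OF integral_norm_bound]) (simp add: norm_mult)

lemma continuous_fourier_transform:
  fixes h :: "'a::euclidean_space \<Rightarrow> complex"
  assumes h: "integrable lborel h"
  shows "continuous_on UNIV (fourier_transform h)"
proof (rule continuous_at_imp_continuous_on, intro ballI)
  fix x :: 'a
  have [measurable]: "h \<in> borel_measurable borel" using h by simp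
  show "isCont (fourier_transform h) x"
    unfolding continuous_at_sequentially o_def
  proof (intro allI impI)
    fix X :: "nat \<Rightarrow> 'a" assume X: "X \<longlonglongrightarrow> x"
    show "(\<lambda>n. fourier_transform h (X n)) \<longlonglongrightarrow> fourier_transform h x"
      unfolding fourier_transform_def
    proof (rule integral_dominated_convergence[where w="\<lambda>\<xi>. norm (h \<xi>)"])
      show "AE \<xi> in lborel. (\<lambda>n. cis (X n \<bullet> \<xi>) * h \<xi>) \<longlonglongrightarrow> cis (x \<bullet> \<xi>) * h \<xi>"
        by (intro AE_I2 tendsto_intros X)
    qed (use h in \<open>auto simp: norm_mult\<close>)
  qed
qed

lemma borel_measurable_fourier_transform [measurable_dest]:
  "integrable lborel h \<Longrightarrow> fourier_transform h \<in> borel_measurable borel"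
  by (rule borel_measurable_continuous_onI) (rule continuous_fourier_transform)

text \<open>Fubini for \<open>a x * (cis (x \<bullet> \<xi>) * b \<xi>)\<close>. It moves a
  transform from one factor to the other, in particular onto a Gaussian, whose transform is
  explicit.\<close>

lemma fourier_transform_multiplication_formula:
  fixes a b :: "'a::euclidean_space \<Rightarrow> complex"
  assumes a: "integrable lborel a" and b: "integrable lborel b"
  shows "(\<integral>x. a x * fourier_transform b x \<partial>lborel) = (\<integral>\<xi>. fourier_transform a \<xi> * b \<xi> \<partial>lborel)"
proof -
  have [measurable]: "a \<in> borel_measurable borel" "b \<in> borel_measurable borel" using a b by simp_all
  have int: "integrable (lborel \<Otimes>\<^sub>M lborel) (\<lambda>(x, \<xi>). a x * (cis (x \<bullet> \<xi>) * b \<xi>))"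
    by (rule lborel_pair.Fubini_integrable)
       (use a b in \<open>auto simp: norm_mult intro!: integrable_mult_right integrable_cis_mult\<close>)
  have "(\<integral>x. a x * fourier_transform b x \<partial>lborel) = (\<integral>x. \<integral>\<xi>. a x * (cis (x \<bullet> \<xi>) * b \<xi>) \<partial>lborel \<partial>lborel)"
    using integrable_cis_mult[OF b] by (simp add: fourier_transform_def)
  also have "\<dots> = (\<integral>\<xi>. \<integral>x. a x * (cis (x \<bullet> \<xi>) * b \<xi>) \<partial>lborel \<partial>lborel)"
    by (rule lborel_pair.Fubini_integral[symmetric]) (rule int)
  also have "\<dots> = (\<integral>\<xi>. (\<integral>x. (cis (\<xi> \<bullet> x) * a x) * b \<xi> \<partial>lborel) \<partial>lborel)"
    by (simp add: inner_commute ac_simps)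
  also have "\<dots> = (\<integral>\<xi>. fourier_transform a \<xi> * b \<xi> \<partial>lborel)"
    using integrable_cis_mult[OF a] by (simp add: fourier_transform_def)
  finally show ?thesis .
qed

section \<open>Gaussians, Fourier inversion and Plancherel\<close>

text \<open>The substitution \<open>u = v / sqrt (2 * t)\<close> turns the Gaussian into the
  standard normal density, up to \<open>sqrt (2 * pi)\<close>, and the integral into its
  characteristic function at \<open>x / c\<close>.\<close>

lemma gaussian_fourier_real:
  fixes t x :: real
  assumes t: "t > 0"
  shows "has_bochner_integral lborel (\<lambda>u. cis (x * u) * complex_of_real (exp (- t * u\<^sup>2)))
     (complex_of_real (sqrt (pi / t) * exp (- x\<^sup>2 / (4 * t))))"
proof -
  define c where "c = sqrt (2 * t)"
  have c: "c > 0" "c\<^sup>2 = 2 * t" using t by (auto simp: c_def)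
  define f where "f = (\<lambda>u. cis (x * u) * complex_of_real (exp (- t * u\<^sup>2)))"
  have [measurable]: "f \<in> borel_measurable borel" unfolding f_def by measurable
  have f_eq: "f (0 + (1 / c) * v) = sqrt (2 * pi) *\<^sub>R (std_normal_density v *\<^sub>R iexp ((x / c) * v))" for v
    using c t by (simp add: f_def std_normal_density_def cis_conv_exp power_divide scaleR_conv_of_real mult_ac)
  interpret real_distribution std_normal_distribution by (rule real_dist_normal_dist)
  have char: "(\<integral>v. std_normal_density v *\<^sub>R iexp ((x / c) * v) \<partial>lborel) = complex_of_real (exp (- ((x / c)\<^sup>2) / 2))"
    using fun_cong[OF char_std_normal_distribution, of "x / c"] unfolding char_def
    by (subst (asm) integral_density) (auto simp: normal_density_nonneg)
  have I: "integrable lborel (\<lambda>v. std_normal_density v *\<^sub>R iexp ((x / c) * v))"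
    by (rule Bochner_Integration.integrable_bound[of _ "\<lambda>v. std_normal_density v"])
       (auto simp: integrable_normal_density[of 1 0, simplified])
  have "integrable lborel (\<lambda>v. f (0 + (1 / c) * v))" unfolding f_eq by (intro integrable_scaleR_right I)
  then have int: "integrable lborel f"
    using lborel_integrable_real_affine_iff[of "1 / c" f 0] c by simp
  have "(\<integral>u. f u \<partial>lborel) = \<bar>1 / c\<bar> *\<^sub>R (\<integral>v. f (0 + (1 / c) * v) \<partial>lborel)"
    using c by (intro lborel_integral_real_affine) simp
  also have "\<dots> = \<bar>1 / c\<bar> *\<^sub>R (sqrt (2 * pi) *\<^sub>R complex_of_real (exp (- ((x / c)\<^sup>2) / 2)))"
    unfolding f_eq by (simp only: integral_scaleR_right char)
  also have "\<dots> = complex_of_real (sqrt (2 * pi) / c * exp (- ((x / c)\<^sup>2) / 2))"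
    using c by (simp add: scaleR_conv_of_real)
  also have "sqrt (2 * pi) / c = sqrt (pi / t)"
    unfolding c_def using t by (simp add: real_sqrt_divide real_sqrt_mult)
  also have "- ((x / c)\<^sup>2) / 2 = - x\<^sup>2 / (4 * t)" using c t by (simp add: power_divide)
  finally have "has_bochner_integral lborel f (complex_of_real (sqrt (pi / t) * exp (- x\<^sup>2 / (4 * t))))"
    using int by (simp only: has_bochner_integral_iff simp_thms)
  then show ?thesis unfolding f_def .
qed

text \<open>Both \<open>cis\<close> of an inner product and the Gaussian of a norm factor over the
  coordinates, and \<open>lborel\<close> is the image of a product of one-dimensional measures, so
  the integral is a product of one-dimensional ones.\<close>

lemma gaussian_fourier:
  fixes t :: real and x :: "'a::euclidean_space"
  assumes t: "t > 0"
  shows "has_bochner_integral lborel (\<lambda>\<xi>. cis (x \<bullet> \<xi>) * complex_of_real (exp (- t * (norm \<xi>)\<^sup>2)))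
     (complex_of_real (sqrt (pi / t) ^ DIM('a) * exp (- (norm x)\<^sup>2 / (4 * t))))"
proof -
  interpret product_sigma_finite "\<lambda>_::'a. lborel :: real measure" by standard
  let ?g = "\<lambda>b u. cis ((x \<bullet> b) * u) * complex_of_real (exp (- t * u\<^sup>2))"
  let ?T = "\<lambda>f. \<Sum>b\<in>Basis. f b *\<^sub>R (b::'a)"
  define F where "F = (\<lambda>\<xi>. cis (x \<bullet> \<xi>) * complex_of_real (exp (- t * (norm \<xi>)\<^sup>2)))"
  have [measurable]: "F \<in> borel_measurable borel" unfolding F_def by measurable
  have cis_sum: "cis (sum h A) = (\<Prod>b\<in>A. cis (h b))" if "finite A" for h and A :: "'a set"
    using that by induction (auto simp: cis_mult[symmetric])
  have eq: "F (?T f) = (\<Prod>b\<in>Basis. ?g b (f b))" for f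
  proof -
    have 1: "x \<bullet> ?T f = (\<Sum>b\<in>Basis. (x \<bullet> b) * f b)" by (simp add: inner_sum_right mult.commute)
    have 2: "(norm (?T f))\<^sup>2 = (\<Sum>b\<in>Basis. (f b)\<^sup>2)"
      unfolding power2_norm_eq_inner by (subst euclidean_inner) (simp add: inner_sum_left inner_Basis if_distrib cong: if_cong flip: power2_eq_square)
    show ?thesis unfolding F_def 1 2
      by (simp add: cis_sum prod.distrib exp_sum[symmetric] sum_distrib_left sum_negf[symmetric] flip: of_real_prod del: of_real_exp)
  qed
  have hb: "has_bochner_integral lborel (?g b) (complex_of_real (sqrt (pi / t) * exp (- (x \<bullet> b)\<^sup>2 / (4 * t))))" for b
    using gaussian_fourier_real[OF t, of "x \<bullet> b"] .
  have gi: "integrable lborel (?g b)" for b using hb[of b] by (simp only: has_bochner_integral_iff)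
  have gv: "integral\<^sup>L lborel (?g b) = complex_of_real (sqrt (pi / t) * exp (- (x \<bullet> b)\<^sup>2 / (4 * t)))" for b
    using hb[of b] by (rule has_bochner_integral_integral_eq)
  have "integrable (\<Pi>\<^sub>M b\<in>Basis. lborel) (\<lambda>f. F (?T f))"
    unfolding eq by (rule product_integrable_prod[OF finite_Basis gi])
  then have I: "integrable lborel F"
    by (subst lborel_eq) (simp add: integrable_distr_eq)
  have "integral\<^sup>L lborel F = (\<integral>f. F (?T f) \<partial>(\<Pi>\<^sub>M b\<in>Basis. lborel))"
    by (subst lborel_eq) (simp add: integral_distr)
  also have "\<dots> = (\<Prod>b\<in>Basis. complex_of_real (sqrt (pi / t) * exp (- (x \<bullet> b)\<^sup>2 / (4 * t))))"
    unfolding eq by (subst product_integral_prod[OF finite_Basis gi]) (simp only: gv)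
  also have "\<dots> = complex_of_real (\<Prod>b\<in>Basis. sqrt (pi / t) * exp (- (x \<bullet> b)\<^sup>2 / (4 * t)))" by simp
  also have "(\<Prod>b\<in>Basis. sqrt (pi / t) * exp (- (x \<bullet> b)\<^sup>2 / (4 * t)))
      = sqrt (pi / t) ^ DIM('a) * exp (\<Sum>b\<in>Basis. - (x \<bullet> b)\<^sup>2 / (4 * t))"
    by (simp add: prod.distrib exp_sum)
  also have "(\<Sum>b\<in>Basis. - (x \<bullet> b)\<^sup>2 / (4 * t)) = - (norm x)\<^sup>2 / (4 * t)"
    unfolding power2_norm_eq_inner
    by (subst euclidean_inner) (simp add: sum_divide_distrib[symmetric] sum_negf power2_eq_square)
  finally have "has_bochner_integral lborel F (complex_of_real (sqrt (pi / t) ^ DIM('a) * exp (- (norm x)\<^sup>2 / (4 * t))))"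
    using I by (simp only: has_bochner_integral_iff simp_thms)
  then show ?thesis unfolding F_def .
qed

lemma integrable_gaussian:
  "t > 0 \<Longrightarrow> integrable lborel (\<lambda>\<xi>::'a::euclidean_space. complex_of_real (exp (- t * (norm \<xi>)\<^sup>2)))"
  using gaussian_fourier[of t "0::'a"] by (simp add: has_bochner_integral_iff)

lemma gaussian_integral:
  "has_bochner_integral lborel (\<lambda>z::'a::euclidean_space. exp (- (norm z)\<^sup>2)) (sqrt pi ^ DIM('a))"
proof -
  have *: "has_bochner_integral lborel (\<lambda>z::'a. complex_of_real (exp (- (norm z)\<^sup>2))) (complex_of_real (sqrt pi ^ DIM('a)))"
    using gaussian_fourier[of 1 "0::'a"] by simp
  show ?thesis using has_bochner_integral_Re[OF *] by simp
qed

text \<open>Up to normalisation this is the heat semigroup at time \<open>t\<close>, written with the Gaussian rescaled to unit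
  width so that the limit \<open>t \<rightarrow> 0\<close> is a dominated one.\<close>

definition gaussian_mean :: "real \<Rightarrow> ('a::euclidean_space \<Rightarrow> complex) \<Rightarrow> 'a \<Rightarrow> complex"
  where "gaussian_mean t h \<eta> = (\<integral>z. complex_of_real (exp (- (norm z)\<^sup>2)) * h (\<eta> + (2 * sqrt t) *\<^sub>R z) \<partial>lborel)"

text \<open>The multiplication formula puts the transform on \<open>cis (\<eta> \<bullet> x)\<close>
  times the Gaussian, where it gives a bump centred at \<open>- \<eta>\<close> of width
  \<open>2 * sqrt t\<close>. Rescaling to unit width cancels all powers of \<open>t\<close>, so the
  constant is the same at all times.\<close>

lemma fourier_transform_gaussian_mult:
  fixes h :: "'a::euclidean_space \<Rightarrow> complex"
  assumes h: "integrable lborel h" and t: "t > 0"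
  shows "fourier_transform (\<lambda>x. complex_of_real (exp (- t * (norm x)\<^sup>2)) * fourier_transform h x) \<eta>
      = complex_of_real ((2 * sqrt pi) ^ DIM('a)) * gaussian_mean t h (- \<eta>)"
proof -
  have [measurable]: "h \<in> borel_measurable borel" using h by simp
  define a where "a x = cis (\<eta> \<bullet> x) * complex_of_real (exp (- t * (norm x)\<^sup>2))" for x
  have a: "integrable lborel a" unfolding a_def by (intro integrable_cis_mult integrable_gaussian t)
  have Fa: "fourier_transform a \<xi> = complex_of_real (sqrt (pi / t) ^ DIM('a) * exp (- (norm (\<xi> + \<eta>))\<^sup>2 / (4 * t)))" for \<xi>
    using has_bochner_integral_integral_eq[OF gaussian_fourier[OF t, of "\<xi> + \<eta>"]]
    unfolding fourier_transform_def a_def by (simp only: inner_add_left cis_mult[symmetric] mult.assoc)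
  have "fourier_transform (\<lambda>x. complex_of_real (exp (- t * (norm x)\<^sup>2)) * fourier_transform h x) \<eta>
      = (\<integral>x. a x * fourier_transform h x \<partial>lborel)"
    unfolding fourier_transform_def[of _ \<eta>] a_def by (simp only: mult.assoc)
  also have "\<dots> = (\<integral>\<xi>. fourier_transform a \<xi> * h \<xi> \<partial>lborel)"
    by (rule fourier_transform_multiplication_formula[OF a h])
  also have "\<dots> = (\<integral>\<xi>. complex_of_real (sqrt (pi / t) ^ DIM('a) * exp (- (norm (\<xi> + \<eta>))\<^sup>2 / (4 * t))) * h \<xi> \<partial>lborel)"
    by (simp only: Fa)
  also have "\<dots> = \<bar>2 * sqrt t\<bar> ^ DIM('a) *\<^sub>R (\<integral>z. complex_of_real (sqrt (pi / t) ^ DIM('a) *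
      exp (- (norm ((- \<eta> + (2 * sqrt t) *\<^sub>R z) + \<eta>))\<^sup>2 / (4 * t))) * h (- \<eta> + (2 * sqrt t) *\<^sub>R z) \<partial>lborel)"
  proof (rule lborel_integral_affine)
    show "2 * sqrt t \<noteq> 0" using t by simp
  qed measurable
  also have "(\<lambda>z. complex_of_real (sqrt (pi / t) ^ DIM('a) *
      exp (- (norm ((- \<eta> + (2 * sqrt t) *\<^sub>R z) + \<eta>))\<^sup>2 / (4 * t))) * h (- \<eta> + (2 * sqrt t) *\<^sub>R z))
     = (\<lambda>z. complex_of_real (sqrt (pi / t) ^ DIM('a)) * (complex_of_real (exp (- (norm z)\<^sup>2)) * h (- \<eta> + (2 * sqrt t) *\<^sub>R z)))"
  proof
    fix z
    have "- (norm ((- \<eta> + (2 * sqrt t) *\<^sub>R z) + \<eta>))\<^sup>2 / (4 * t) = - (norm z)\<^sup>2"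
      using t by (simp add: power_mult_distrib)
    then show "complex_of_real (sqrt (pi / t) ^ DIM('a) *
      exp (- (norm ((- \<eta> + (2 * sqrt t) *\<^sub>R z) + \<eta>))\<^sup>2 / (4 * t))) * h (- \<eta> + (2 * sqrt t) *\<^sub>R z)
     = complex_of_real (sqrt (pi / t) ^ DIM('a)) * (complex_of_real (exp (- (norm z)\<^sup>2)) * h (- \<eta> + (2 * sqrt t) *\<^sub>R z))"
      by (simp only: of_real_mult mult.assoc)
  qed
  also have "\<bar>2 * sqrt t\<bar> ^ DIM('a) *\<^sub>R (\<integral>z. complex_of_real (sqrt (pi / t) ^ DIM('a)) * (complex_of_real (exp (- (norm z)\<^sup>2)) * h (- \<eta> + (2 * sqrt t) *\<^sub>R z)) \<partial>lborel)
     = complex_of_real ((2 * sqrt t) ^ DIM('a) * sqrt (pi / t) ^ DIM('a)) * gaussian_mean t h (- \<eta>)"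
    using t by (simp only: gaussian_mean_def integral_mult_right_zero scaleR_conv_of_real of_real_mult mult.assoc abs_of_pos zero_less_mult_iff real_sqrt_gt_0_iff zero_less_numeral simp_thms)
  also have "(2 * sqrt t) ^ DIM('a) * sqrt (pi / t) ^ DIM('a) = (2 * sqrt pi) ^ DIM('a)"
    unfolding power_mult_distrib[symmetric] using t by (simp add: real_sqrt_divide)
  finally show ?thesis .
qed

lemma norm_gaussian_mean_le:
  fixes h :: "'a::euclidean_space \<Rightarrow> complex"
  assumes "\<And>x. norm (h x) \<le> B"
  shows "norm (gaussian_mean t h \<eta>) \<le> sqrt pi ^ DIM('a) * B"
proof -
  note g = gaussian_integral[where 'a='a, unfolded has_bochner_integral_iff, THEN conjunct1]
    gaussian_integral[where 'a='a, unfolded has_bochner_integral_iff, THEN conjunct2]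
  have "norm (gaussian_mean t h \<eta>) \<le> (\<integral>z. exp (- (norm (z::'a))\<^sup>2) * B \<partial>lborel)"
    unfolding gaussian_mean_def
  proof (rule order_trans[OF integral_norm_bound], rule integral_mono')
    show "integrable lborel (\<lambda>z::'a. exp (- (norm z)\<^sup>2) * B)" by (rule integrable_mult_left) (rule g)
    have "0 \<le> B" using assms[of undefined] norm_ge_zero order_trans by blast
    then show "0 \<le> exp (- (norm z)\<^sup>2) * B" for z :: 'a by simp
    show "norm (complex_of_real (exp (- (norm z)\<^sup>2)) * h (\<eta> + (2 * sqrt t) *\<^sub>R z)) \<le> exp (- (norm z)\<^sup>2) * B" for z
      unfolding norm_mult using assms by (intro mult_mono) auto
  qed
  also have "\<dots> = sqrt pi ^ DIM('a) * B" by (simp only: integral_mult_left_zero g)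
  finally show ?thesis .
qed

lemma gaussian_mean_tendsto:
  fixes h :: "'a::euclidean_space \<Rightarrow> complex"
  assumes h: "continuous_on UNIV h" and B: "\<And>x. norm (h x) \<le> B" and \<tau>: "\<tau> \<longlonglongrightarrow> 0"
  shows "(\<lambda>n. gaussian_mean (\<tau> n) h \<eta>) \<longlonglongrightarrow> complex_of_real (sqrt pi ^ DIM('a)) * h \<eta>"
proof -
  note g = gaussian_integral[where 'a='a, unfolded has_bochner_integral_iff, THEN conjunct1]
    gaussian_integral[where 'a='a, unfolded has_bochner_integral_iff, THEN conjunct2]
  have [measurable]: "h \<in> borel_measurable borel" by (rule borel_measurable_continuous_onI) (rule h)
  have "(\<lambda>n. gaussian_mean (\<tau> n) h \<eta>) \<longlonglongrightarrow> (\<integral>z. complex_of_real (exp (- (norm (z::'a))\<^sup>2)) * h \<eta> \<partial>lborel)"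
    unfolding gaussian_mean_def
  proof (rule integral_dominated_convergence[where w="\<lambda>z. exp (- (norm (z::'a))\<^sup>2) * B"])
    show "AE z in lborel. (\<lambda>n. complex_of_real (exp (- (norm (z::'a))\<^sup>2)) * h (\<eta> + (2 * sqrt (\<tau> n)) *\<^sub>R z))
       \<longlonglongrightarrow> complex_of_real (exp (- (norm z)\<^sup>2)) * h \<eta>"
    proof (intro AE_I2 tendsto_mult tendsto_const)
      fix z :: 'a
      have "(\<lambda>n. \<eta> + (2 * sqrt (\<tau> n)) *\<^sub>R z) \<longlonglongrightarrow> \<eta> + (2 * sqrt 0) *\<^sub>R z"
        by (intro tendsto_intros \<tau>)
      moreover have "isCont h \<eta>" using h by (simp add: continuous_on_eq_continuous_at)
      ultimately show "(\<lambda>n. h (\<eta> + (2 * sqrt (\<tau> n)) *\<^sub>R z)) \<longlonglongrightarrow> h \<eta>"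
        by (intro isCont_tendsto_compose[of \<eta> h]) auto
    qed
  qed (use g B in \<open>auto simp: norm_mult\<close>)
  also have "(\<integral>z. complex_of_real (exp (- (norm (z::'a))\<^sup>2)) * h \<eta> \<partial>lborel) = complex_of_real (sqrt pi ^ DIM('a)) * h \<eta>"
    by (simp only: integral_mult_left_zero integral_complex_of_real g)
  finally show ?thesis .
qed

text \<open>Written out, the double transform is an iterated integral to which Fubini does not
  apply. The factor \<open>exp (- \<tau> n * (norm x)\<^sup>2)\<close> regularises it: the
  regularised transform is a Gaussian mean of \<open>h\<close> and tends to a multiple of
  \<open>h (- \<eta>)\<close>, while domination by \<open>norm (fourier_transform h x)\<close>
  removes the factor on the other side.\<close>

theorem fourier_inversion:
  fixes h :: "'a::euclidean_space \<Rightarrow> complex"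
  assumes h: "continuous_on UNIV h" "\<And>x. norm (h x) \<le> B" "integrable lborel h"
    and Fh: "integrable lborel (fourier_transform h)"
  shows "fourier_transform (fourier_transform h) \<eta> = complex_of_real ((2 * pi) ^ DIM('a)) * h (- \<eta>)"
proof -
  define \<tau> :: "nat \<Rightarrow> real" where "\<tau> n = inverse (real (Suc n))" for n
  have \<tau>: "\<tau> \<longlonglongrightarrow> 0" "\<And>n. \<tau> n > 0" unfolding \<tau>_def by (rule LIMSEQ_inverse_real_of_nat) simp
  note [measurable] = borel_measurable_fourier_transform[OF h(3)]
  have "(\<lambda>n. fourier_transform (\<lambda>x. complex_of_real (exp (- \<tau> n * (norm x)\<^sup>2)) * fourier_transform h x) \<eta>)
      \<longlonglongrightarrow> fourier_transform (\<lambda>x. complex_of_real (exp (- 0 * (norm x)\<^sup>2)) * fourier_transform h x) \<eta>"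
    unfolding fourier_transform_def[of _ \<eta>]
  proof (rule integral_dominated_convergence[where w="\<lambda>x. norm (fourier_transform h x)"])
    show "AE x in lborel. (\<lambda>n. cis (\<eta> \<bullet> x) * (complex_of_real (exp (- \<tau> n * (norm x)\<^sup>2)) * fourier_transform h x))
      \<longlonglongrightarrow> cis (\<eta> \<bullet> x) * (complex_of_real (exp (- 0 * (norm x)\<^sup>2)) * fourier_transform h x)"
      by (intro AE_I2 tendsto_intros \<tau>)
    show "AE x in lborel. norm (cis (\<eta> \<bullet> x) * (complex_of_real (exp (- \<tau> n * (norm x)\<^sup>2)) * fourier_transform h x))
       \<le> norm (fourier_transform h x)" for n
      using \<tau>(2)[of n] by (intro AE_I2) (auto simp: norm_mult intro!: mult_left_le_one_le)
  qed (use Fh in auto)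
  moreover have "(\<lambda>n. fourier_transform (\<lambda>x. complex_of_real (exp (- \<tau> n * (norm x)\<^sup>2)) * fourier_transform h x) \<eta>)
      \<longlonglongrightarrow> complex_of_real ((2 * sqrt pi) ^ DIM('a)) * (complex_of_real (sqrt pi ^ DIM('a)) * h (- \<eta>))"
    unfolding fourier_transform_gaussian_mult[OF h(3) \<tau>(2)]
    by (intro tendsto_mult tendsto_const gaussian_mean_tendsto[OF h(1,2) \<tau>(1)])
  ultimately have "fourier_transform (fourier_transform h) \<eta>
      = complex_of_real ((2 * sqrt pi) ^ DIM('a)) * (complex_of_real (sqrt pi ^ DIM('a)) * h (- \<eta>))"
    by (simp add: LIMSEQ_unique)
  also have "\<dots> = complex_of_real ((2 * sqrt pi * sqrt pi) ^ DIM('a)) * h (- \<eta>)"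
    by (simp add: power_mult_distrib mult.assoc del: real_sqrt_mult_self)
  also have "2 * sqrt pi * sqrt pi = 2 * pi" by simp
  finally show ?thesis .
qed


text \<open>The transform of \<open>k x = cnj (h (- x))\<close> is the conjugate of that of
  \<open>h\<close>, so the squared modulus is a product of two transforms and the multiplication
  formula applies. As the transform of \<open>h\<close> may fail to be integrable, a Gaussian factor
  is inserted first and removed by monotone convergence, which gives the identity in
  \<open>ennreal\<close>.\<close>

theorem plancherel:
  fixes h :: "'a::euclidean_space \<Rightarrow> complex"
  assumes h: "continuous_on UNIV h" "\<And>x. norm (h x) \<le> B" "integrable lborel h"
  shows "(\<integral>\<^sup>+x. ennreal ((norm (fourier_transform h x))\<^sup>2) \<partial>lborel)
      = ennreal ((2 * pi) ^ DIM('a)) * (\<integral>\<^sup>+x. ennreal ((norm (h x))\<^sup>2) \<partial>lborel)"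
proof -
  define \<tau> :: "nat \<Rightarrow> real" where "\<tau> n = inverse (real (Suc n))" for n
  have \<tau>: "\<tau> \<longlonglongrightarrow> 0" "\<And>n. \<tau> n > 0" unfolding \<tau>_def by (rule LIMSEQ_inverse_real_of_nat) simp
  have B: "B \<ge> 0" using h(2)[of undefined] norm_ge_zero order_trans by blast
  note [measurable] = borel_measurable_fourier_transform[OF h(3)]
  have [measurable]: "h \<in> borel_measurable borel" using h by simp
  have neg: "integrable lborel (\<lambda>x. h (- x))" using lborel_integrable_affine[OF h(3), of "-1" 0] by simp
  define k where "k x = cnj (h (- x))" for x
  have k: "integrable lborel k" unfolding k_def using neg by (rule integrable_cnj)
  have [measurable]: "k \<in> borel_measurable borel" using k by simp
  have Fk: "fourier_transform k x = cnj (fourier_transform h x)" for x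
  proof -
    have "cnj (fourier_transform h x) = (\<integral>\<xi>. cnj (cis (x \<bullet> \<xi>) * h \<xi>) \<partial>lborel)"
      unfolding fourier_transform_def by (rule Bochner_Integration.integral_cnj[symmetric])
    also have "\<dots> = (\<bar>-1\<bar> ^ DIM('a)) *\<^sub>R (\<integral>\<xi>. cnj (cis (x \<bullet> (0 + (-1) *\<^sub>R \<xi>)) * h (0 + (-1) *\<^sub>R \<xi>)) \<partial>lborel)"
      by (intro lborel_integral_affine) auto
    also have "\<dots> = fourier_transform k x"
      by (simp add: fourier_transform_def k_def cis_cnj)
    finally show ?thesis ..
  qed
  define M where "M = (\<integral>\<xi>. norm (h \<xi>) \<partial>lborel)"
  have FhM: "norm (fourier_transform h x) \<le> M" for x unfolding M_def by (rule norm_fourier_transform_le)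
  let ?g = "\<lambda>n x. complex_of_real (exp (- \<tau> n * (norm x)\<^sup>2))"
  have a: "integrable lborel (\<lambda>x. ?g n x * fourier_transform h x)" for n
  proof (rule Bochner_Integration.integrable_bound[of _ "\<lambda>x. M *\<^sub>R ?g n x"])
    show "integrable lborel (\<lambda>x. M *\<^sub>R ?g n x)" by (intro integrable_scaleR_right integrable_gaussian \<tau>)
    show "AE x in lborel. norm (?g n x * fourier_transform h x) \<le> norm (M *\<^sub>R ?g n x)"
      by (intro AE_I2) (auto simp: norm_mult mult.commute intro!: mult_right_mono order_trans[OF FhM])
  qed measurable
  define c where "c = complex_of_real ((2 * sqrt pi) ^ DIM('a))"
  have step: "complex_of_real (\<integral>x. exp (- \<tau> n * (norm x)\<^sup>2) * (norm (fourier_transform h x))\<^sup>2 \<partial>lborel)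
      = (\<integral>\<eta>. c * gaussian_mean (\<tau> n) h (- \<eta>) * k \<eta> \<partial>lborel)" for n
  proof -
    have "complex_of_real (\<integral>x. exp (- \<tau> n * (norm x)\<^sup>2) * (norm (fourier_transform h x))\<^sup>2 \<partial>lborel)
      = (\<integral>x. (?g n x * fourier_transform h x) * fourier_transform k x \<partial>lborel)"
      unfolding Fk integral_complex_of_real[symmetric]
      by (simp add: complex_norm_square[symmetric] mult.assoc)
    also have "\<dots> = (\<integral>\<eta>. fourier_transform (\<lambda>x. ?g n x * fourier_transform h x) \<eta> * k \<eta> \<partial>lborel)"
      by (rule fourier_transform_multiplication_formula[OF a k])
    also have "\<dots> = (\<integral>\<eta>. c * gaussian_mean (\<tau> n) h (- \<eta>) * k \<eta> \<partial>lborel)"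
      unfolding fourier_transform_gaussian_mult[OF h(3) \<tau>(2)] c_def ..
    finally show ?thesis .
  qed
  have gm [measurable]: "(\<lambda>\<eta>. gaussian_mean (\<tau> n) h (- \<eta>)) \<in> borel_measurable borel" for n
    unfolding gaussian_mean_def by measurable
  have "(\<lambda>n. (\<integral>\<eta>. c * gaussian_mean (\<tau> n) h (- \<eta>) * k \<eta> \<partial>lborel)) \<longlonglongrightarrow>
     (\<integral>\<eta>. c * (complex_of_real (sqrt pi ^ DIM('a)) * h (- \<eta>)) * k \<eta> \<partial>lborel)"
  proof (rule integral_dominated_convergence[where w="\<lambda>x. norm c * (sqrt pi ^ DIM('a) * B) * norm (k x)"])
    show "AE \<eta> in lborel. (\<lambda>n. c * gaussian_mean (\<tau> n) h (- \<eta>) * k \<eta>)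
       \<longlonglongrightarrow> c * (complex_of_real (sqrt pi ^ DIM('a)) * h (- \<eta>)) * k \<eta>"
      by (intro AE_I2 tendsto_mult tendsto_const gaussian_mean_tendsto[OF h(1,2) \<tau>(1)])
    show "AE \<eta> in lborel. norm (c * gaussian_mean (\<tau> n) h (- \<eta>) * k \<eta>)
        \<le> norm c * (sqrt pi ^ DIM('a) * B) * norm (k \<eta>)" for n
      unfolding norm_mult by (intro AE_I2 mult_right_mono mult_left_mono norm_gaussian_mean_le h) auto
  qed (use k in auto)
  also have "(\<integral>\<eta>. c * (complex_of_real (sqrt pi ^ DIM('a)) * h (- \<eta>)) * k \<eta> \<partial>lborel)
    = (\<integral>\<eta>. complex_of_real ((2 * pi) ^ DIM('a) * (norm (h (- \<eta>)))\<^sup>2) \<partial>lborel)"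
  proof (rule Bochner_Integration.integral_cong[OF refl])
    fix \<eta>
    have "c * (complex_of_real (sqrt pi ^ DIM('a)) * h (- \<eta>)) * k \<eta>
      = complex_of_real ((2 * sqrt pi * sqrt pi) ^ DIM('a)) * (h (- \<eta>) * cnj (h (- \<eta>)))"
      by (simp add: c_def k_def power_mult_distrib mult_ac)
    also have "2 * sqrt pi * sqrt pi = 2 * pi" by simp
    finally show "c * (complex_of_real (sqrt pi ^ DIM('a)) * h (- \<eta>)) * k \<eta>
      = complex_of_real ((2 * pi) ^ DIM('a) * (norm (h (- \<eta>)))\<^sup>2)"
      by (simp only: of_real_mult complex_norm_square)
  qed
  also have "\<dots> = complex_of_real ((2 * pi) ^ DIM('a) * (\<integral>\<eta>. (norm (h (- \<eta>)))\<^sup>2 \<partial>lborel))"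
    by (simp only: integral_complex_of_real integral_mult_right_zero)
  also have "(\<integral>\<eta>. (norm (h (- \<eta>)))\<^sup>2 \<partial>lborel) = (\<integral>\<eta>. (norm (h \<eta>))\<^sup>2 \<partial>lborel)"
    using lborel_integral_affine[of "\<lambda>\<eta>. (norm (h \<eta>))\<^sup>2" "-1" 0] by simp
  finally have lim: "(\<lambda>n. (\<integral>x. exp (- \<tau> n * (norm x)\<^sup>2) * (norm (fourier_transform h x))\<^sup>2 \<partial>lborel))
     \<longlonglongrightarrow> (2 * pi) ^ DIM('a) * (\<integral>\<eta>. (norm (h \<eta>))\<^sup>2 \<partial>lborel)"
    unfolding step[symmetric] tendsto_of_real_iff .
  have h2: "integrable lborel (\<lambda>x. (norm (h x))\<^sup>2)"
  proof (rule Bochner_Integration.integrable_bound[of _ "\<lambda>x. B * norm (h x)"])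
    show "AE x in lborel. norm ((norm (h x))\<^sup>2) \<le> norm (B * norm (h x))"
      using h(2) B by (intro AE_I2) (auto simp: power2_eq_square intro!: mult_right_mono)
  qed (use h in auto)
  have g2: "integrable lborel (\<lambda>x. exp (- \<tau> n * (norm x)\<^sup>2) * (norm (fourier_transform h x))\<^sup>2)" for n
  proof (rule Bochner_Integration.integrable_bound[of _ "\<lambda>x. M\<^sup>2 *\<^sub>R ?g n x"])
    show "integrable lborel (\<lambda>x. M\<^sup>2 *\<^sub>R ?g n x)" by (intro integrable_scaleR_right integrable_gaussian \<tau>)
    show "AE x in lborel. norm (exp (- \<tau> n * (norm x)\<^sup>2) * (norm (fourier_transform h x))\<^sup>2) \<le> norm (M\<^sup>2 *\<^sub>R ?g n x)"
      by (intro AE_I2) (auto simp: mult.commute intro!: mult_right_mono power_mono FhM)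
  qed measurable
  have L1: "(\<lambda>n. ennreal (\<integral>x. exp (- \<tau> n * (norm x)\<^sup>2) * (norm (fourier_transform h x))\<^sup>2 \<partial>lborel))
    \<longlonglongrightarrow> ennreal ((2 * pi) ^ DIM('a) * (\<integral>\<eta>. (norm (h \<eta>))\<^sup>2 \<partial>lborel))"
    using lim by (rule tendsto_ennrealI)
  have L2: "ennreal (\<integral>x. exp (- \<tau> n * (norm x)\<^sup>2) * (norm (fourier_transform h x))\<^sup>2 \<partial>lborel)
     = (\<integral>\<^sup>+x. ennreal (exp (- \<tau> n * (norm x)\<^sup>2) * (norm (fourier_transform h x))\<^sup>2) \<partial>lborel)" for n
    by (rule nn_integral_eq_integral[symmetric, OF g2]) simp
  have L3: "(\<lambda>n. (\<integral>\<^sup>+x. ennreal (exp (- \<tau> n * (norm x)\<^sup>2) * (norm (fourier_transform h x))\<^sup>2) \<partial>lborel))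
     \<longlonglongrightarrow> (\<integral>\<^sup>+x. ennreal ((norm (fourier_transform h x))\<^sup>2) \<partial>lborel)"
  proof (rule nn_integral_LIMSEQ)
    have "\<tau> n \<le> \<tau> m" if "m \<le> n" for m n unfolding \<tau>_def using that by (simp add: field_simps)
    then show "incseq (\<lambda>n x. ennreal (exp (- \<tau> n * (norm x)\<^sup>2) * (norm (fourier_transform h x))\<^sup>2))"
      by (auto simp: incseq_def le_fun_def intro!: ennreal_leI mult_right_mono)
    fix x :: 'a
    have "(\<lambda>n. exp (- \<tau> n * (norm x)\<^sup>2) * (norm (fourier_transform h x))\<^sup>2)
       \<longlonglongrightarrow> exp (- 0 * (norm x)\<^sup>2) * (norm (fourier_transform h x))\<^sup>2"
      by (intro tendsto_intros \<tau>)
    then show "(\<lambda>n. ennreal (exp (- \<tau> n * (norm x)\<^sup>2) * (norm (fourier_transform h x))\<^sup>2))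
       \<longlonglongrightarrow> ennreal ((norm (fourier_transform h x))\<^sup>2)"
      by (intro tendsto_ennrealI) simp
  qed measurable
  have "(\<integral>\<^sup>+x. ennreal ((norm (fourier_transform h x))\<^sup>2) \<partial>lborel)
     = ennreal ((2 * pi) ^ DIM('a) * (\<integral>\<eta>. (norm (h \<eta>))\<^sup>2 \<partial>lborel))"
    by (rule LIMSEQ_unique[OF L3 L1[unfolded L2]])
  also have "\<dots> = ennreal ((2 * pi) ^ DIM('a)) * (\<integral>\<^sup>+x. ennreal ((norm (h x))\<^sup>2) \<partial>lborel)"
    by (simp add: ennreal_mult nn_integral_eq_integral[OF h2])
  finally show ?thesis .
qed


section \<open>Fourier transforms of test functions\<close>

lemma test_function_differentiable: "test_function f \<Longrightarrow> f differentiable (at x)"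
  unfolding test_function_def by (metis foldr_Nil id_apply)

lemma test_function_continuous: "test_function f \<Longrightarrow> continuous_on UNIV f"
  by (meson test_function_differentiable continuous_at_imp_continuous_on differentiable_imp_continuous_within)

lemma test_function_borel_measurable: "test_function f \<Longrightarrow> f \<in> borel_measurable borel"
  by (intro borel_measurable_continuous_onI test_function_continuous)

lemma partial_deriv_outside_support:
  assumes "x \<notin> closure {x. f x \<noteq> 0}"
  shows "partial_deriv i f x = 0"
proof -
  have "((\<lambda>_. 0) has_derivative (\<lambda>_. 0)) (at x)" by simp
  then have "(f has_derivative (\<lambda>_. 0)) (at x)"
  proof (rule has_derivative_transform_within_open)
    show "open (- closure {x. f x \<noteq> 0})" by auto
    show "0 = f y" if "y \<in> - closure {x. f x \<noteq> 0}" for y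
      using that closure_subset[of "{x. f x \<noteq> 0}"] by auto
  qed (use assms in auto)
  then have "frechet_derivative f (at x) = (\<lambda>_. 0)" by (metis frechet_derivative_at)
  then show ?thesis by (simp add: partial_deriv_def)
qed

lemma test_function_partial_deriv:
  assumes "test_function f"
  shows "test_function (partial_deriv i f)"
  unfolding test_function_def
proof (intro conjI allI)
  fix "is" x
  have "foldr partial_deriv (is @ [i]) f differentiable (at x)"
    using assms unfolding test_function_def by blast
  then show "foldr partial_deriv is (partial_deriv i f) differentiable (at x)" by simp
next
  have "{x. partial_deriv i f x \<noteq> 0} \<subseteq> closure {x. f x \<noteq> 0}"
    using partial_deriv_outside_support by blast
  then have "closure {x. partial_deriv i f x \<noteq> 0} \<subseteq> closure {x. f x \<noteq> 0}"
    by (rule closure_minimal) simp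
  then show "compact (closure {x. partial_deriv i f x \<noteq> 0})"
    using assms unfolding test_function_def
    by (metis closed_closure compact_Int_closed inf.absorb_iff2)
qed

lemma test_function_support:
  assumes "test_function f"
  obtains R where "R > 0" "\<And>x. R < norm x \<Longrightarrow> f x = 0"
proof -
  have "bounded (closure {x. f x \<noteq> 0})"
    using assms by (simp add: test_function_def compact_imp_bounded)
  then obtain R where R: "R > 0" "\<And>x. x \<in> closure {x. f x \<noteq> 0} \<Longrightarrow> norm x \<le> R"
    by (auto simp: bounded_pos)
  have "f x = 0" if "R < norm x" for x
    using R(2)[of x] that closure_subset[of "{x. f x \<noteq> 0}"] by force
  then show ?thesis using R(1) that by blast
qed

lemma test_function_bounded:
  assumes "test_function f"
  obtains B where "B > 0" "\<And>x. \<bar>f x\<bar> \<le> B"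
proof -
  obtain R where R: "R > 0" "\<And>x. R < norm x \<Longrightarrow> f x = 0" by (rule test_function_support[OF assms]) blast
  have "compact (f ` cball 0 R)"
    by (intro compact_continuous_image continuous_on_subset[OF test_function_continuous[OF assms]]) auto
  then obtain B where B: "B > 0" "\<And>y. y \<in> f ` cball 0 R \<Longrightarrow> norm y \<le> B"
    by (meson compact_imp_bounded bounded_pos)
  have "\<bar>f x\<bar> \<le> B" for x
    by (cases "norm x \<le> R") (use B R(2)[of x] in auto)
  then show ?thesis using B(1) that by blast
qed

lemma integrable_bounded_support:
  fixes f :: "'a::euclidean_space \<Rightarrow> 'b::{banach, second_countable_topology}"
  assumes [measurable]: "f \<in> borel_measurable borel" and B: "\<And>x. norm (f x) \<le> B" and R: "\<And>x. R < norm x \<Longrightarrow> f x = 0"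
  shows "integrable lborel f"
proof (rule Bochner_Integration.integrable_bound[of _ "\<lambda>x. B * indicator (cball 0 R) x"])
  show "integrable lborel (\<lambda>x::'a. B * indicator (cball 0 R) x)"
    by (intro integrable_mult_right integrable_real_indicator emeasure_lborel_cball_finite) auto
  show "AE x in lborel. norm (f x) \<le> norm (B * indicator (cball 0 R) x)"
    using B R by (intro AE_I2) (auto simp: indicator_def intro: order_trans[OF _ abs_ge_self])
qed simp

lemma integrable_test_function:
  assumes "test_function f"
  shows "integrable lborel (\<lambda>x. complex_of_real (f x))"
proof -
  obtain R where R: "R > 0" "\<And>x. R < norm x \<Longrightarrow> f x = 0" by (rule test_function_support[OF assms]) blast
  obtain B where B: "B > 0" "\<And>x. \<bar>f x\<bar> \<le> B" by (rule test_function_bounded[OF assms]) blast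
  note [measurable] = test_function_borel_measurable[OF assms]
  show ?thesis by (rule integrable_bounded_support[of _ B R]) (use R B in auto)
qed

section \<open>Derivatives and decay of the transform\<close>

lemma has_real_derivative_along_axis:
  assumes "test_function f"
  shows "((\<lambda>s. f (y + s *\<^sub>R axis i 1)) has_real_derivative partial_deriv i f (y + s *\<^sub>R axis i 1)) (at s)"
proof -
  let ?D = "frechet_derivative f (at (y + s *\<^sub>R axis i 1))"
  have D: "(f has_derivative ?D) (at (y + s *\<^sub>R axis i 1))"
    using test_function_differentiable[OF assms] frechet_derivative_works by blast
  have "((\<lambda>s. y + s *\<^sub>R axis i 1) has_derivative (\<lambda>h. h *\<^sub>R axis i 1)) (at s)"
    by (auto intro!: derivative_eq_intros)
  from has_derivative_compose[OF this D]
  have "((\<lambda>s. f (y + s *\<^sub>R axis i 1)) has_derivative (\<lambda>h. ?D (h *\<^sub>R axis i 1))) (at s)" by (simp add: o_def)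
  also have "(\<lambda>h. ?D (h *\<^sub>R axis i 1)) = (*) (?D (axis i 1))"
    using linear_frechet_derivative[OF test_function_differentiable[OF assms]]
    by (auto simp: linear_cmul fun_eq_iff)
  finally show ?thesis by (simp add: has_field_derivative_def partial_deriv_def)
qed

lemma fourier_transform_translate:
  assumes h: "integrable lborel h"
  shows "fourier_transform (\<lambda>y. h (y + v)) x = cis (- (x \<bullet> v)) * fourier_transform h x"
proof -
  have [measurable]: "h \<in> borel_measurable borel" using h by simp
  have "fourier_transform h x = \<bar>1\<bar> ^ DIM('a) *\<^sub>R (\<integral>y. cis (x \<bullet> (v + 1 *\<^sub>R y)) * h (v + 1 *\<^sub>R y) \<partial>lborel)"
    unfolding fourier_transform_def by (rule lborel_integral_affine) auto
  also have "\<dots> = (\<integral>y. cis (x \<bullet> v) * (cis (x \<bullet> y) * h (y + v)) \<partial>lborel)"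
    by (simp add: inner_add_right cis_mult[symmetric] add.commute mult_ac del: integral_mult_right_zero)
  also have "\<dots> = cis (x \<bullet> v) * fourier_transform (\<lambda>y. h (y + v)) x"
    by (simp add: fourier_transform_def)
  finally show ?thesis by (simp add: cis_mult mult.assoc[symmetric])
qed

text \<open>Pass to the limit in difference quotients instead of integrating by parts. A translation
  multiplies the transform by \<open>cis\<close>, so the quotient of step \<open>\<tau> n\<close>
  yields the factor \<open>(cis (- (x $ i) * \<tau> n) - 1) / \<tau> n\<close>, which tends to
  \<open>- \<i> * x $ i\<close>. On the other side dominated convergence applies: the mean value
  theorem bounds the quotients by \<open>B\<close>, and steps of length at most 1 keep them
  supported in the ball of radius \<open>R + 1\<close>.\<close>

lemma fourier_transform_partial_deriv:
  fixes f :: "real ^ 'n \<Rightarrow> real"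
  assumes f: "test_function f"
  shows "fourier_transform (\<lambda>y. complex_of_real (partial_deriv i f y)) x
       = - \<i> * complex_of_real (x $ i) * fourier_transform (\<lambda>y. complex_of_real (f y)) x"
proof -
  define e :: "real ^ 'n" where "e = axis i 1"
  define \<tau> :: "nat \<Rightarrow> real" where "\<tau> n = inverse (real (Suc n))" for n
  have \<tau>: "\<tau> \<longlonglongrightarrow> 0" "\<And>n. \<tau> n > 0" unfolding \<tau>_def by (rule LIMSEQ_inverse_real_of_nat) simp
  have \<tau>1: "\<tau> n \<le> 1" for n unfolding \<tau>_def by (simp add: field_simps)
  have \<tau>': "filterlim \<tau> (at 0) sequentially"
    using \<tau> by (auto simp: filterlim_at eventually_sequentially dest: less_imp_neq[symmetric])
  have e: "norm e = 1" unfolding e_def by (simp add: norm_axis_1)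
  obtain R where R: "R > 0" "\<And>x. R < norm x \<Longrightarrow> f x = 0" by (rule test_function_support[OF f]) blast
  obtain B where B: "B > 0" "\<And>x. \<bar>partial_deriv i f x\<bar> \<le> B"
    by (rule test_function_bounded[OF test_function_partial_deriv[OF f]]) blast
  note [measurable] = test_function_borel_measurable[OF f]
     test_function_borel_measurable[OF test_function_partial_deriv[OF f, of i]]
  define h where "h y = complex_of_real (f y)" for y
  have h: "integrable lborel h" unfolding h_def by (rule integrable_test_function[OF f])
  have [measurable]: "h \<in> borel_measurable borel" using h by simp
  define q where "q n y = (f (y + \<tau> n *\<^sub>R e) - f y) / \<tau> n" for n y
  have [measurable]: "q n \<in> borel_measurable borel" for n unfolding q_def by measurable
  have hs: "integrable lborel (\<lambda>y. h (y + v))" for v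
    using lborel_integrable_affine[OF h, of 1 v] by (simp add: add.commute)
  have Fq: "fourier_transform (\<lambda>y. complex_of_real (q n y)) x
     = ((cis (- (x $ i) * \<tau> n) - 1) / complex_of_real (\<tau> n)) * fourier_transform h x" for n
  proof -
    have "fourier_transform (\<lambda>y. complex_of_real (q n y)) x
       = (\<integral>y. (cis (x \<bullet> y) * h (y + \<tau> n *\<^sub>R e) - cis (x \<bullet> y) * h y) / complex_of_real (\<tau> n) \<partial>lborel)"
      by (simp add: fourier_transform_def q_def h_def algebra_simps)
    also have "\<dots> = (fourier_transform (\<lambda>y. h (y + \<tau> n *\<^sub>R e)) x - fourier_transform h x) / complex_of_real (\<tau> n)"
      using integrable_cis_mult[OF hs, of x "\<tau> n *\<^sub>R e"] integrable_cis_mult[OF h, of x]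
      by (simp add: fourier_transform_def Bochner_Integration.integral_diff)
    finally show ?thesis
      unfolding fourier_transform_translate[OF h]
      by (simp add: e_def inner_axis diff_divide_distrib algebra_simps)
  qed
  have "(\<lambda>n. fourier_transform (\<lambda>y. complex_of_real (q n y)) x)
     \<longlonglongrightarrow> fourier_transform (\<lambda>y. complex_of_real (partial_deriv i f y)) x"
    unfolding fourier_transform_def
  proof (rule integral_dominated_convergence[where w="\<lambda>y. B * indicator (cball 0 (R + 1)) y"])
    show "integrable lborel (\<lambda>x::real ^ 'n. B * indicator (cball 0 (R + 1)) x)"
      by (intro integrable_mult_right integrable_real_indicator emeasure_lborel_cball_finite) auto
    show "AE y in lborel. (\<lambda>n. cis (x \<bullet> y) * complex_of_real (q n y)) \<longlonglongrightarrow> cis (x \<bullet> y) * complex_of_real (partial_deriv i f y)"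
    proof (intro AE_I2 tendsto_mult tendsto_const tendsto_of_real)
      fix y
      have "((\<lambda>s. (f (y + (0 + s) *\<^sub>R e) - f (y + 0 *\<^sub>R e)) / s) \<longlongrightarrow> partial_deriv i f (y + 0 *\<^sub>R e)) (at 0)"
        using has_real_derivative_along_axis[OF f, of y i 0] unfolding e_def DERIV_def .
      from filterlim_compose[OF this \<tau>'] show "(\<lambda>n. q n y) \<longlonglongrightarrow> partial_deriv i f y"
        by (simp add: q_def)
    qed
    show "AE y in lborel. norm (cis (x \<bullet> y) * complex_of_real (q n y)) \<le> B * indicator (cball 0 (R + 1)) y" for n
    proof (rule AE_I2)
      fix y
      show "norm (cis (x \<bullet> y) * complex_of_real (q n y)) \<le> B * indicator (cball 0 (R + 1)) y"
      proof (cases "norm y \<le> R + 1")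
        case True
        obtain z where z: "f (y + \<tau> n *\<^sub>R e) - f (y + 0 *\<^sub>R e) = (\<tau> n - 0) * partial_deriv i f (y + z *\<^sub>R e)"
          using MVT2[OF \<tau>(2)[of n], of "\<lambda>s. f (y + s *\<^sub>R e)" "\<lambda>s. partial_deriv i f (y + s *\<^sub>R e)"]
            has_real_derivative_along_axis[OF f, of y i] unfolding e_def by blast
        have "q n y = partial_deriv i f (y + z *\<^sub>R e)" using z \<tau>(2)[of n] by (simp add: q_def)
        then show ?thesis using B(2) True by (simp add: norm_mult)
      next
        case False
        have "norm (\<tau> n *\<^sub>R e) \<le> 1" using e \<tau>(2)[of n] \<tau>1[of n] by simp
        then have "norm (y + \<tau> n *\<^sub>R e) > R" using False norm_diff_ineq[of y "\<tau> n *\<^sub>R e"] by simp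
        then have "q n y = 0" using R(2)[of y] R(2)[of "y + \<tau> n *\<^sub>R e"] False by (simp add: q_def)
        then show ?thesis using B(1) by simp
      qed
    qed
  qed measurable
  moreover have "(\<lambda>n. fourier_transform (\<lambda>y. complex_of_real (q n y)) x)
     \<longlonglongrightarrow> (- \<i> * complex_of_real (x $ i)) * fourier_transform h x"
    unfolding Fq
  proof (intro tendsto_mult tendsto_const)
    let ?c = "- \<i> * complex_of_real (x $ i)"
    have "((\<lambda>z. exp (?c * z)) has_field_derivative ?c) (at 0)"
      by (auto intro!: derivative_eq_intros)
    then have lim: "((\<lambda>z. (exp (?c * (0 + z)) - exp (?c * 0)) / z) \<longlongrightarrow> ?c) (at 0)"
      unfolding DERIV_def .
    have "filterlim (\<lambda>n. complex_of_real (\<tau> n)) (at 0) sequentially"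
      using \<tau> tendsto_of_real[OF \<tau>(1), where 'a=complex]
      by (auto simp: filterlim_at eventually_sequentially dest: less_imp_neq[symmetric])
    from filterlim_compose[OF lim this]
    show "(\<lambda>n. (cis (- (x $ i) * \<tau> n) - 1) / complex_of_real (\<tau> n)) \<longlonglongrightarrow> ?c"
      by (simp add: cis_conv_exp mult.assoc)
  qed
  ultimately show ?thesis unfolding h_def by (rule LIMSEQ_unique)
qed


text \<open>Each partial derivative multiplies the transform by a coordinate, so \<open>k\<close>
  derivatives in direction \<open>i\<close> control \<open>\<bar>x $ i\<bar> ^ k\<close>. The norm
  is at most \<open>N\<close> times the largest coordinate; since the index of that coordinate
  depends on \<open>x\<close>, the constants of all directions are summed.\<close>

lemma fourier_transform_test_function_decay:
  fixes f :: "real ^ 'n \<Rightarrow> real"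
  assumes f: "test_function f"
  obtains C where "C > 0" "\<And>x. norm x ^ k * norm (fourier_transform (\<lambda>y. complex_of_real (f y)) x) \<le> C"
proof -
  \<comment> \<open>Valid for every \<open>g\<close>, because the Bochner integral of a
    non-integrable function is 0.\<close>
  have bnd: "\<exists>C>0. \<forall>x. norm (fourier_transform (\<lambda>y. complex_of_real (g y)) x) \<le> C" for g :: "real ^ 'n \<Rightarrow> real"
    using norm_fourier_transform_le[of "\<lambda>y. complex_of_real (g y)"]
    by (intro exI[of _ "(\<integral>\<xi>. norm (complex_of_real (g \<xi>)) \<partial>lborel) + 1"])
       (auto intro: add_increasing2 add_nonneg_pos integral_nonneg)
  have coord: "\<exists>C>0. \<forall>x. \<bar>x $ i\<bar> ^ k * norm (fourier_transform (\<lambda>y. complex_of_real (g y)) x) \<le> C"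
    if "test_function g" for i and g :: "real ^ 'n \<Rightarrow> real"
    using that
  proof (induction k arbitrary: g)
    case 0
    then show ?case using bnd[of g] by simp
  next
    case (Suc k)
    have "norm (fourier_transform (\<lambda>y. complex_of_real (partial_deriv i g y)) x)
        = \<bar>x $ i\<bar> * norm (fourier_transform (\<lambda>y. complex_of_real (g y)) x)" for x
      unfolding fourier_transform_partial_deriv[OF Suc.prems] by (simp add: norm_mult)
    then show ?case using Suc.IH[OF test_function_partial_deriv[OF Suc.prems, of i]] by (simp add: mult.assoc mult.left_commute)
  qed
  then obtain C where C: "\<And>i. C i > 0" "\<And>i x. \<bar>x $ i\<bar> ^ k * norm (fourier_transform (\<lambda>y. complex_of_real (f y)) x) \<le> C i"
    using f by metis
  define N where "N = real CARD('n)"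
  have "norm x ^ k * norm (fourier_transform (\<lambda>y. complex_of_real (f y)) x) \<le> N ^ k * (\<Sum>i\<in>UNIV. C i)" for x :: "real ^ 'n"
  proof -
    obtain j where j: "\<And>i. \<bar>x $ i\<bar> \<le> \<bar>x $ j\<bar>"
    proof -
      have "Max (range (\<lambda>i. \<bar>x $ i\<bar>)) \<in> range (\<lambda>i. \<bar>x $ i\<bar>)" by (intro Max_in) auto
      then obtain j where j: "Max (range (\<lambda>i. \<bar>x $ i\<bar>)) = \<bar>x $ j\<bar>" by (rule imageE)
      have "\<bar>x $ i\<bar> \<le> \<bar>x $ j\<bar>" for i unfolding j[symmetric] by (rule Max_ge) auto
      then show thesis by (rule that)
    qed
    have "norm x \<le> (\<Sum>i\<in>UNIV. \<bar>x $ i\<bar>)" using norm_le_l1_cart[of x] by simp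
    also have "\<dots> \<le> N * \<bar>x $ j\<bar>" using sum_bounded_above[of UNIV "\<lambda>i. \<bar>x $ i\<bar>" "\<bar>x $ j\<bar>"] j by (simp add: N_def)
    finally have "norm x ^ k \<le> (N * \<bar>x $ j\<bar>) ^ k" by (intro power_mono) auto
    then have "norm x ^ k * norm (fourier_transform (\<lambda>y. complex_of_real (f y)) x)
       \<le> (N * \<bar>x $ j\<bar>) ^ k * norm (fourier_transform (\<lambda>y. complex_of_real (f y)) x)"
      by (intro mult_right_mono) auto
    also have "\<dots> = N ^ k * (\<bar>x $ j\<bar> ^ k * norm (fourier_transform (\<lambda>y. complex_of_real (f y)) x))"
      by (simp add: power_mult_distrib)
    also have "\<dots> \<le> N ^ k * C j" by (intro mult_left_mono C) (simp add: N_def)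
    also have "C j \<le> (\<Sum>i\<in>UNIV. C i)" using C(1) by (intro member_le_sum) (auto intro: less_imp_le)
    finally show ?thesis by (simp add: N_def mult_left_mono)
  qed
  moreover have "(\<Sum>i\<in>UNIV. C i) > 0" using C(1) by (intro sum_pos) auto
  moreover have "N > 0" by (simp add: N_def)
  ultimately show thesis by (intro that[of "N ^ k * (\<Sum>i\<in>UNIV. C i)"]) auto
qed

text \<open>Decay of order \<open>k > N + a\<close> bounds the weighted transform by a multiple of
  \<open>norm x powr (a - k)\<close> at infinity, which is integrable; near the origin boundedness
  is enough. For \<open>a = s\<close> this is, up to a reflection, the function that
  \<open>frac_laplacian (s / 2)\<close> transforms back.\<close>

lemma fourier_transform_test_function_powr:
  fixes f :: "real ^ 'n \<Rightarrow> real"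
  assumes f: "test_function f" and a: "a \<ge> 0"
  defines "H \<equiv> fourier_transform (\<lambda>y. complex_of_real (f y))"
  shows "integrable lborel (\<lambda>x. complex_of_real (norm x powr a) * H x)"
    and "\<exists>B. \<forall>x. norm (complex_of_real (norm x powr a) * H x) \<le> B"
proof -
  obtain k :: nat where k: "real k > CARD('n) + a" using reals_Archimedean2 by blast
  have cont: "continuous_on UNIV H" unfolding H_def
    by (intro continuous_fourier_transform integrable_test_function f)
  then have [measurable]: "H \<in> borel_measurable borel" by (rule borel_measurable_continuous_onI)
  obtain C where C: "C > 0" "\<And>x. norm x ^ k * norm (H x) \<le> C"
    unfolding H_def using fourier_transform_test_function_decay[OF f] by blast
  obtain C0 where C0: "C0 > 0" "\<And>x. norm (H x) \<le> C0"
    unfolding H_def using fourier_transform_test_function_decay[OF f, of 0] by auto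
  let ?K = "\<lambda>x::real ^ 'n. if norm x < 1 then norm x powr - 0 else norm x powr - (real k - a)"
  have le: "norm x powr a * norm (H x) \<le> (C + C0) * ?K x" if "x \<noteq> 0" for x
  proof (cases "norm x < 1")
    case True
    have "norm x powr a * norm (H x) \<le> 1 * C0"
      using True a C0 by (intro mult_mono powr_le1) auto
    then show ?thesis using True that C by simp
  next
    case False
    have "norm x powr a * norm (H x) = norm x powr - (real k - a) * (norm x ^ k * norm (H x))"
      using that by (simp add: powr_realpow[symmetric] powr_add[symmetric] mult.assoc[symmetric])
    also have "\<dots> \<le> norm x powr - (real k - a) * (C + C0)"
      using C C0 by (intro mult_left_mono) (auto intro: order_trans[OF C(2)])
    finally show ?thesis using False by (simp add: mult.commute)
  qed
  show "\<exists>B. \<forall>x. norm (complex_of_real (norm x powr a) * H x) \<le> B"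
  proof (intro exI allI)
    fix x
    show "norm (complex_of_real (norm x powr a) * H x) \<le> C + C0"
    proof (cases "x = 0")
      case False
      have "norm x powr - (real k - a) \<le> 1 powr - (real k - a)" if "\<not> norm x < 1"
        using that k a by (intro powr_mono2') auto
      then have "?K x \<le> 1" using False by auto
      then have "(C + C0) * ?K x \<le> C + C0" using C C0 by (intro mult_left_le) auto
      then show ?thesis using le[OF False] by (simp add: norm_mult)
    qed (use C C0 in auto)
  qed
  have K: "integrable lborel ?K"
  proof (rule integrableI_bounded)
    have "norm (?K x) = ?K x" for x by simp
    then show "(\<integral>\<^sup>+x. ennreal (norm (?K x)) \<partial>lborel) < \<infinity>"
      using nn_integral_radial_powr_finite[where 'a="real ^ 'n", of 0 "real k - a"] k a by simp
  qed measurable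
  have ne: "AE x in lborel. x \<noteq> (0 :: real ^ 'n)"
    by (rule AE_lborel_singleton)
  show "integrable lborel (\<lambda>x. complex_of_real (norm x powr a) * H x)"
  proof (rule Bochner_Integration.integrable_bound[of _ "\<lambda>x. (C + C0) * ?K x"])
    show "integrable lborel (\<lambda>x. (C + C0) * ?K x)" by (intro integrable_mult_right K)
    show "AE x in lborel. norm (complex_of_real (norm x powr a) * H x) \<le> norm ((C + C0) * ?K x)"
      using ne
    proof eventually_elim
      case (elim x)
      have *: "norm (complex_of_real (norm x powr a) * H x) = norm x powr a * norm (H x)" by (simp add: norm_mult)
      show ?case unfolding * real_norm_def by (rule order_trans[OF le[OF elim] abs_ge_self])
    qed
  qed measurable
qed

lemma integrable_fourier_transform_test_function:
  fixes f :: "real ^ 'n \<Rightarrow> real"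
  assumes f: "test_function f"
  shows "integrable lborel (fourier_transform (\<lambda>y. complex_of_real (f y)))"
proof -
  let ?H = "fourier_transform (\<lambda>y. complex_of_real (f y))"
  have [measurable]: "?H \<in> borel_measurable borel"
    by (intro borel_measurable_fourier_transform integrable_test_function f)
  \<comment> \<open>The case \<open>a = 0\<close> of the previous lemma can differ from
    \<open>?H\<close> at the origin only, where \<open>norm x powr 0\<close> is 0 and not 1.\<close>
  have "AE x in lborel. x \<noteq> (0 :: real ^ 'n)" by (rule AE_lborel_singleton)
  then have "AE x in lborel. complex_of_real (norm x powr 0) * ?H x = ?H x"
    by eventually_elim simp
  then show ?thesis
    by (intro integrable_cong_AE_imp[OF fourier_transform_test_function_powr(1)[OF f, of 0]]) auto
qed


section \<open>The refined Sobolev inequality for test functions\<close>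

text \<open>A single term of the exponential series,
  \<open>exp (4 ^ k) \<ge> (4 ^ k) ^ j / fact j\<close>, bounds the Gaussian on dyadic shells by a
  geometric sequence whose ratio \<open>1 / 4 ^ j\<close> can be made as small as desired. The
  factor \<open>4 ^ j\<close> pays for indexing by the outer radius of the shell.\<close>

lemma exp_le_dyadic:
  fixes r :: real
  assumes "r \<ge> 0"
  obtains k :: nat where "r < 2 ^ k" "exp (- r\<^sup>2) \<le> fact j * 4 ^ j * (1 / 4 ^ j) ^ k"
proof (cases "r < 1")
  case True
  have "exp (- r\<^sup>2) \<le> 1" by simp
  also have "1 \<le> fact j * (4 ^ j :: real)" using mult_mono[of 1 "fact j" 1 "4 ^ j :: real"] by (simp add: fact_ge_1)
  finally show ?thesis using True by (intro that[of 0]) auto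
next
  case False
  then obtain k where k: "2 ^ k \<le> r" "r < 2 ^ Suc k" using dyadic_shell[of r] by auto
  have "(4 ^ k) ^ j / fact j \<le> exp (4 ^ k :: real)"
    using sum_le_suminf[OF summable_exp_generic[of "4 ^ k :: real"], of "{j}"]
    by (simp add: exp_def divide_inverse mult.commute)
  moreover have "exp (4 ^ k :: real) \<le> exp (r\<^sup>2)"
  proof -
    have "(2 ^ k)\<^sup>2 \<le> r\<^sup>2" using k(1) by (intro power_mono) auto
    moreover have "(2 ^ k)\<^sup>2 = (4 ^ k :: real)" by (simp add: power2_eq_square power_mult_distrib[symmetric])
    ultimately show ?thesis by simp
  qed
  ultimately have "(4 ^ k) ^ j / fact j \<le> exp (r\<^sup>2)" by linarith
  then have "exp (- r\<^sup>2) \<le> fact j / (4 ^ k) ^ j" by (simp add: exp_minus field_simps)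
  also have "\<dots> = fact j * 4 ^ j * (1 / 4 ^ j) ^ Suc k"
    by (simp add: power_divide power_mult[symmetric] mult.commute)
  finally show ?thesis using k(2) that by blast
qed

text \<open>Majorise the Gaussian by a sum of multiples of indicators of balls of radius
  \<open>2 ^ k\<close>. The change of variables turns these into balls of radius
  \<open>c * 2 ^ k\<close> with \<open>c = 2 * sqrt t\<close>, on which the hypothesis gives
  \<open>M * c powr (\<kappa> - N) * (2 ^ k) powr \<kappa>\<close>. The sum over \<open>k\<close> is
  geometric, and the power of \<open>c\<close> becomes the power of \<open>t\<close>.\<close>

lemma gaussian_mean_morrey:
  fixes \<kappa> :: real
  obtains C where "C > 0"
    "\<And>(f :: 'a::euclidean_space \<Rightarrow> real) M t x. \<lbrakk>f \<in> borel_measurable borel; 0 \<le> M; 0 < t;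
       \<And>x R. 0 < R \<Longrightarrow> (\<integral>\<^sup>+y. ennreal \<bar>f y\<bar> * indicator (ball x R) y \<partial>lborel) \<le> ennreal (M * R powr \<kappa>)\<rbrakk> \<Longrightarrow>
       norm (gaussian_mean t (\<lambda>y. complex_of_real (f y)) x) \<le> C * M * t powr ((\<kappa> - DIM('a)) / 2)"
proof -
  define N where "N = real DIM('a)"
  \<comment> \<open>\<open>2 * j > \<kappa>\<close> lets the decay \<open>(1 / 4 ^ j) ^ k\<close> of
    the Gaussian beat the growth \<open>(2 ^ k) powr \<kappa>\<close> over the balls; the resulting
    ratio is \<rho>.\<close>
  obtain j :: nat where j: "\<kappa> < 2 * real j" using reals_Archimedean2[of "\<kappa> / 2"] by (auto simp: mult.commute)
  define A :: real where "A = fact j * 4 ^ j"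
  have A: "A > 0" by (simp add: A_def)
  define \<rho> where "\<rho> = 2 powr (\<kappa> - 2 * real j)"
  have \<rho>: "0 < \<rho>" "\<rho> < 1" using j by (auto simp: \<rho>_def powr_less_one)
  have \<rho>_eq: "(1 / 4 ^ j) ^ k * (2 ^ k) powr \<kappa> = \<rho> ^ k" for k
  proof -
    have "(1 / 4 ^ j :: real) = 2 powr (- 2 * real j)"
      by (simp add: powr_minus powr_realpow[symmetric] divide_inverse powr_powr[symmetric])
    moreover have "(2 ^ k :: real) powr \<kappa> = (2 powr \<kappa>) ^ k"
      by (simp add: powr_realpow[symmetric] powr_powr mult.commute)
    ultimately have "(1 / 4 ^ j) ^ k * (2 ^ k) powr \<kappa> = (2 powr (- 2 * real j) * 2 powr \<kappa>) ^ k"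
      by (simp only: power_mult_distrib)
    also have "2 powr (- 2 * real j) * 2 powr \<kappa> = \<rho>" unfolding \<rho>_def powr_add[symmetric] by simp
    finally show ?thesis .
  qed
  define C where "C = A * 2 powr (\<kappa> - N) / (1 - \<rho>)"
  have "C > 0" using A \<rho> by (simp add: C_def)
  moreover have "norm (gaussian_mean t (\<lambda>y. complex_of_real (f y)) x) \<le> C * M * t powr ((\<kappa> - DIM('a)) / 2)"
    if [measurable]: "f \<in> borel_measurable borel" and M: "0 \<le> M" and t: "0 < t"
      and f: "\<And>x R. 0 < R \<Longrightarrow> (\<integral>\<^sup>+y. ennreal \<bar>f y\<bar> * indicator (ball x R) y \<partial>lborel) \<le> ennreal (M * R powr \<kappa>)"
    for f :: "'a \<Rightarrow> real" and M t x
  proof -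
    define c where "c = 2 * sqrt t"
    have c: "c > 0" using t by (simp add: c_def)
    have ball: "(\<integral>\<^sup>+z. ennreal \<bar>f (x + c *\<^sub>R z)\<bar> * indicator (ball 0 (2 ^ k)) z \<partial>lborel)
        \<le> ennreal (M * c powr (\<kappa> - N) * (2 ^ k) powr \<kappa>)" for k
    proof -
      let ?I = "\<integral>\<^sup>+z. ennreal \<bar>f (x + c *\<^sub>R z)\<bar> * indicator (ball 0 (2 ^ k)) z \<partial>lborel"
      have "(\<integral>\<^sup>+y. ennreal \<bar>f y\<bar> * indicator (ball x (c * 2 ^ k)) y \<partial>lborel)
         = ennreal (\<bar>c\<bar> ^ DIM('a)) * (\<integral>\<^sup>+z. ennreal \<bar>f (x + c *\<^sub>R z)\<bar> * indicator (ball x (c * 2 ^ k)) (x + c *\<^sub>R z) \<partial>lborel)"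
        using c by (intro nn_integral_lborel_affine borel_measurable_times_ennreal borel_measurable_indicator) auto
      also have "(\<lambda>z. ennreal \<bar>f (x + c *\<^sub>R z)\<bar> * indicator (ball x (c * 2 ^ k)) (x + c *\<^sub>R z))
         = (\<lambda>z. ennreal \<bar>f (x + c *\<^sub>R z)\<bar> * indicator (ball 0 (2 ^ k)) z)"
        using c by (auto simp: fun_eq_iff indicator_def dist_norm)
      finally have "ennreal (\<bar>c\<bar> ^ DIM('a)) * ?I \<le> ennreal (M * (c * 2 ^ k) powr \<kappa>)"
        using f[of "c * 2 ^ k" x] c by simp
      then have "ennreal (c powr - N) * (ennreal (\<bar>c\<bar> ^ DIM('a)) * ?I)
         \<le> ennreal (c powr - N) * ennreal (M * (c * 2 ^ k) powr \<kappa>)"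
        by (rule mult_left_mono) simp
      also have "ennreal (c powr - N) * (ennreal (\<bar>c\<bar> ^ DIM('a)) * ?I) = ?I"
        using c by (simp add: mult.assoc[symmetric] ennreal_mult[symmetric] N_def powr_minus powr_realpow)
      also have "ennreal (c powr - N) * ennreal (M * (c * 2 ^ k) powr \<kappa>) = ennreal (M * c powr (\<kappa> - N) * (2 ^ k) powr \<kappa>)"
        using c M by (simp add: ennreal_mult[symmetric] powr_mult powr_diff powr_minus divide_inverse mult_ac)
      finally show ?thesis .
    qed
    have pt: "ennreal (exp (- (norm z)\<^sup>2)) \<le> (\<Sum>k. ennreal (A * (1 / 4 ^ j) ^ k) * indicator (ball 0 (2 ^ k)) z)" for z :: 'a
    proof -
      obtain k where k: "norm z < 2 ^ k" "exp (- (norm z)\<^sup>2) \<le> A * (1 / 4 ^ j) ^ k"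
        unfolding A_def by (rule exp_le_dyadic[of "norm z" j]) auto
      then have "ennreal (exp (- (norm z)\<^sup>2)) \<le> ennreal (A * (1 / 4 ^ j) ^ k) * indicator (ball 0 (2 ^ k)) z"
        by (simp add: ennreal_leI)
      also have "\<dots> \<le> (\<Sum>k. ennreal (A * (1 / 4 ^ j) ^ k) * indicator (ball 0 (2 ^ k)) z)"
        by (rule term_le_suminf_ennreal)
      finally show ?thesis .
    qed
    have nn: "(\<integral>\<^sup>+z. ennreal (exp (- (norm z)\<^sup>2) * \<bar>f (x + c *\<^sub>R z)\<bar>) \<partial>lborel) \<le> ennreal (C * M * t powr ((\<kappa> - N) / 2))"
    proof -
      have "(\<integral>\<^sup>+z. ennreal (exp (- (norm z)\<^sup>2) * \<bar>f (x + c *\<^sub>R z)\<bar>) \<partial>lborel)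
        \<le> (\<integral>\<^sup>+z. (\<Sum>k. ennreal (A * (1 / 4 ^ j) ^ k) * (ennreal \<bar>f (x + c *\<^sub>R z)\<bar> * indicator (ball 0 (2 ^ k)) z)) \<partial>lborel)"
      proof (intro nn_integral_mono)
        fix z
        have "ennreal (exp (- (norm z)\<^sup>2) * \<bar>f (x + c *\<^sub>R z)\<bar>)
          \<le> (\<Sum>k. ennreal (A * (1 / 4 ^ j) ^ k) * indicator (ball 0 (2 ^ k)) z) * ennreal \<bar>f (x + c *\<^sub>R z)\<bar>"
          using mult_right_mono[OF pt[of z], of "ennreal \<bar>f (x + c *\<^sub>R z)\<bar>"]
          by (subst ennreal_mult) auto
        also have "\<dots> = (\<Sum>k. ennreal (A * (1 / 4 ^ j) ^ k) * (ennreal \<bar>f (x + c *\<^sub>R z)\<bar> * indicator (ball 0 (2 ^ k)) z))"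
          by (subst ennreal_suminf_multc[symmetric]) (simp add: mult_ac)
        finally show "ennreal (exp (- (norm z)\<^sup>2) * \<bar>f (x + c *\<^sub>R z)\<bar>)
          \<le> (\<Sum>k. ennreal (A * (1 / 4 ^ j) ^ k) * (ennreal \<bar>f (x + c *\<^sub>R z)\<bar> * indicator (ball 0 (2 ^ k)) z))" .
      qed
      also have "\<dots> = (\<Sum>k. ennreal (A * (1 / 4 ^ j) ^ k) * (\<integral>\<^sup>+z. ennreal \<bar>f (x + c *\<^sub>R z)\<bar> * indicator (ball 0 (2 ^ k)) z \<partial>lborel))"
      proof -
        have meas: "(\<lambda>z. ennreal \<bar>f (x + c *\<^sub>R z)\<bar> * indicator (ball 0 (2 ^ k)) z) \<in> borel_measurable lborel" for k :: nat
          by (intro borel_measurable_times_ennreal borel_measurable_indicator) auto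
        show ?thesis
          by (subst nn_integral_suminf)
            (simp_all only: nn_integral_cmult[OF meas] borel_measurable_times_ennreal[OF borel_measurable_const meas])
      qed
      also have "\<dots> \<le> (\<Sum>k. ennreal (A * (1 / 4 ^ j) ^ k) * ennreal (M * c powr (\<kappa> - N) * (2 ^ k) powr \<kappa>))"
        by (intro suminf_le mult_left_mono ball) auto
      also have "\<dots> = (\<Sum>k. ennreal (A * (M * c powr (\<kappa> - N)) * \<rho> ^ k))"
        using A M by (intro suminf_cong) (simp add: ennreal_mult[symmetric] \<rho>_eq[symmetric] mult_ac)
      also have "\<dots> = ennreal (A * (M * c powr (\<kappa> - N)) * (1 / (1 - \<rho>)))"
      proof (rule suminf_ennreal_eq)
        show "(\<lambda>k. A * (M * c powr (\<kappa> - N)) * \<rho> ^ k) sums (A * (M * c powr (\<kappa> - N)) * (1 / (1 - \<rho>)))"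
          using \<rho> by (intro sums_mult geometric_sums) auto
      qed (use A M \<rho> in auto)
      also have "c powr (\<kappa> - N) = 2 powr (\<kappa> - N) * t powr ((\<kappa> - N) / 2)"
        using t by (simp add: c_def powr_mult powr_half_sqrt[symmetric] powr_powr)
      also have "A * (M * (2 powr (\<kappa> - N) * t powr ((\<kappa> - N) / 2))) * (1 / (1 - \<rho>)) = C * M * t powr ((\<kappa> - N) / 2)"
        by (simp add: C_def)
      finally show ?thesis .
    qed
    have "norm (gaussian_mean t (\<lambda>y. complex_of_real (f y)) x) \<le> C * M * t powr ((\<kappa> - N) / 2)"
    \<comment> \<open>For an integrand that is not integrable the mean is 0 by the convention of the
      Bochner integral.\<close>
    proof (cases "integrable lborel (\<lambda>z. complex_of_real (exp (- (norm z)\<^sup>2)) * complex_of_real (f (x + (2 * sqrt t) *\<^sub>R z)))")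
      case True
      have "ennreal (norm (gaussian_mean t (\<lambda>y. complex_of_real (f y)) x))
         \<le> (\<integral>\<^sup>+z. ennreal (norm (complex_of_real (exp (- (norm z)\<^sup>2)) * complex_of_real (f (x + (2 * sqrt t) *\<^sub>R z)))) \<partial>lborel)"
        unfolding gaussian_mean_def by (rule integral_norm_bound_ennreal[OF True])
      also have "\<dots> \<le> ennreal (C * M * t powr ((\<kappa> - N) / 2))"
        using nn by (simp add: norm_mult c_def)
      finally show ?thesis using \<open>C > 0\<close> M by (simp add: ennreal_le_iff)
    next
      case False
      then have "gaussian_mean t (\<lambda>y. complex_of_real (f y)) x = 0"
        unfolding gaussian_mean_def by (rule not_integrable_integral_eq)
      then show ?thesis using \<open>C > 0\<close> M by simp
    qed
    then show ?thesis by (simp add: N_def)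
  qed
  ultimately show thesis by (rule that)
qed


text \<open>The power \<open>m\<close> makes the multiplier vanish at \<open>0\<close> to an order exceeding \<open>s\<close>; the exponent
  \<open>m = 1\<close> would only cover \<open>s < 2\<close>.\<close>

definition high_pass :: "nat \<Rightarrow> real \<Rightarrow> 'a::euclidean_space \<Rightarrow> real"
  where "high_pass m t \<xi> = (1 - exp (- t * (norm \<xi>)\<^sup>2)) ^ m"

section \<open>The high-pass multiplier and its action on test functions\<close>

lemma high_pass_bounds:
  assumes "t \<ge> 0"
  shows "0 \<le> high_pass m t \<xi>" "high_pass m t \<xi> \<le> 1" "high_pass m t \<xi> \<le> (t * (norm \<xi>)\<^sup>2) ^ m"
proof -
  have "exp (- t * (norm \<xi>)\<^sup>2) \<le> 1" using assms by simp
  moreover have "1 - exp (- t * (norm \<xi>)\<^sup>2) \<le> t * (norm \<xi>)\<^sup>2"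
    using exp_ge_add_one_self[of "- t * (norm \<xi>)\<^sup>2"] by simp
  ultimately show "0 \<le> high_pass m t \<xi>" "high_pass m t \<xi> \<le> 1" "high_pass m t \<xi> \<le> (t * (norm \<xi>)\<^sup>2) ^ m"
    unfolding high_pass_def by (auto intro!: power_le_one power_mono)
qed

lemma high_pass_binomial:
  "high_pass m t \<xi> = (\<Sum>j\<le>m. (real (m choose j) * (- 1) ^ j) * exp (- (real j * t) * (norm \<xi>)\<^sup>2))"
proof -
  have "high_pass m t \<xi> = ((- exp (- t * (norm \<xi>)\<^sup>2)) + 1) ^ m" by (simp add: high_pass_def)
  also have "\<dots> = (\<Sum>j\<le>m. real (m choose j) * (- exp (- t * (norm \<xi>)\<^sup>2)) ^ j)"
    by (subst binomial_ring) simp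
  also have "\<dots> = (\<Sum>j\<le>m. (real (m choose j) * (- 1) ^ j) * exp (- (real j * t) * (norm \<xi>)\<^sup>2))"
  proof (rule sum.cong[OF refl])
    fix j
    have "(- exp (- t * (norm \<xi>)\<^sup>2)) ^ j = (- 1) ^ j * exp (- t * (norm \<xi>)\<^sup>2) ^ j"
      by (rule power_minus)
    also have "exp (- t * (norm \<xi>)\<^sup>2) ^ j = exp (- (real j * t) * (norm \<xi>)\<^sup>2)"
      unfolding exp_of_nat_mult[symmetric] by (simp add: mult.assoc)
    finally show "real (m choose j) * (- exp (- t * (norm \<xi>)\<^sup>2)) ^ j
       = (real (m choose j) * (- 1) ^ j) * exp (- (real j * t) * (norm \<xi>)\<^sup>2)" by simp
  qed
  finally show ?thesis .
qed

text \<open>The binomial theorem expands the multiplier into Gaussians of times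
  \<open>j * t\<close>. The term \<open>j = 0\<close> is the constant 1 and is evaluated by
  inversion; the others become Gaussian means. So the high-frequency part is, up to constants,
  \<open>h\<close> plus a signed combination of its averages, all taken at the reflected
  point.\<close>

lemma fourier_transform_high_pass:
  fixes h :: "'a::euclidean_space \<Rightarrow> complex"
  assumes h: "continuous_on UNIV h" "\<And>x. norm (h x) \<le> B" "integrable lborel h"
    and Fh: "integrable lborel (fourier_transform h)" and t: "t > 0"
  shows "fourier_transform (\<lambda>\<xi>. complex_of_real (high_pass m t \<xi>) * fourier_transform h \<xi>) x
     = complex_of_real ((2 * pi) ^ DIM('a)) * h (- x)
       + (\<Sum>j\<in>{1..m}. complex_of_real (real (m choose j) * (- 1) ^ j) *
            (complex_of_real ((2 * sqrt pi) ^ DIM('a)) * gaussian_mean (real j * t) h (- x)))"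
proof -
  let ?H = "fourier_transform h"
  let ?c = "\<lambda>j. complex_of_real (real (m choose j) * (- 1) ^ j)"
  let ?g = "\<lambda>j \<xi>. complex_of_real (exp (- (real j * t) * (norm \<xi>)\<^sup>2)) * ?H \<xi>"
  have [measurable]: "?H \<in> borel_measurable borel" using Fh by simp
  have int: "integrable lborel (?g j)" for j
    by (rule Bochner_Integration.integrable_bound[OF Fh])
       (use t in \<open>auto simp: norm_mult intro!: mult_left_le_one_le\<close>)
  have "fourier_transform (\<lambda>\<xi>. complex_of_real (high_pass m t \<xi>) * ?H \<xi>) x
    = (\<integral>\<xi>. (\<Sum>j\<le>m. ?c j * (cis (x \<bullet> \<xi>) * ?g j \<xi>)) \<partial>lborel)"
    unfolding fourier_transform_def[of _ x] high_pass_binomial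
    by (simp only: of_real_sum of_real_mult sum_distrib_left sum_distrib_right mult_ac)
  also have "\<dots> = (\<Sum>j\<le>m. \<integral>\<xi>. ?c j * (cis (x \<bullet> \<xi>) * ?g j \<xi>) \<partial>lborel)"
    by (intro Bochner_Integration.integral_sum integrable_mult_right integrable_cis_mult int)
  also have "\<dots> = (\<Sum>j\<le>m. ?c j * fourier_transform (?g j) x)"
    by (simp only: integral_mult_right_zero fourier_transform_def[of _ x])
  also have "\<dots> = ?c 0 * fourier_transform (?g 0) x + (\<Sum>j\<in>{1..m}. ?c j * fourier_transform (?g j) x)"
  proof -
    have "{..m} = insert 0 {1..m}" by auto
    then show ?thesis by (simp only:) (rule sum.insert, auto)
  qed
  also have "?c 0 * fourier_transform (?g 0) x = complex_of_real ((2 * pi) ^ DIM('a)) * h (- x)"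
    using fourier_inversion[OF h Fh, of x] by simp
  also have "(\<Sum>j\<in>{1..m}. ?c j * fourier_transform (?g j) x)
     = (\<Sum>j\<in>{1..m}. ?c j * (complex_of_real ((2 * sqrt pi) ^ DIM('a)) * gaussian_mean (real j * t) h (- x)))"
    by (intro sum.cong refl arg_cong2[where f="(*)"] fourier_transform_gaussian_mult[OF h(3)]) (use t in auto)
  finally show ?thesis .
qed

text \<open>Solve the previous identity for the value at \<open>- x\<close>. The bounds for the
  means at times \<open>j * t\<close> with \<open>1 \<le> j \<le> m\<close> do not exceed the one at
  time \<open>t\<close>, because the exponent \<open>(\<kappa> - CARD('n)) / 2\<close> is at most
  0.\<close>

lemma test_function_le_high_pass:
  fixes \<kappa> :: real
  assumes \<kappa>: "\<kappa> \<le> CARD('n)"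
  obtains K where "K > 0"
    "\<And>(f :: real ^ 'n \<Rightarrow> real) M t x. \<lbrakk>test_function f; 0 \<le> M; 0 < t;
       \<And>x R. 0 < R \<Longrightarrow> (\<integral>\<^sup>+y. ennreal \<bar>f y\<bar> * indicator (ball x R) y \<partial>lborel) \<le> ennreal (M * R powr \<kappa>)\<rbrakk> \<Longrightarrow>
       (2 * pi) ^ CARD('n) * \<bar>f (- x)\<bar> \<le>
         norm (fourier_transform (\<lambda>\<xi>. complex_of_real (high_pass m t \<xi>) * fourier_transform (\<lambda>y. complex_of_real (f y)) \<xi>) x)
         + K * M * t powr ((\<kappa> - CARD('n)) / 2)"
proof -
  obtain C where C: "C > 0" and gm: "\<And>(f :: real ^ 'n \<Rightarrow> real) M t x. \<lbrakk>f \<in> borel_measurable borel; 0 \<le> M; 0 < t;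
       \<And>x R. 0 < R \<Longrightarrow> (\<integral>\<^sup>+y. ennreal \<bar>f y\<bar> * indicator (ball x R) y \<partial>lborel) \<le> ennreal (M * R powr \<kappa>)\<rbrakk> \<Longrightarrow>
       norm (gaussian_mean t (\<lambda>y. complex_of_real (f y)) x) \<le> C * M * t powr ((\<kappa> - CARD('n)) / 2)"
    by (rule gaussian_mean_morrey[where 'a="real ^ 'n", of \<kappa>, unfolded DIM_cart DIM_real mult_1_right]) blast
  define P where "P = (2 * sqrt pi) ^ CARD('n)"
  have P: "P > 0" by (simp add: P_def)
  \<comment> \<open>The summand 1 keeps \<open>K\<close> positive also for \<open>m = 0\<close>,
    when the sum is empty.\<close>
  define K where "K = (\<Sum>j\<in>{1..m}. real (m choose j)) * P * C + 1"
  have "(\<Sum>j\<in>{1..m}. real (m choose j)) * P * C \<ge> 0" using P C by (intro mult_nonneg_nonneg sum_nonneg) auto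
  then have K: "K > 0" by (simp add: K_def)
  moreover have "(2 * pi) ^ CARD('n) * \<bar>f (- x)\<bar> \<le>
         norm (fourier_transform (\<lambda>\<xi>. complex_of_real (high_pass m t \<xi>) * fourier_transform (\<lambda>y. complex_of_real (f y)) \<xi>) x)
         + K * M * t powr ((\<kappa> - CARD('n)) / 2)"
    if f: "test_function f" and M: "0 \<le> M" and t: "0 < t" and
       fM: "\<And>x R. 0 < R \<Longrightarrow> (\<integral>\<^sup>+y. ennreal \<bar>f y\<bar> * indicator (ball x R) y \<partial>lborel) \<le> ennreal (M * R powr \<kappa>)"
    for f :: "real ^ 'n \<Rightarrow> real" and M t x
  proof -
    define h where "h y = complex_of_real (f y)" for y
    define T where "T = t powr ((\<kappa> - CARD('n)) / 2)"
    obtain B where B: "\<And>x. \<bar>f x\<bar> \<le> B" by (rule test_function_bounded[OF f]) blast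
    have cont: "continuous_on UNIV h" unfolding h_def by (intro continuous_intros test_function_continuous f)
    have int: "integrable lborel h" unfolding h_def by (rule integrable_test_function[OF f])
    have Fint: "integrable lborel (fourier_transform h)"
      unfolding h_def by (rule integrable_fourier_transform_test_function[OF f])
    let ?W = "fourier_transform (\<lambda>\<xi>. complex_of_real (high_pass m t \<xi>) * fourier_transform h \<xi>) x"
    define S where "S = (\<Sum>j\<in>{1..m}. complex_of_real (real (m choose j) * (- 1) ^ j) *
            (complex_of_real P * gaussian_mean (real j * t) h (- x)))"
    have W: "?W = complex_of_real ((2 * pi) ^ CARD('n)) * h (- x) + S"
      using fourier_transform_high_pass[OF cont _ int Fint t, of B m x] B unfolding S_def P_def by (simp add: h_def)
    have gj: "norm (gaussian_mean (real j * t) h (- x)) \<le> C * M * T" if "j \<in> {1..m}" for j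
    proof -
      have "norm (gaussian_mean (real j * t) h (- x)) \<le> C * M * (real j * t) powr ((\<kappa> - CARD('n)) / 2)"
        unfolding h_def using that t by (intro gm test_function_borel_measurable f M fM) auto
      also have "\<dots> \<le> C * M * T"
        unfolding T_def using that t C M \<kappa> by (intro mult_left_mono powr_mono2') auto
      finally show ?thesis .
    qed
    have "norm S \<le> (\<Sum>j\<in>{1..m}. real (m choose j) * (P * (C * M * T)))"
      unfolding S_def using P gj[unfolded mult.assoc]
      by (intro sum_norm_le) (auto simp: norm_mult abs_mult norm_power intro!: mult_left_mono)
    also have "\<dots> = ((\<Sum>j\<in>{1..m}. real (m choose j)) * P * C) * M * T"
      by (simp add: sum_distrib_right[symmetric] mult.assoc)
    also have "\<dots> \<le> K * M * T" unfolding K_def T_def using M by (intro mult_right_mono) auto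
    finally have S: "norm S \<le> K * M * T" .
    have "(2 * pi) ^ CARD('n) * \<bar>f (- x)\<bar> = norm (?W - S)" unfolding W by (simp add: h_def norm_mult norm_power)
    also have "\<dots> \<le> norm ?W + norm S" by (rule norm_triangle_ineq4)
    also have "\<dots> \<le> norm ?W + K * M * T" using S by simp
    finally show ?thesis unfolding h_def T_def .
  qed
  ultimately show thesis by (rule that)
qed


text \<open>The layer cake formula up to a constant: only the levels between \<open>u/2\<close> and \<open>u\<close> are used.\<close>

lemma powr_le_layer_integral:
  fixes u p :: real
  assumes "u \<ge> 0" "p \<ge> 1"
  shows "ennreal (u powr p) \<le> ennreal (2 powr p) * (\<integral>\<^sup>+\<mu>. (if 0 < \<mu> \<and> \<mu> < u then ennreal (\<mu> powr (p - 1)) else 0) \<partial>lborel)"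
proof (cases "u = 0")
  case False
  then have u: "u > 0" using assms by simp
  have "ennreal (u powr p) = ennreal (2 powr p * ((u / 2) powr (p - 1) * (u / 2)))"
    using u by (simp add: powr_divide powr_diff)
  also have "\<dots> = ennreal (2 powr p) * (ennreal ((u / 2) powr (p - 1)) * ennreal (u / 2))"
    by (subst ennreal_mult, use u in simp, use u in simp)+ (rule refl)
  also have "ennreal ((u / 2) powr (p - 1)) * ennreal (u / 2) = (\<integral>\<^sup>+\<mu>. ennreal ((u / 2) powr (p - 1)) * indicator {u / 2<..<u} \<mu> \<partial>lborel)"
    using u by (subst nn_integral_cmult_indicator) auto
  also have "\<dots> \<le> (\<integral>\<^sup>+\<mu>. (if 0 < \<mu> \<and> \<mu> < u then ennreal (\<mu> powr (p - 1)) else 0) \<partial>lborel)"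
    using u assms by (intro nn_integral_mono) (auto simp: indicator_def intro!: ennreal_leI powr_mono2)
  finally show ?thesis by (simp add: mult_left_mono)
qed (use assms in simp)

section \<open>Integration over the levels\<close>

text \<open>With \<open>t = (c / \<mu>) powr (1 / a)\<close> and
  \<open>L = c * norm \<xi> powr (2 * a)\<close> one has
  \<open>t * (norm \<xi>)\<^sup>2 = (L / \<mu>) powr (1 / a)\<close>, so the multiplier depends on
  \<open>\<mu> / L\<close> only, and scaling produces \<open>L powr (p - 2)\<close>. What remains is
  convergence. At small levels the multiplier is at most 1, and \<open>p > 2\<close> makes
  \<open>p - 3 > - 1\<close>; at large levels its square is at most
  \<open>(L / \<mu>) powr (2 * m / a)\<close>.\<close>

lemma high_pass_scale_integral:
  fixes a p :: real
  assumes a: "a > 0" and p: "p > 2" and m: "a * (p - 2) < 2 * real m"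
  obtains \<kappa> where "\<kappa> > 0"
    "\<And>(\<xi> :: 'a::euclidean_space) c. 0 < c \<Longrightarrow>
      (\<integral>\<^sup>+\<mu>. (if 0 < \<mu> then ennreal (\<mu> powr (p - 3) * (high_pass m ((c / \<mu>) powr (1 / a)) \<xi>)\<^sup>2) else 0) \<partial>lborel)
        \<le> ennreal (\<kappa> * (c powr (p - 2) * norm \<xi> powr (2 * a * (p - 2))))"
proof -
  \<comment> \<open>The decay exponent at large levels:
    \<open>- \<gamma> = p - 3 - 2 * m / a\<close>. The hypothesis on \<open>m\<close> says exactly
    that \<open>\<gamma> > 1\<close>.\<close>
  define \<gamma> where "\<gamma> = 2 * real m / a + 3 - p"
  define k where "k v = (if norm v < 1 then norm v powr - (3 - p) else norm v powr - \<gamma>)" for v :: real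
  have \<gamma>: "\<gamma> > 1" using a m by (simp add: \<gamma>_def field_simps)
  have [measurable]: "k \<in> borel_measurable borel" unfolding k_def by measurable
  have "(\<integral>\<^sup>+v. ennreal (k v) \<partial>lborel) < \<infinity>"
    unfolding k_def using \<gamma> p by (intro nn_integral_radial_powr_finite) auto
  then obtain \<kappa> where \<kappa>: "\<kappa> \<ge> 0" "(\<integral>\<^sup>+v. ennreal (k v) \<partial>lborel) = ennreal \<kappa>"
    by (metis less_top_ennreal infinity_ennreal_def)
  have m0: "m > 0" using m a p by (cases m) (auto simp: mult_less_0_iff)
  have main: "(\<integral>\<^sup>+\<mu>. (if 0 < \<mu> then ennreal (\<mu> powr (p - 3) * (high_pass m ((c / \<mu>) powr (1 / a)) \<xi>)\<^sup>2) else 0) \<partial>lborel)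
        \<le> ennreal ((\<kappa> + 1) * (c powr (p - 2) * norm \<xi> powr (2 * a * (p - 2))))" if c: "c > 0" for \<xi> :: 'a and c
  proof (cases "\<xi> = 0")
    case True
    have "high_pass m t \<xi> = 0" for t using m0 True by (simp add: high_pass_def)
    then show ?thesis by (simp cong: if_cong)
  next
    case False
    define L where "L = c * norm \<xi> powr (2 * a)"
    have L: "L > 0" using c False by (simp add: L_def)
    have pt: "\<mu> powr (p - 3) * (high_pass m ((c / \<mu>) powr (1 / a)) \<xi>)\<^sup>2 \<le> L powr (p - 3) * k (\<mu> / L)" if l: "\<mu> > 0" for \<mu>
    proof -
      let ?t = "(c / \<mu>) powr (1 / a)"
      have t: "?t \<ge> 0" by simp
      note hp = high_pass_bounds[OF t, of m \<xi>]
      show ?thesis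
      proof (cases "\<mu> < L")
        case True
        have "(high_pass m ?t \<xi>)\<^sup>2 \<le> 1" using hp by (intro power_le_one)
        then have "\<mu> powr (p - 3) * (high_pass m ?t \<xi>)\<^sup>2 \<le> \<mu> powr (p - 3)"
          by (intro mult_left_le) auto
        also have "\<dots> = L powr (p - 3) * (\<mu> / L) powr (p - 3)"
          using L l by (simp add: powr_divide)
        also have "\<dots> = L powr (p - 3) * k (\<mu> / L)" using L l True by (simp add: k_def)
        finally show ?thesis .
      next
        case f: False
        have ta: "?t * (norm \<xi>)\<^sup>2 = (L / \<mu>) powr (1 / a)"
        proof -
          have "(norm \<xi>)\<^sup>2 = (norm \<xi> powr (2 * a)) powr (1 / a)"
            using False a by (simp add: powr_powr powr_numeral)
          then show ?thesis using c l False by (simp add: L_def powr_mult[symmetric] del: powr_mult)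
        qed
        have "(high_pass m ?t \<xi>)\<^sup>2 \<le> ((?t * (norm \<xi>)\<^sup>2) ^ m)\<^sup>2" using hp by (intro power_mono)
        also have "\<dots> = (L / \<mu>) powr (2 * real m / a)"
          unfolding ta using L l a by (simp add: powr_realpow[symmetric] powr_powr mult.commute power_mult[symmetric])
        finally have "\<mu> powr (p - 3) * (high_pass m ?t \<xi>)\<^sup>2 \<le> \<mu> powr (p - 3) * (L / \<mu>) powr (2 * real m / a)"
          by (intro mult_left_mono) auto
        also have "\<mu> powr (p - 3) * (L / \<mu>) powr (2 * real m / a) = L powr (p - 3) * (\<mu> / L) powr - \<gamma>"
        proof -
          have "\<mu> powr (p - 3) = L powr (p - 3) * (\<mu> / L) powr (p - 3)"
            using L l by (simp add: powr_divide)
          moreover have "(L / \<mu>) powr (2 * real m / a) = (\<mu> / L) powr - (2 * real m / a)"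
            using L l by (simp add: powr_divide powr_minus)
          moreover have "(\<mu> / L) powr (p - 3) * (\<mu> / L) powr - (2 * real m / a) = (\<mu> / L) powr - \<gamma>"
            unfolding powr_add[symmetric] \<gamma>_def by (rule arg_cong2[where f="(powr)"]) simp_all
          ultimately show ?thesis by (simp only: mult.assoc)
        qed
        also have "\<dots> = L powr (p - 3) * k (\<mu> / L)" using L l f by (simp add: k_def)
        finally show ?thesis .
      qed
    qed
    have "(\<integral>\<^sup>+\<mu>. (if 0 < \<mu> then ennreal (\<mu> powr (p - 3) * (high_pass m ((c / \<mu>) powr (1 / a)) \<xi>)\<^sup>2) else 0) \<partial>lborel)
      \<le> (\<integral>\<^sup>+\<mu>. ennreal (L powr (p - 3)) * ennreal (k (\<mu> / L)) \<partial>lborel)"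
    proof (rule nn_integral_mono)
      fix \<mu>
      have "k (\<mu> / L) \<ge> 0" by (simp add: k_def)
      then show "(if 0 < \<mu> then ennreal (\<mu> powr (p - 3) * (high_pass m ((c / \<mu>) powr (1 / a)) \<xi>)\<^sup>2) else 0)
         \<le> ennreal (L powr (p - 3)) * ennreal (k (\<mu> / L))"
        using pt[of \<mu>] by (auto simp: ennreal_mult[symmetric] intro!: ennreal_leI)
    qed
    also have "\<dots> = ennreal (L powr (p - 3)) * (\<integral>\<^sup>+\<mu>. ennreal (k (\<mu> / L)) \<partial>lborel)"
      by (rule nn_integral_cmult) measurable
    also have "(\<integral>\<^sup>+\<mu>. ennreal (k (\<mu> / L)) \<partial>lborel) = ennreal L * ennreal \<kappa>"
      using nn_integral_lborel_affine[of "\<lambda>\<mu>. ennreal (k (\<mu> / L))" L 0] L \<kappa> by simp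
    also have "ennreal (L powr (p - 3)) * (ennreal L * ennreal \<kappa>) = ennreal (\<kappa> * (L powr (p - 3) * L powr 1))"
      using L \<kappa> by (simp add: ennreal_mult[symmetric] mult_ac)
    also have "L powr (p - 3) * L powr 1 = c powr (p - 2) * norm \<xi> powr (2 * a * (p - 2))"
      unfolding powr_add[symmetric] L_def using c by (simp add: powr_mult powr_powr)
    also have "ennreal (\<kappa> * (c powr (p - 2) * norm \<xi> powr (2 * a * (p - 2)))) \<le> ennreal ((\<kappa> + 1) * (c powr (p - 2) * norm \<xi> powr (2 * a * (p - 2))))"
      by (intro ennreal_leI mult_right_mono) auto
    finally show ?thesis .
  qed
  show thesis by (rule that[of "\<kappa> + 1"]) (use \<kappa> main in auto)
qed

text \<open>Here \<kappa> and \<open>p\<close> are still independent; the weight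
  \<open>(CARD('n) - \<kappa>) * (p - 2)\<close> is the one that scaling dictates, and it becomes
  \<open>2 * s\<close> for the exponents used later. At level \<mu>, Chebyshev's inequality in L^2
  and Plancherel bound the measure of \<open>{x. \<mu> < g x}\<close> by
  \<open>4 * P / \<mu>\<^sup>2\<close> times a frequency integral. Integration against
  \<open>\<mu> powr (p - 1)\<close> leaves \<open>\<mu> powr (p - 3)\<close>, and after the exchange
  of integrals the integral over \<mu> at a fixed frequency is the one computed above.\<close>

theorem refined_sobolev_test_function:
  fixes \<kappa> p :: real
  assumes \<kappa>: "\<kappa> < CARD('n)" and p: "p > 2"
  obtains C where "C > 0"
    "\<And>(f :: real ^ 'n \<Rightarrow> real) M. \<lbrakk>test_function f; 0 < M;
       \<And>x R. 0 < R \<Longrightarrow> (\<integral>\<^sup>+y. ennreal \<bar>f y\<bar> * indicator (ball x R) y \<partial>lborel) \<le> ennreal (M * R powr \<kappa>)\<rbrakk> \<Longrightarrow>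
       (\<integral>\<^sup>+x. ennreal (\<bar>f x\<bar> powr p) \<partial>lborel) \<le> ennreal (C * M powr (p - 2)) *
         (\<integral>\<^sup>+\<xi>. ennreal (norm \<xi> powr ((CARD('n) - \<kappa>) * (p - 2)) * (norm (fourier_transform (\<lambda>y. complex_of_real (f y)) \<xi>))\<^sup>2) \<partial>lborel)"
proof -
  define N where "N = real CARD('n)"
  define a where "a = (N - \<kappa>) / 2"
  have a: "a > 0" using \<kappa> by (simp add: a_def N_def)
  obtain m :: nat where "a * (p - 2) < real m" using reals_Archimedean2 by blast
  then have m: "a * (p - 2) < 2 * real m" by simp
  define P where "P = (2 * pi) ^ CARD('n)"
  have P: "P \<ge> 1" unfolding P_def using pi_gt3 by (intro one_le_power) auto
  obtain K where K: "K > 0" and hp: "\<And>(f :: real ^ 'n \<Rightarrow> real) M t x. \<lbrakk>test_function f; 0 \<le> M; 0 < t;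
       \<And>x R. 0 < R \<Longrightarrow> (\<integral>\<^sup>+y. ennreal \<bar>f y\<bar> * indicator (ball x R) y \<partial>lborel) \<le> ennreal (M * R powr \<kappa>)\<rbrakk> \<Longrightarrow>
       P * \<bar>f (- x)\<bar> \<le>
         norm (fourier_transform (\<lambda>\<xi>. complex_of_real (high_pass m t \<xi>) * fourier_transform (\<lambda>y. complex_of_real (f y)) \<xi>) x)
         + K * M * t powr ((\<kappa> - N) / 2)"
    unfolding P_def N_def by (rule test_function_le_high_pass[of \<kappa> m]) (use \<kappa> in auto)
  obtain \<kappa>' where \<kappa>': "\<kappa>' > 0" and sc: "\<And>(\<xi> :: real ^ 'n) c. 0 < c \<Longrightarrow>
      (\<integral>\<^sup>+\<mu>. (if 0 < \<mu> then ennreal (\<mu> powr (p - 3) * (high_pass m ((c / \<mu>) powr (1 / a)) \<xi>)\<^sup>2) else 0) \<partial>lborel)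
        \<le> ennreal (\<kappa>' * (c powr (p - 2) * norm \<xi> powr (2 * a * (p - 2))))"
    by (rule high_pass_scale_integral[where 'a="real ^ 'n", OF a p m]) blast
  define C where "C = 2 powr p * (4 * P) * \<kappa>' * (2 * K) powr (p - 2)"
  have C: "C > 0" using P \<kappa>' K by (simp add: C_def)
  moreover have "(\<integral>\<^sup>+x. ennreal (\<bar>f x\<bar> powr p) \<partial>lborel) \<le> ennreal (C * M powr (p - 2)) *
         (\<integral>\<^sup>+\<xi>. ennreal (norm \<xi> powr ((CARD('n) - \<kappa>) * (p - 2)) * (norm (fourier_transform (\<lambda>y. complex_of_real (f y)) \<xi>))\<^sup>2) \<partial>lborel)"
    if f: "test_function f" and M: "0 < M" and
       fM: "\<And>x R. 0 < R \<Longrightarrow> (\<integral>\<^sup>+y. ennreal \<bar>f y\<bar> * indicator (ball x R) y \<partial>lborel) \<le> ennreal (M * R powr \<kappa>)"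
    for f :: "real ^ 'n \<Rightarrow> real" and M
  proof -
    define H where "H = fourier_transform (\<lambda>y. complex_of_real (f y))"
    \<comment> \<open>Inversion controls \<open>(2 * pi) ^ CARD('n)\<close> times the reflected
      function, so the level sets are those of \<open>g\<close>. Reflection does not affect the
      integral of \<open>\<bar>f\<bar> powr p\<close>, and the factor \<open>P \<ge> 1\<close> can
      only increase it.\<close>
    define g where "g x = P * \<bar>f (- x)\<bar>" for x
    \<comment> \<open>Chosen so that at time \<open>t \<mu>\<close> the low-frequency bound
      \<open>K * M * t \<mu> powr (- a)\<close> equals \<open>\<mu> / 2\<close>.\<close>
    define c where "c = 2 * K * M"
    have c: "c > 0" using K M by (simp add: c_def)
    define t where "t \<mu> = (c / \<mu>) powr (1 / a)" for \<mu>
    have int: "integrable lborel (\<lambda>y. complex_of_real (f y))" by (rule integrable_test_function[OF f])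
    have Hint: "integrable lborel H" unfolding H_def by (rule integrable_fourier_transform_test_function[OF f])
    have Hcont: "continuous_on UNIV H" unfolding H_def by (rule continuous_fourier_transform[OF int])
    obtain B where B: "\<And>x. norm (H x) \<le> B" unfolding H_def using norm_fourier_transform_le by blast
    have [measurable]: "f \<in> borel_measurable borel" by (rule test_function_borel_measurable[OF f])
    have [measurable]: "H \<in> borel_measurable borel" using Hint by simp
    have [measurable]: "g \<in> borel_measurable borel" unfolding g_def by measurable
    have level: "(\<integral>\<^sup>+x. (if \<mu> < g x then 1 else 0) \<partial>lborel)
        \<le> ennreal (4 / \<mu>\<^sup>2 * P) * (\<integral>\<^sup>+\<xi>. ennreal ((high_pass m (t \<mu>) \<xi>)\<^sup>2 * (norm (H \<xi>))\<^sup>2) \<partial>lborel)" if l: "\<mu> > 0" for \<mu>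
    proof -
      have tl: "t \<mu> > 0" using l c by (simp add: t_def)
      define h where "h = (\<lambda>\<xi>. complex_of_real (high_pass m (t \<mu>) \<xi>) * H \<xi>)"
      note hpb = high_pass_bounds[of "t \<mu>" m]
      have hn: "norm (h \<xi>) \<le> norm (H \<xi>)" for \<xi>
        unfolding h_def norm_mult using hpb(1,2)[of \<xi>] tl by (intro mult_left_le_one_le) auto
      have hcont: "continuous_on UNIV h" unfolding h_def high_pass_def by (intro continuous_intros Hcont)
      have [measurable]: "h \<in> borel_measurable borel" using hcont by (rule borel_measurable_continuous_onI)
      have hint: "integrable lborel h" by (rule Bochner_Integration.integrable_bound[OF Hint]) (use hn in auto)
      have [measurable]: "fourier_transform h \<in> borel_measurable borel" by (rule borel_measurable_fourier_transform[OF hint])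
      have "K * M * t \<mu> powr ((\<kappa> - N) / 2) = \<mu> / 2"
      proof -
        have "t \<mu> powr ((\<kappa> - N) / 2) = (c / \<mu>) powr (1 / a * (- a))"
          unfolding t_def powr_powr a_def by (simp add: minus_divide_left)
        also have "1 / a * (- a) = - 1" using a by simp
        finally show ?thesis using K M l by (simp add: powr_minus c_def)
      qed
      then have hg: "g x \<le> norm (fourier_transform h x) + \<mu> / 2" for x
        using hp[OF f less_imp_le[OF M] tl fM, of x] by (simp add: g_def h_def H_def)
      have "(if \<mu> < g x then 1 else 0) \<le> ennreal (4 / \<mu>\<^sup>2) * ennreal ((norm (fourier_transform h x))\<^sup>2)" for x
      proof (cases "\<mu> < g x")
        case True
        then have "\<mu> / 2 \<le> norm (fourier_transform h x)" using hg[of x] by simp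
        then have "(\<mu> / 2)\<^sup>2 \<le> (norm (fourier_transform h x))\<^sup>2" using l by (intro power_mono) auto
        then have "1 \<le> 4 / \<mu>\<^sup>2 * (norm (fourier_transform h x))\<^sup>2" using l by (simp add: field_simps)
        then have "ennreal 1 \<le> ennreal (4 / \<mu>\<^sup>2 * (norm (fourier_transform h x))\<^sup>2)" by (rule ennreal_leI)
        then show ?thesis using True by (simp add: ennreal_mult[symmetric])
      qed simp
      then have "(\<integral>\<^sup>+x. (if \<mu> < g x then 1 else 0) \<partial>lborel)
        \<le> (\<integral>\<^sup>+x. ennreal (4 / \<mu>\<^sup>2) * ennreal ((norm (fourier_transform h x))\<^sup>2) \<partial>lborel)"
        by (intro nn_integral_mono)
      also have "\<dots> = ennreal (4 / \<mu>\<^sup>2) * (\<integral>\<^sup>+x. ennreal ((norm (fourier_transform h x))\<^sup>2) \<partial>lborel)"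
        by (rule nn_integral_cmult) measurable
      also have "(\<integral>\<^sup>+x. ennreal ((norm (fourier_transform h x))\<^sup>2) \<partial>lborel) = ennreal P * (\<integral>\<^sup>+\<xi>. ennreal ((norm (h \<xi>))\<^sup>2) \<partial>lborel)"
        using plancherel[OF hcont order_trans[OF hn B] hint] by (simp add: P_def)
      also have "(\<lambda>\<xi>. (norm (h \<xi>))\<^sup>2) = (\<lambda>\<xi>. (high_pass m (t \<mu>) \<xi>)\<^sup>2 * (norm (H \<xi>))\<^sup>2)"
        by (simp add: h_def norm_mult power_mult_distrib)
      also have "ennreal (4 / \<mu>\<^sup>2) * (ennreal P * (\<integral>\<^sup>+\<xi>. ennreal ((high_pass m (t \<mu>) \<xi>)\<^sup>2 * (norm (H \<xi>))\<^sup>2) \<partial>lborel))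
        = ennreal (4 / \<mu>\<^sup>2 * P) * (\<integral>\<^sup>+\<xi>. ennreal ((high_pass m (t \<mu>) \<xi>)\<^sup>2 * (norm (H \<xi>))\<^sup>2) \<partial>lborel)"
        using P by (simp only: mult.assoc[symmetric] ennreal_mult[symmetric] zero_le_divide_iff) (simp add: ennreal_mult[symmetric])
      finally show ?thesis .
    qed
    have "(\<integral>\<^sup>+x. ennreal (\<bar>f x\<bar> powr p) \<partial>lborel) = (\<integral>\<^sup>+x. ennreal (\<bar>f (- x)\<bar> powr p) \<partial>lborel)"
      using nn_integral_lborel_affine[of "\<lambda>x. ennreal (\<bar>f x\<bar> powr p)" "-1" 0] by simp
    also have "\<dots> \<le> (\<integral>\<^sup>+x. ennreal (g x powr p) \<partial>lborel)"
    proof (intro nn_integral_mono ennreal_leI powr_mono2)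
      show "\<bar>f (- x)\<bar> \<le> g x" for x unfolding g_def using mult_right_mono[OF P, of "\<bar>f (- x)\<bar>"] by simp
    qed (use p in auto)
    also have "\<dots> \<le> (\<integral>\<^sup>+x. ennreal (2 powr p) * (\<integral>\<^sup>+\<mu>. (if 0 < \<mu> \<and> \<mu> < g x then ennreal (\<mu> powr (p - 1)) else 0) \<partial>lborel) \<partial>lborel)"
      using P p by (intro nn_integral_mono powr_le_layer_integral) (auto simp: g_def)
    also have "\<dots> = ennreal (2 powr p) * (\<integral>\<^sup>+x. \<integral>\<^sup>+\<mu>. (if 0 < \<mu> \<and> \<mu> < g x then ennreal (\<mu> powr (p - 1)) else 0) \<partial>lborel \<partial>lborel)"
      by (rule nn_integral_cmult) measurable
    also have "(\<integral>\<^sup>+x. \<integral>\<^sup>+\<mu>. (if 0 < \<mu> \<and> \<mu> < g x then ennreal (\<mu> powr (p - 1)) else 0) \<partial>lborel \<partial>lborel)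
      = (\<integral>\<^sup>+\<mu>. \<integral>\<^sup>+x. (if 0 < \<mu> \<and> \<mu> < g x then ennreal (\<mu> powr (p - 1)) else 0) \<partial>lborel \<partial>lborel)"
      by (rule lborel_pair.Fubini') measurable
    also have "\<dots> \<le> (\<integral>\<^sup>+\<mu>. \<integral>\<^sup>+\<xi>. (if 0 < \<mu> then ennreal (4 * P) * (ennreal ((norm (H \<xi>))\<^sup>2) *
         ennreal (\<mu> powr (p - 3) * (high_pass m (t \<mu>) \<xi>)\<^sup>2)) else 0) \<partial>lborel \<partial>lborel)"
    proof (rule nn_integral_mono)
      fix \<mu> :: real
      show "(\<integral>\<^sup>+x. (if 0 < \<mu> \<and> \<mu> < g x then ennreal (\<mu> powr (p - 1)) else 0) \<partial>lborel)
        \<le> (\<integral>\<^sup>+\<xi>. (if 0 < \<mu> then ennreal (4 * P) * (ennreal ((norm (H \<xi>))\<^sup>2) *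
         ennreal (\<mu> powr (p - 3) * (high_pass m (t \<mu>) \<xi>)\<^sup>2)) else 0) \<partial>lborel)"
      proof (cases "\<mu> > 0")
        case l: True
        have hpl [measurable]: "(\<lambda>\<xi>::real ^ 'n. high_pass m (t \<mu>) \<xi>) \<in> borel_measurable borel"
          unfolding high_pass_def by measurable
        have "(\<integral>\<^sup>+x. (if 0 < \<mu> \<and> \<mu> < g x then ennreal (\<mu> powr (p - 1)) else 0) \<partial>lborel)
          = (\<integral>\<^sup>+x. ennreal (\<mu> powr (p - 1)) * (if \<mu> < g x then 1 else 0) \<partial>lborel)"
          using l by (intro nn_integral_cong) auto
        also have "\<dots> = ennreal (\<mu> powr (p - 1)) * (\<integral>\<^sup>+x. (if \<mu> < g x then 1 else 0) \<partial>lborel)"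
          by (rule nn_integral_cmult) measurable
        also have "\<dots> \<le> ennreal (\<mu> powr (p - 1)) * (ennreal (4 / \<mu>\<^sup>2 * P) * (\<integral>\<^sup>+\<xi>. ennreal ((high_pass m (t \<mu>) \<xi>)\<^sup>2 * (norm (H \<xi>))\<^sup>2) \<partial>lborel))"
          by (intro mult_left_mono level l) simp
        also have "\<dots> = (\<integral>\<^sup>+\<xi>. ennreal (\<mu> powr (p - 1) * (4 / \<mu>\<^sup>2 * P)) * ennreal ((high_pass m (t \<mu>) \<xi>)\<^sup>2 * (norm (H \<xi>))\<^sup>2) \<partial>lborel)"
        proof -
          have "ennreal (\<mu> powr (p - 1) * (4 / \<mu>\<^sup>2 * P)) = ennreal (\<mu> powr (p - 1)) * ennreal (4 / \<mu>\<^sup>2 * P)"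
            using P by (intro ennreal_mult) auto
          then show ?thesis by (subst nn_integral_cmult) (measurable, simp only: mult.assoc)
        qed
        also have "\<dots> = (\<integral>\<^sup>+\<xi>. ennreal (4 * P) * (ennreal ((norm (H \<xi>))\<^sup>2) *
         ennreal (\<mu> powr (p - 3) * (high_pass m (t \<mu>) \<xi>)\<^sup>2)) \<partial>lborel)"
        proof (intro nn_integral_cong)
          fix \<xi> :: "real ^ 'n"
          have "\<mu> powr (p - 3) = \<mu> powr (p - 1) / \<mu>\<^sup>2" using l by (simp add: powr_diff power3_eq_cube power2_eq_square)
          then show "ennreal (\<mu> powr (p - 1) * (4 / \<mu>\<^sup>2 * P)) * ennreal ((high_pass m (t \<mu>) \<xi>)\<^sup>2 * (norm (H \<xi>))\<^sup>2)
            = ennreal (4 * P) * (ennreal ((norm (H \<xi>))\<^sup>2) * ennreal (\<mu> powr (p - 3) * (high_pass m (t \<mu>) \<xi>)\<^sup>2))"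
            using P by (simp add: ennreal_mult[symmetric] mult_ac)
        qed
        finally show ?thesis using l by simp
      qed simp
    qed
    also have "\<dots> = (\<integral>\<^sup>+\<xi>. \<integral>\<^sup>+\<mu>. (if 0 < \<mu> then ennreal (4 * P) * (ennreal ((norm (H \<xi>))\<^sup>2) *
         ennreal (\<mu> powr (p - 3) * (high_pass m (t \<mu>) \<xi>)\<^sup>2)) else 0) \<partial>lborel \<partial>lborel)"
      unfolding high_pass_def t_def by (rule lborel_pair.Fubini') measurable
    also have "\<dots> \<le> (\<integral>\<^sup>+\<xi>. ennreal (4 * P * \<kappa>' * c powr (p - 2)) * ennreal (norm \<xi> powr (2 * a * (p - 2)) * (norm (H \<xi>))\<^sup>2) \<partial>lborel)"
    proof (rule nn_integral_mono)
      fix \<xi> :: "real ^ 'n"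
      let ?F = "\<lambda>\<mu>. if 0 < \<mu> then ennreal (\<mu> powr (p - 3) * (high_pass m ((c / \<mu>) powr (1 / a)) \<xi>)\<^sup>2) else 0"
      have [measurable]: "?F \<in> borel_measurable borel" unfolding high_pass_def by measurable
      have "(\<integral>\<^sup>+\<mu>. (if 0 < \<mu> then ennreal (4 * P) * (ennreal ((norm (H \<xi>))\<^sup>2) *
         ennreal (\<mu> powr (p - 3) * (high_pass m (t \<mu>) \<xi>)\<^sup>2)) else 0) \<partial>lborel)
        = (\<integral>\<^sup>+\<mu>. ennreal (4 * P * (norm (H \<xi>))\<^sup>2) * ?F \<mu> \<partial>lborel)"
        using P by (intro nn_integral_cong) (auto simp: t_def ennreal_mult mult.assoc)
      also have "\<dots> = ennreal (4 * P * (norm (H \<xi>))\<^sup>2) * (\<integral>\<^sup>+\<mu>. ?F \<mu> \<partial>lborel)"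
        by (rule nn_integral_cmult) measurable
      also have "\<dots> \<le> ennreal (4 * P * (norm (H \<xi>))\<^sup>2) * ennreal (\<kappa>' * (c powr (p - 2) * norm \<xi> powr (2 * a * (p - 2))))"
        by (intro mult_left_mono sc c) simp
      also have "\<dots> = ennreal (4 * P * \<kappa>' * c powr (p - 2)) * ennreal (norm \<xi> powr (2 * a * (p - 2)) * (norm (H \<xi>))\<^sup>2)"
        using P \<kappa>' by (simp add: ennreal_mult[symmetric] mult_ac)
      finally show "(\<integral>\<^sup>+\<mu>. (if 0 < \<mu> then ennreal (4 * P) * (ennreal ((norm (H \<xi>))\<^sup>2) *
         ennreal (\<mu> powr (p - 3) * (high_pass m (t \<mu>) \<xi>)\<^sup>2)) else 0) \<partial>lborel)
        \<le> ennreal (4 * P * \<kappa>' * c powr (p - 2)) * ennreal (norm \<xi> powr (2 * a * (p - 2)) * (norm (H \<xi>))\<^sup>2)" .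
    qed
    also have "\<dots> = ennreal (4 * P * \<kappa>' * c powr (p - 2)) * (\<integral>\<^sup>+\<xi>. ennreal (norm \<xi> powr (2 * a * (p - 2)) * (norm (H \<xi>))\<^sup>2) \<partial>lborel)"
      by (rule nn_integral_cmult) measurable
    finally have "(\<integral>\<^sup>+x. ennreal (\<bar>f x\<bar> powr p) \<partial>lborel) \<le> ennreal (2 powr p) *
       (ennreal (4 * P * \<kappa>' * c powr (p - 2)) * (\<integral>\<^sup>+\<xi>. ennreal (norm \<xi> powr (2 * a * (p - 2)) * (norm (H \<xi>))\<^sup>2) \<partial>lborel))"
      by (simp add: mult_left_mono)
    also have "\<dots> = ennreal (C * M powr (p - 2)) * (\<integral>\<^sup>+\<xi>. ennreal (norm \<xi> powr (2 * a * (p - 2)) * (norm (H \<xi>))\<^sup>2) \<partial>lborel)"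
    proof -
      have "2 powr p * (4 * P * \<kappa>' * c powr (p - 2)) = C * M powr (p - 2)"
        using K M by (simp add: C_def c_def powr_mult)
      then show ?thesis using P \<kappa>' by (simp add: mult.assoc[symmetric] ennreal_mult[symmetric])
    qed
    also have "2 * a * (p - 2) = (CARD('n) - \<kappa>) * (p - 2)" by (simp add: a_def N_def)
    finally show ?thesis unfolding H_def .
  qed
  ultimately show thesis by (rule that)
qed


section \<open>The norm of the completion\<close>

lemma test_function_iterated_differentiable:
  "test_function f \<Longrightarrow> foldr partial_deriv is f differentiable (at x)"
  unfolding test_function_def by (elim conjE allE)

lemma foldr_partial_deriv_diff:
  assumes f: "test_function f" and g: "test_function g"
  shows "foldr partial_deriv is (\<lambda>x. f x - g x) = (\<lambda>x. foldr partial_deriv is f x - foldr partial_deriv is g x)"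
proof (induction "is")
  case (Cons i "is")
  have "partial_deriv i (\<lambda>x. foldr partial_deriv is f x - foldr partial_deriv is g x) x
     = partial_deriv i (foldr partial_deriv is f) x - partial_deriv i (foldr partial_deriv is g) x" for x
  proof -
    have "(foldr partial_deriv is f has_derivative frechet_derivative (foldr partial_deriv is f) (at x)) (at x)"
      "(foldr partial_deriv is g has_derivative frechet_derivative (foldr partial_deriv is g) (at x)) (at x)"
      by (intro frechet_derivative_works[THEN iffD1] test_function_iterated_differentiable f g)+
    then have "((\<lambda>x. foldr partial_deriv is f x - foldr partial_deriv is g x) has_derivative
      (\<lambda>h. frechet_derivative (foldr partial_deriv is f) (at x) h - frechet_derivative (foldr partial_deriv is g) (at x) h)) (at x)"
      by (rule has_derivative_diff)
    from frechet_derivative_at[OF this, symmetric] show ?thesis unfolding partial_deriv_def by simp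
  qed
  then show ?case unfolding foldr.simps o_apply Cons.IH by (rule ext)
qed simp

lemma test_function_diff:
  assumes f: "test_function f" and g: "test_function g"
  shows "test_function (\<lambda>x. f x - g x)"
  unfolding test_function_def
proof (intro conjI allI)
  fix "is" x
  show "foldr partial_deriv is (\<lambda>x. f x - g x) differentiable (at x)"
    unfolding foldr_partial_deriv_diff[OF f g]
    by (intro differentiable_diff test_function_iterated_differentiable f g)
next
  let ?K = "closure {x. f x \<noteq> 0} \<union> closure {x. g x \<noteq> 0}"
  have sub: "closure {x. f x - g x \<noteq> 0} \<subseteq> ?K"
    unfolding closure_Un[symmetric] by (rule closure_mono) auto
  have "compact ?K" using f g unfolding test_function_def by (intro compact_Un; elim conjE)
  from compact_Int_closed[OF this closed_closure[of "{x. f x - g x \<noteq> 0}"]]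
  show "compact (closure {x. f x - g x \<noteq> 0})" unfolding Int_absorb1[OF sub] .
qed

text \<open>For a test function and \<open>s > 0\<close> this is \<open>(2 * pi) ^ CARD('n)\<close>
  times the square of \<open>D_norm_test s f\<close>, read on the Fourier side, where the fractional
  Laplacian is a mere weight.\<close>

definition sobolev_energy :: "real \<Rightarrow> (real ^ 'n \<Rightarrow> real) \<Rightarrow> ennreal"
  where "sobolev_energy s f =
    (\<integral>\<^sup>+\<xi>. ennreal (norm \<xi> powr (2 * s) * (norm (fourier_transform (\<lambda>y. complex_of_real (f y)) \<xi>))\<^sup>2) \<partial>lborel)"

text \<open>The weighted transform \<open>G\<close> is bounded and integrable, and
  \<open>(norm (G \<xi>))\<^sup>2 \<le> B * norm (G \<xi>)\<close>.\<close>

lemma sobolev_energy_finite: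
  assumes f: "test_function f" and s: "0 \<le> s"
  shows "sobolev_energy s f < \<infinity>"
proof -
  let ?H = "fourier_transform (\<lambda>y. complex_of_real (f y))"
  define G where "G \<xi> = complex_of_real (norm \<xi> powr s) * ?H \<xi>" for \<xi>
  have G: "integrable lborel G" unfolding G_def by (rule fourier_transform_test_function_powr(1)[OF f s])
  obtain B where B: "\<And>\<xi>. norm (G \<xi>) \<le> B" unfolding G_def using fourier_transform_test_function_powr(2)[OF f s] by blast
  have "integrable lborel (\<lambda>\<xi>. norm \<xi> powr (2 * s) * (norm (?H \<xi>))\<^sup>2)"
  proof (rule Bochner_Integration.integrable_bound[of _ "\<lambda>\<xi>. B * norm (G \<xi>)"])
    have [measurable]: "?H \<in> borel_measurable borel"
      by (intro borel_measurable_fourier_transform integrable_test_function f)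
    show "(\<lambda>\<xi>. norm \<xi> powr (2 * s) * (norm (?H \<xi>))\<^sup>2) \<in> borel_measurable lborel" by measurable
    have "norm \<xi> powr (2 * s) * (norm (?H \<xi>))\<^sup>2 \<le> B * norm (G \<xi>)" for \<xi>
    proof -
      have "norm \<xi> powr (2 * s) = norm \<xi> powr s * norm \<xi> powr s" by (subst powr_add[symmetric]) simp
      then have "norm \<xi> powr (2 * s) * (norm (?H \<xi>))\<^sup>2 = norm (G \<xi>) * norm (G \<xi>)"
        by (simp add: G_def norm_mult power2_eq_square)
      also have "\<dots> \<le> B * norm (G \<xi>)" using B by (intro mult_right_mono) auto
      finally show ?thesis .
    qed
    then show "AE \<xi> in lborel. norm (norm \<xi> powr (2 * s) * (norm (?H \<xi>))\<^sup>2) \<le> norm (B * norm (G \<xi>))"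
      by (intro AE_I2) (simp add: order_trans[OF _ abs_ge_self])
  qed (use G in auto)
  from nn_integral_eq_integral[OF this] show ?thesis by (simp add: sobolev_energy_def)
qed

lemma fourier_test_function:
  assumes f: "test_function f"
  shows "fourier (\<lambda>x. complex_of_real (f x)) \<xi> = fourier_transform (\<lambda>y. complex_of_real (f y)) (- \<xi>)"
proof -
  note [measurable] = test_function_borel_measurable[OF f]
  show ?thesis unfolding fourier_def fourier_transform_def
    by (subst integral_completion) (simp_all add: inner_commute)
qed

text \<open>\<open>frac_laplacian (s / 2) f\<close> is \<open>1 / P\<close> times the transform of
  the reflected function \<open>h\<close>. Plancherel contributes \<open>P\<close> against the
  square \<open>(1 / P)\<^sup>2\<close>, so one factor \<open>1 / P\<close> survives.\<close>

lemma frac_laplacian_nn_integral: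
  fixes f :: "real ^ 'n \<Rightarrow> real"
  assumes f: "test_function f" and s: "0 < s"
  shows "(\<integral>\<^sup>+x. ennreal (norm (frac_laplacian (s / 2) f x) powr 2) \<partial>lebesgue)
     = ennreal (1 / (2 * pi) ^ CARD('n)) * sobolev_energy s f"
proof -
  let ?H = "fourier_transform (\<lambda>y. complex_of_real (f y))"
  define P :: real where "P = (2 * pi) ^ CARD('n)"
  have P: "P > 0" by (simp add: P_def)
  have int: "integrable lborel (\<lambda>y. complex_of_real (f y))" by (rule integrable_test_function[OF f])
  have Hcont: "continuous_on UNIV ?H" by (rule continuous_fourier_transform[OF int])
  have [measurable]: "?H \<in> borel_measurable borel" by (rule borel_measurable_fourier_transform[OF int])
  define G where "G = (\<lambda>\<xi>. complex_of_real (norm \<xi> powr s) * ?H \<xi>)"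
  define h where "h = (\<lambda>\<xi>. G (- \<xi>))"
  have Gint: "integrable lborel G" unfolding G_def using s by (intro fourier_transform_test_function_powr(1)[OF f]) simp
  obtain B where B: "\<And>\<xi>. norm (G \<xi>) \<le> B"
    unfolding G_def using fourier_transform_test_function_powr(2)[OF f less_imp_le[OF s]] by blast
  have Gcont: "continuous_on UNIV G" unfolding G_def
    by (intro continuous_intros Hcont continuous_on_powr') (use s in auto)
  have hcont: "continuous_on UNIV h" unfolding h_def
    by (rule continuous_on_compose2[OF Gcont]) (auto intro: continuous_intros)
  have hint: "integrable lborel h" unfolding h_def using lborel_integrable_affine[OF Gint, of "-1" 0] by simp
  have [measurable]: "h \<in> borel_measurable borel" using hint by simp
  have [measurable]: "G \<in> borel_measurable borel" using Gint by simp
  have [measurable]: "fourier_transform h \<in> borel_measurable borel" by (rule borel_measurable_fourier_transform[OF hint])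
  have fl: "frac_laplacian (s / 2) f x = complex_of_real (1 / P) * fourier_transform h x" for x
  proof -
    have "frac_laplacian (s / 2) f x = complex_of_real (1 / P) * (\<integral>\<xi>. cis (x \<bullet> \<xi>) * h \<xi> \<partial>lebesgue)"
      unfolding frac_laplacian_def inv_fourier_def P_def fourier_test_function[OF f] by (simp add: h_def G_def)
    also have "(\<integral>\<xi>. cis (x \<bullet> \<xi>) * h \<xi> \<partial>lebesgue) = fourier_transform h x"
      unfolding fourier_transform_def by (rule integral_completion) measurable
    finally show ?thesis .
  qed
  have "(\<integral>\<^sup>+x. ennreal (norm (frac_laplacian (s / 2) f x) powr 2) \<partial>lebesgue)
     = (\<integral>\<^sup>+x. ennreal ((1 / P)\<^sup>2) * ennreal ((norm (fourier_transform h x))\<^sup>2) \<partial>lborel)"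
    unfolding nn_integral_completion
  proof (rule nn_integral_cong)
    fix x
    have "norm (frac_laplacian (s / 2) f x) powr 2 = (norm (frac_laplacian (s / 2) f x))\<^sup>2"
      by (cases "norm (frac_laplacian (s / 2) f x) = 0") (auto simp: powr_numeral)
    also have "\<dots> = (1 / P)\<^sup>2 * (norm (fourier_transform h x))\<^sup>2"
      unfolding fl norm_mult power_mult_distrib norm_of_real by (simp add: power_divide)
    finally show "ennreal (norm (frac_laplacian (s / 2) f x) powr 2)
       = ennreal ((1 / P)\<^sup>2) * ennreal ((norm (fourier_transform h x))\<^sup>2)" by (simp add: ennreal_mult)
  qed
  also have "\<dots> = ennreal ((1 / P)\<^sup>2) * (\<integral>\<^sup>+x. ennreal ((norm (fourier_transform h x))\<^sup>2) \<partial>lborel)"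
    by (rule nn_integral_cmult) measurable
  also have "(\<integral>\<^sup>+x. ennreal ((norm (fourier_transform h x))\<^sup>2) \<partial>lborel) = ennreal P * (\<integral>\<^sup>+x. ennreal ((norm (h x))\<^sup>2) \<partial>lborel)"
    using plancherel[OF hcont _ hint, of B] B by (simp add: h_def P_def)
  also have "(\<integral>\<^sup>+x. ennreal ((norm (h x))\<^sup>2) \<partial>lborel) = (\<integral>\<^sup>+x. ennreal ((norm (G x))\<^sup>2) \<partial>lborel)"
    unfolding h_def using nn_integral_lborel_affine[of "\<lambda>x. ennreal ((norm (G x))\<^sup>2)" "-1" 0] by simp
  also have "\<dots> = sobolev_energy s f"
    unfolding sobolev_energy_def G_def
  proof (intro nn_integral_cong arg_cong[where f=ennreal])
    fix \<xi> :: "real ^ 'n"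
    have "(norm \<xi> powr s)\<^sup>2 = norm \<xi> powr (2 * s)" unfolding power2_eq_square powr_add[symmetric] by simp
    then show "(norm (complex_of_real (norm \<xi> powr s) * ?H \<xi>))\<^sup>2 = norm \<xi> powr (2 * s) * (norm (?H \<xi>))\<^sup>2"
      by (simp add: norm_mult power_mult_distrib)
  qed
  also have "ennreal ((1 / P)\<^sup>2) * (ennreal P * sobolev_energy s f) = ennreal (1 / P) * sobolev_energy s f"
  proof -
    have "ennreal ((1 / P)\<^sup>2) * ennreal P = ennreal ((1 / P)\<^sup>2 * P)" using P by (intro ennreal_mult[symmetric]) auto
    also have "(1 / P)\<^sup>2 * P = 1 / P" using P by (simp add: power2_eq_square)
    finally show ?thesis by (simp only: mult.assoc[symmetric])
  qed
  finally show ?thesis by (simp add: P_def)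
qed

lemma ennpowr_ennreal: "0 \<le> x \<Longrightarrow> ennpowr (ennreal x) a = ennreal (x powr a)"
  by (simp add: ennpowr_def)

lemma ennpowr_top [simp]: "ennpowr \<infinity> a = \<infinity>" "ennpowr top a = \<infinity>"
  by (simp_all add: ennpowr_def)

text \<open>The real-valued form of \<open>D_norm_test\<close> on test functions, where the energy
  is finite and \<open>enn2real\<close> loses nothing. Cauchy sequences and limits can then be taken
  in the reals.\<close>

definition sobolev_seminorm :: "real \<Rightarrow> (real ^ 'n \<Rightarrow> real) \<Rightarrow> real"
  where "sobolev_seminorm s f = sqrt (enn2real (sobolev_energy s f) / (2 * pi) ^ CARD('n))"

lemma sobolev_seminorm_nonneg: "sobolev_seminorm s f \<ge> 0"
  by (simp add: sobolev_seminorm_def)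

lemma sobolev_energy_eq:
  fixes f :: "real ^ 'n \<Rightarrow> real"
  assumes "test_function f" "0 \<le> s"
  shows "sobolev_energy s f = ennreal ((2 * pi) ^ CARD('n) * (sobolev_seminorm s f)\<^sup>2)"
  using sobolev_energy_finite[OF assms] by (simp add: sobolev_seminorm_def ennreal_enn2real_if)

lemma D_norm_test_eq:
  fixes f :: "real ^ 'n \<Rightarrow> real"
  assumes f: "test_function f" and s: "0 < s"
  shows "D_norm_test s f = ennreal (sobolev_seminorm s f)"
proof -
  have "D_norm_test s f = ennpowr (ennreal (1 / (2 * pi) ^ CARD('n)) * sobolev_energy s f) (1 / 2)"
    unfolding D_norm_test_def Lp_norm_def frac_laplacian_nn_integral[OF assms] ..
  also have "ennreal (1 / (2 * pi) ^ CARD('n)) * sobolev_energy s f = ennreal ((sobolev_seminorm s f)\<^sup>2)"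
    using s by (subst sobolev_energy_eq[OF f]) (auto simp: ennreal_mult[symmetric])
  also have "ennpowr (ennreal ((sobolev_seminorm s f)\<^sup>2)) (1 / 2) = ennreal (sobolev_seminorm s f)"
    using sobolev_seminorm_nonneg[of s f] by (simp add: ennpowr_ennreal powr_half_sqrt)
  finally show ?thesis .
qed

text \<open>The triangle inequality in a weighted L^2 space, without square roots: integrate the
  pointwise inequality with weights \<open>1 + B / A\<close> and \<open>1 + A / B\<close>. For these
  weights the right side adds up to exactly \<open>(A + B)\<^sup>2\<close>. The bounds have to be
  positive because of the quotients.\<close>

lemma sobolev_energy_diff_le:
  fixes f g :: "real ^ 'n \<Rightarrow> real"
  assumes f: "test_function f" and g: "test_function g" and A: "A > 0" and B: "B > 0"
    and gA: "sobolev_energy s g \<le> ennreal (A\<^sup>2)" and fgB: "sobolev_energy s (\<lambda>x. f x - g x) \<le> ennreal (B\<^sup>2)"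
  shows "sobolev_energy s f \<le> ennreal ((A + B)\<^sup>2)"
proof -
  let ?F = "\<lambda>f. fourier_transform (\<lambda>y. complex_of_real (f y))"
  have fi: "integrable lborel (\<lambda>y. complex_of_real (f y))" "integrable lborel (\<lambda>y. complex_of_real (g y))"
    by (intro integrable_test_function f g)+
  have split: "?F f \<xi> = ?F g \<xi> + ?F (\<lambda>x. f x - g x) \<xi>" for \<xi>
    using integrable_cis_mult[OF fi(1), of \<xi>] integrable_cis_mult[OF fi(2), of \<xi>]
    by (simp add: fourier_transform_def right_diff_distrib)
  have young: "(norm (a + b))\<^sup>2 \<le> (1 + B / A) * (norm a)\<^sup>2 + (1 + A / B) * (norm b)\<^sup>2" for a b :: complex
  proof -
    have exp2: "r * (x - y / r)\<^sup>2 = r * x\<^sup>2 - 2 * (x * y) + 1 / r * y\<^sup>2" if "r > 0" for r x y :: real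
      using that by (simp add: power2_diff power_divide right_diff_distrib distrib_left) (simp add: power2_eq_square)
    have "0 \<le> B / A * (norm a - norm b / (B / A))\<^sup>2" using A B by simp
    also have "\<dots> = B / A * (norm a)\<^sup>2 - 2 * (norm a * norm b) + 1 / (B / A) * (norm b)\<^sup>2"
      using A B by (intro exp2) simp
    finally have "2 * (norm a * norm b) \<le> B / A * (norm a)\<^sup>2 + A / B * (norm b)\<^sup>2" by simp
    moreover have "(norm (a + b))\<^sup>2 \<le> (norm a + norm b)\<^sup>2" by (intro power_mono norm_triangle_ineq) auto
    moreover have "(norm a + norm b)\<^sup>2 = (norm a)\<^sup>2 + (norm b)\<^sup>2 + 2 * (norm a * norm b)"
      by (simp add: power2_sum)
    ultimately show ?thesis by (simp add: distrib_right)
  qed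
  have "sobolev_energy s f \<le> (\<integral>\<^sup>+\<xi>. ennreal (1 + B / A) * ennreal (norm \<xi> powr (2 * s) * (norm (?F g \<xi>))\<^sup>2)
     + ennreal (1 + A / B) * ennreal (norm \<xi> powr (2 * s) * (norm (?F (\<lambda>x. f x - g x) \<xi>))\<^sup>2) \<partial>lborel)"
    unfolding sobolev_energy_def
  proof (rule nn_integral_mono)
    fix \<xi> :: "real ^ 'n"
    have "norm \<xi> powr (2 * s) * (norm (?F f \<xi>))\<^sup>2
      \<le> norm \<xi> powr (2 * s) * ((1 + B / A) * (norm (?F g \<xi>))\<^sup>2 + (1 + A / B) * (norm (?F (\<lambda>x. f x - g x) \<xi>))\<^sup>2)"
      unfolding split by (intro mult_left_mono young) simp
    also have "\<dots> = (1 + B / A) * (norm \<xi> powr (2 * s) * (norm (?F g \<xi>))\<^sup>2)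
       + (1 + A / B) * (norm \<xi> powr (2 * s) * (norm (?F (\<lambda>x. f x - g x) \<xi>))\<^sup>2)"
      by (simp add: algebra_simps)
    finally show "ennreal (norm \<xi> powr (2 * s) * (norm (?F f \<xi>))\<^sup>2)
      \<le> ennreal (1 + B / A) * ennreal (norm \<xi> powr (2 * s) * (norm (?F g \<xi>))\<^sup>2)
        + ennreal (1 + A / B) * ennreal (norm \<xi> powr (2 * s) * (norm (?F (\<lambda>x. f x - g x) \<xi>))\<^sup>2)"
      using A B by (simp add: ennreal_mult[symmetric] ennreal_plus[symmetric] ennreal_leI del: ennreal_plus)
  qed
  also have "\<dots> = ennreal (1 + B / A) * sobolev_energy s g + ennreal (1 + A / B) * sobolev_energy s (\<lambda>x. f x - g x)"
  proof -
    have m: "(\<lambda>\<xi>. ennreal (norm \<xi> powr (2 * s) * (norm (?F h \<xi>))\<^sup>2)) \<in> borel_measurable lborel"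
      if "test_function h" for h :: "real ^ 'n \<Rightarrow> real"
    proof -
      have [measurable]: "?F h \<in> borel_measurable borel"
        by (intro borel_measurable_fourier_transform integrable_test_function that)
      show ?thesis by measurable
    qed
    note mg = m[OF g] and md = m[OF test_function_diff[OF f g]]
    show ?thesis unfolding sobolev_energy_def
      by (simp only: nn_integral_cmult[OF mg] nn_integral_cmult[OF md]
          nn_integral_add[OF borel_measurable_times_ennreal[OF borel_measurable_const mg]
            borel_measurable_times_ennreal[OF borel_measurable_const md]])
  qed
  also have "\<dots> \<le> ennreal (1 + B / A) * ennreal (A\<^sup>2) + ennreal (1 + A / B) * ennreal (B\<^sup>2)"
    by (intro add_mono mult_left_mono gA fgB) auto
  also have "\<dots> = ennreal ((1 + B / A) * A\<^sup>2 + (1 + A / B) * B\<^sup>2)"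
    using A B by (simp add: ennreal_mult[symmetric] ennreal_plus[symmetric] del: ennreal_plus)
  also have "(1 + B / A) * A\<^sup>2 + (1 + A / B) * B\<^sup>2 = (A + B)\<^sup>2"
    using A B by (simp add: distrib_right power2_sum) (simp add: power2_eq_square)
  finally show ?thesis .
qed

text \<open>The previous lemma asks for positive bounds, while \<open>sobolev_seminorm s g\<close>
  may be 0; enlarging it by \<open>e\<close> costs the second copy of \<open>e\<close>. The factor
  \<open>Q\<close> converts seminorms into square roots of energies.\<close>

lemma sobolev_seminorm_diff_less:
  fixes f g :: "real ^ 'n \<Rightarrow> real"
  assumes f: "test_function f" and g: "test_function g" and s: "0 < s" and e: "e > 0"
    and less: "sobolev_seminorm s (\<lambda>x. f x - g x) < e"
  shows "sobolev_seminorm s f \<le> sobolev_seminorm s g + 2 * e"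
proof -
  define Q where "Q = sqrt ((2 * pi) ^ CARD('n))"
  have Q: "Q > 0" "Q\<^sup>2 = (2 * pi) ^ CARD('n)" by (simp_all add: Q_def)
  have E: "sobolev_energy s h = ennreal ((Q * sobolev_seminorm s h)\<^sup>2)" if "test_function h" for h :: "real ^ 'n \<Rightarrow> real"
    unfolding power_mult_distrib[of Q _ 2] Q(2) using that s by (intro sobolev_energy_eq) auto
  let ?d = "sobolev_seminorm s"
  have "sobolev_energy s f \<le> ennreal ((Q * (?d g + e) + Q * e)\<^sup>2)"
  proof (rule sobolev_energy_diff_le[OF f g])
    have dg: "?d g \<ge> 0" by (rule sobolev_seminorm_nonneg)
    show "Q * (?d g + e) > 0" "Q * e > 0" using Q e dg by auto
    show "sobolev_energy s g \<le> ennreal ((Q * (?d g + e))\<^sup>2)"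
      unfolding E[OF g] using Q e dg by (intro ennreal_leI power_mono mult_left_mono) auto
    show "sobolev_energy s (\<lambda>x. f x - g x) \<le> ennreal ((Q * e)\<^sup>2)"
      unfolding E[OF test_function_diff[OF f g]] using Q less
      by (intro ennreal_leI power_mono mult_left_mono mult_nonneg_nonneg sobolev_seminorm_nonneg) auto
  qed
  then have "(Q * ?d f)\<^sup>2 \<le> (Q * (?d g + e) + Q * e)\<^sup>2" unfolding E[OF f] by (simp only: ennreal_le_iff zero_le_power2)
  then have "Q * ?d f \<le> Q * (?d g + e) + Q * e"
    by (rule power2_le_imp_le) (use Q e sobolev_seminorm_nonneg[of s g] in auto)
  also have "\<dots> = Q * (?d g + 2 * e)" by (simp add: algebra_simps)
  finally show ?thesis using Q by simp
qed


text \<open>\<open>D_norm\<close> is a limit along one sequence picked by \<open>SOME\<close>. Its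
  seminorms form a Cauchy sequence of reals, so \<open>lim\<close> denotes a genuine limit. The
  approximants handed out are those of this very sequence, which ties them to the value of
  \<open>D_norm\<close>.\<close>

lemma D_norm_limit:
  fixes u :: "real ^ 'n \<Rightarrow> real"
  assumes s: "0 < s" and u: "u \<in> D_space s"
  obtains \<phi> d where "\<And>k. test_function (\<phi> k)"
    "(\<lambda>k. Lp_norm (sobolev_exponent TYPE('n) s) (\<lambda>x. \<phi> k x - u x)) \<longlonglongrightarrow> 0"
    "0 \<le> d" "D_norm s u = ennreal d" "(\<lambda>k. sobolev_seminorm s (\<phi> k)) \<longlonglongrightarrow> d"
proof -
  define \<phi> where "\<phi> = (SOME \<phi>. D_completing s \<phi> u)"
  have "\<exists>\<phi>. D_completing s \<phi> u" using u by (auto simp: D_space_def)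
  then have c: "D_completing s \<phi> u" unfolding \<phi>_def by (rule someI_ex)
  then have t: "test_function (\<phi> k)" for k by (auto simp: D_completing_def)
  let ?d = "\<lambda>k. sobolev_seminorm s (\<phi> k)"
  have "Cauchy ?d"
  proof (rule CauchyI)
    fix e :: real assume e: "0 < e"
    then have "e / 3 > 0" by simp
    then obtain M where M: "\<And>m n. m \<ge> M \<Longrightarrow> n \<ge> M \<Longrightarrow> D_norm_test s (\<lambda>x. \<phi> m x - \<phi> n x) < ennreal (e / 3)"
      using c unfolding D_completing_def by blast
    have le: "?d m \<le> ?d n + 2 * (e / 3)" if "m \<ge> M" "n \<ge> M" for m n
    proof (rule sobolev_seminorm_diff_less[OF t t s])
      show "sobolev_seminorm s (\<lambda>x. \<phi> m x - \<phi> n x) < e / 3"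
        using M[OF that] unfolding D_norm_test_eq[OF test_function_diff[OF t t] s]
        by (simp add: ennreal_less_iff sobolev_seminorm_nonneg)
    qed (use e in simp)
    have "norm (?d m - ?d n) < e" if "m \<ge> M" "n \<ge> M" for m n
      using le[OF that] le[OF that(2,1)] e by simp
    then show "\<exists>M. \<forall>m\<ge>M. \<forall>n\<ge>M. norm (?d m - ?d n) < e" by blast
  qed
  then obtain d where d: "?d \<longlonglongrightarrow> d" by (auto simp: Cauchy_convergent_iff convergent_def)
  have d0: "d \<ge> 0" by (rule LIMSEQ_le_const[OF d]) (auto intro: sobolev_seminorm_nonneg)
  have "(\<lambda>k. D_norm_test s (\<phi> k)) \<longlonglongrightarrow> ennreal d"
    unfolding D_norm_test_eq[OF t s] by (intro tendsto_ennrealI d)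
  then have "D_norm s u = ennreal d" unfolding D_norm_def \<phi>_def[symmetric] by (rule limI)
  moreover have "(\<lambda>k. Lp_norm (sobolev_exponent TYPE('n) s) (\<lambda>x. \<phi> k x - u x)) \<longlonglongrightarrow> 0"
    using c by (simp add: D_completing_def)
  ultimately show thesis using that t d d0 by blast
qed


section \<open>Passage to the completion\<close>

text \<open>For bounds whose proof divides by a parameter and therefore works with a strictly larger
  one. Continuity of \<open>powr\<close>, which holds also at 0 because \<open>e > 0\<close>,
  recovers the bound at \<open>a\<close> itself.\<close>

lemma le_powr_of_le_add:
  fixes X :: ennreal and a c e :: real
  assumes le: "\<And>\<delta>. \<delta> > 0 \<Longrightarrow> X \<le> ennreal (c * (a + \<delta>) powr e)" and a: "0 \<le> a" and e: "0 < e"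
  shows "X \<le> ennreal (c * a powr e)"
proof (rule tendsto_lowerbound)
  have "((\<lambda>\<delta>. c * (a + \<delta>) powr e) \<longlongrightarrow> c * (a + 0) powr e) (at_right 0)"
  proof (intro tendsto_intros tendsto_powr')
    show "a + 0 \<noteq> 0 \<or> 0 < e \<and> (\<forall>\<^sub>F \<delta> in at_right 0. 0 \<le> a + \<delta>)"
      using a e by (auto simp: eventually_at_right_less intro!: eventually_at_rightI[of 0 1])
  qed
  then show "((\<lambda>\<delta>. ennreal (c * (a + \<delta>) powr e)) \<longlongrightarrow> ennreal (c * a powr e)) (at_right 0)"
    by (intro tendsto_ennrealI) simp
  show "\<forall>\<^sub>F \<delta> in at_right 0. X \<le> ennreal (c * (a + \<delta>) powr e)"
    using le by (auto intro!: eventually_at_rightI[of 0 1])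
qed simp

text \<open>Hoelder's inequality on a ball by truncation: \<open>\<bar>a\<bar> \<le> \<mu> + \<mu>
  powr (1 - q) * \<bar>a\<bar> powr q\<close>, and the level \<open>\<mu> = L * R powr - w\<close>
  makes both terms integrate to at most a multiple of \<open>L * R powr (N - w)\<close>, one with
  the volume of the unit ball and one with the factor 1. Neither factor depends on
  \<open>q\<close>.\<close>

lemma nn_integral_ball_le_powr:
  fixes u :: "'a::euclidean_space \<Rightarrow> real" and w q K R :: real
  assumes u [measurable]: "u \<in> borel_measurable lebesgue" and q: "1 \<le> q" and K: "0 \<le> K" and R: "0 < R"
    and le: "(\<integral>\<^sup>+y\<in>ball x R. ennreal (\<bar>u y\<bar> powr q) \<partial>lebesgue) \<le> ennreal (K powr q * R powr (DIM('a) - q * w))"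
  shows "(\<integral>\<^sup>+y\<in>ball x R. ennreal \<bar>u y\<bar> \<partial>lebesgue) \<le> ennreal ((1 + unit_ball_vol DIM('a)) * K * R powr (DIM('a) - w))"
proof -
  define N where "N = real DIM('a)"
  define \<omega> where "\<omega> = unit_ball_vol N"
  have \<omega>: "\<omega> \<ge> 0" by (simp add: \<omega>_def N_def)
  have [measurable]: "ball x R \<in> sets lebesgue" by simp
  have pos: "(\<integral>\<^sup>+y\<in>ball x R. ennreal \<bar>u y\<bar> \<partial>lebesgue) \<le> ennreal ((1 + \<omega>) * R powr (N - w) * L powr 1)"
    if L: "L > K" for L
  proof -
    have L0: "L > 0" using K L by simp
    define \<mu> where "\<mu> = L * R powr - w"
    have \<mu>: "\<mu> > 0" using L0 R by (simp add: \<mu>_def)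
    have pt: "\<bar>a\<bar> \<le> \<mu> + \<mu> powr (1 - q) * \<bar>a\<bar> powr q" for a :: real
    proof (cases "\<bar>a\<bar> \<le> \<mu>")
      case False
      then have a: "\<bar>a\<bar> > 0" using \<mu> by simp
      have "\<bar>a\<bar> = \<bar>a\<bar> powr (1 - q) * \<bar>a\<bar> powr q" using a by (simp add: powr_add[symmetric])
      also have "\<dots> \<le> \<mu> powr (1 - q) * \<bar>a\<bar> powr q"
        using False \<mu> q by (intro mult_right_mono powr_mono2') auto
      finally show ?thesis using \<mu> by simp
    qed (simp add: add_increasing2)
    have "(\<integral>\<^sup>+y\<in>ball x R. ennreal \<bar>u y\<bar> \<partial>lebesgue)
      \<le> (\<integral>\<^sup>+y. ennreal \<mu> * indicator (ball x R) y + ennreal (\<mu> powr (1 - q)) * (ennreal (\<bar>u y\<bar> powr q) * indicator (ball x R) y) \<partial>lebesgue)"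
    proof (rule nn_integral_mono)
      fix y
      have "ennreal \<bar>u y\<bar> \<le> ennreal \<mu> + ennreal (\<mu> powr (1 - q)) * ennreal (\<bar>u y\<bar> powr q)"
        using pt[of "u y"] \<mu> by (simp add: ennreal_mult[symmetric] ennreal_plus[symmetric] ennreal_leI del: ennreal_plus)
      then show "ennreal \<bar>u y\<bar> * indicator (ball x R) y
         \<le> ennreal \<mu> * indicator (ball x R) y + ennreal (\<mu> powr (1 - q)) * (ennreal (\<bar>u y\<bar> powr q) * indicator (ball x R) y)"
        by (simp add: indicator_def)
    qed
    also have "\<dots> = ennreal \<mu> * emeasure lebesgue (ball x R)
        + ennreal (\<mu> powr (1 - q)) * (\<integral>\<^sup>+y\<in>ball x R. ennreal (\<bar>u y\<bar> powr q) \<partial>lebesgue)"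
    proof -
      have m: "(\<lambda>y. ennreal (\<bar>u y\<bar> powr q) * indicator (ball x R) y) \<in> borel_measurable lebesgue" by measurable
      have m2: "(\<lambda>y. ennreal \<mu> * indicator (ball x R) y) \<in> borel_measurable lebesgue" by measurable
      have m3: "(\<lambda>y. ennreal (\<mu> powr (1 - q)) * (ennreal (\<bar>u y\<bar> powr q) * indicator (ball x R) y)) \<in> borel_measurable lebesgue"
        by measurable
      show ?thesis unfolding nn_integral_add[OF m2 m3] nn_integral_cmult[OF m]
        by (subst nn_integral_cmult_indicator) auto
    qed
    also have "\<dots> \<le> ennreal \<mu> * ennreal (\<omega> * R powr N) + ennreal (\<mu> powr (1 - q)) * ennreal (L powr q * R powr (N - q * w))"
    proof (intro add_mono mult_left_mono)
      show "emeasure lebesgue (ball x R) \<le> ennreal (\<omega> * R powr N)"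
        using R by (simp add: emeasure_ball \<omega>_def N_def powr_realpow)
      show "(\<integral>\<^sup>+y\<in>ball x R. ennreal (\<bar>u y\<bar> powr q) \<partial>lebesgue) \<le> ennreal (L powr q * R powr (N - q * w))"
        using L K q unfolding N_def
        by (intro order_trans[OF le] ennreal_leI mult_right_mono powr_mono2) auto
    qed auto
    also have "\<dots> = ennreal (\<mu> * (\<omega> * R powr N) + \<mu> powr (1 - q) * (L powr q * R powr (N - q * w)))"
      using \<mu> \<omega> by (simp add: ennreal_mult[symmetric] ennreal_plus[symmetric] del: ennreal_plus)
    also have "\<mu> * (\<omega> * R powr N) + \<mu> powr (1 - q) * (L powr q * R powr (N - q * w)) = (1 + \<omega>) * R powr (N - w) * L powr 1"
    proof -
      have 1: "\<mu> * (\<omega> * R powr N) = \<omega> * R powr (N - w) * L"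
        using R by (simp add: \<mu>_def powr_diff powr_minus divide_inverse)
      have "\<mu> powr (1 - q) * (L powr q * R powr (N - q * w)) = (L powr (1 - q) * L powr q) * (R powr (- w * (1 - q)) * R powr (N - q * w))"
        using L0 R by (simp add: \<mu>_def powr_mult powr_powr)
      also have "L powr (1 - q) * L powr q = L" using L0 by (simp add: powr_add[symmetric])
      also have "R powr (- w * (1 - q)) * R powr (N - q * w) = R powr (N - w)"
        unfolding powr_add[symmetric] by (simp add: algebra_simps)
      finally show ?thesis unfolding 1 using L0 by (simp add: algebra_simps)
    qed
    finally show ?thesis .
  qed
  have "(\<integral>\<^sup>+y\<in>ball x R. ennreal \<bar>u y\<bar> \<partial>lebesgue) \<le> ennreal ((1 + \<omega>) * R powr (N - w) * K powr 1)"
    by (rule le_powr_of_le_add) (use pos K in auto)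
  then show ?thesis using K by (simp add: \<omega>_def N_def mult_ac)
qed

section \<open>Approximation by test functions in L^p\<close>

lemma powr_le_two_powr_sum:
  fixes a b p :: real
  assumes "p \<ge> 0"
  shows "\<bar>a\<bar> powr p \<le> 2 powr p * (\<bar>b\<bar> powr p + \<bar>b - a\<bar> powr p)"
proof -
  define m where "m = max \<bar>b\<bar> \<bar>b - a\<bar>"
  have "\<bar>b\<bar> \<le> m" "\<bar>b - a\<bar> \<le> m" by (simp_all add: m_def)
  then have "\<bar>a\<bar> \<le> 2 * m" by linarith
  then have "\<bar>a\<bar> powr p \<le> (2 * m) powr p" using assms by (intro powr_mono2) auto
  also have "\<dots> = 2 powr p * m powr p" by (simp add: powr_mult m_def)
  also have "m powr p \<le> \<bar>b\<bar> powr p + \<bar>b - a\<bar> powr p" by (auto simp: m_def max_def)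
  finally show ?thesis by simp
qed

lemma nn_integral_powr_le_sum:
  assumes [measurable]: "u \<in> borel_measurable M" "v \<in> borel_measurable M" and p: "p \<ge> (0::real)"
  shows "(\<integral>\<^sup>+x. ennreal (\<bar>u x\<bar> powr p) \<partial>M) \<le> ennreal (2 powr p) *
    ((\<integral>\<^sup>+x. ennreal (\<bar>v x\<bar> powr p) \<partial>M) + (\<integral>\<^sup>+x. ennreal (\<bar>v x - u x\<bar> powr p) \<partial>M))"
proof -
  have m: "(\<lambda>x. ennreal (\<bar>v x\<bar> powr p)) \<in> borel_measurable M" "(\<lambda>x. ennreal (\<bar>v x - u x\<bar> powr p)) \<in> borel_measurable M"
    by measurable
  have "(\<integral>\<^sup>+x. ennreal (\<bar>u x\<bar> powr p) \<partial>M) \<le>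
     (\<integral>\<^sup>+x. ennreal (2 powr p) * (ennreal (\<bar>v x\<bar> powr p) + ennreal (\<bar>v x - u x\<bar> powr p)) \<partial>M)"
  proof (rule nn_integral_mono)
    fix x
    have "ennreal (\<bar>u x\<bar> powr p) \<le> ennreal (2 powr p * (\<bar>v x\<bar> powr p + \<bar>v x - u x\<bar> powr p))"
      by (intro ennreal_leI powr_le_two_powr_sum p)
    also have "\<dots> = ennreal (2 powr p) * (ennreal (\<bar>v x\<bar> powr p) + ennreal (\<bar>v x - u x\<bar> powr p))"
      by (simp add: ennreal_mult)
    finally show "ennreal (\<bar>u x\<bar> powr p) \<le> ennreal (2 powr p) * (ennreal (\<bar>v x\<bar> powr p) + ennreal (\<bar>v x - u x\<bar> powr p))" .
  qed
  also have "\<dots> = ennreal (2 powr p) * (\<integral>\<^sup>+x. ennreal (\<bar>v x\<bar> powr p) + ennreal (\<bar>v x - u x\<bar> powr p) \<partial>M)"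
    by (rule nn_integral_cmult) (rule borel_measurable_add[OF m])
  also have "(\<integral>\<^sup>+x. ennreal (\<bar>v x\<bar> powr p) + ennreal (\<bar>v x - u x\<bar> powr p) \<partial>M) =
     (\<integral>\<^sup>+x. ennreal (\<bar>v x\<bar> powr p) \<partial>M) + (\<integral>\<^sup>+x. ennreal (\<bar>v x - u x\<bar> powr p) \<partial>M)"
    by (rule nn_integral_add[OF m])
  finally show ?thesis .
qed

lemma ennpowr_less_imp_le:
  assumes "ennpowr X (1 / p) < ennreal \<delta>" "p > 0" "\<delta> > 0"
  shows "X \<le> ennreal (\<delta> powr p)"
proof (cases X)
  case (real x)
  then have "x powr (1 / p) < \<delta>" using assms by (simp add: ennpowr_ennreal ennreal_less_iff)
  then have "(x powr (1 / p)) powr p \<le> \<delta> powr p" using assms by (intro powr_mono2) auto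
  then show ?thesis using real assms by (auto simp: powr_powr intro!: ennreal_leI)
qed (use assms in simp)

text \<open>The L^p convergence to \<open>u\<close> and the convergence of the seminorms to
  \<open>D_norm s u\<close> hold along one sequence, so a single index meets both
  tolerances.\<close>

lemma D_space_approx:
  fixes u :: "real ^ 'n \<Rightarrow> real"
  assumes s: "0 < s" "s < real CARD('n) / 2" and u: "u \<in> D_space s" and \<delta>: "\<delta> > 0"
  obtains \<phi> d where "test_function \<phi>" "0 \<le> d" "D_norm s u = ennreal d" "sobolev_seminorm s \<phi> < d + \<delta>"
    "(\<integral>\<^sup>+x. ennreal (\<bar>\<phi> x - u x\<bar> powr sobolev_exponent TYPE('n) s) \<partial>lebesgue) \<le> ennreal (\<delta> powr sobolev_exponent TYPE('n) s)"
proof -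
  define p where "p = sobolev_exponent TYPE('n) s"
  have p: "p > 0" using s by (simp add: p_def sobolev_exponent_def)
  obtain \<phi> d where \<phi>: "\<And>k. test_function (\<phi> k)"
    "(\<lambda>k. Lp_norm p (\<lambda>x. \<phi> k x - u x)) \<longlonglongrightarrow> 0"
    "0 \<le> d" "D_norm s u = ennreal d" "(\<lambda>k. sobolev_seminorm s (\<phi> k)) \<longlonglongrightarrow> d"
    unfolding p_def by (rule D_norm_limit[OF s(1) u]) blast
  have "\<forall>\<^sub>F k in sequentially. Lp_norm p (\<lambda>x. \<phi> k x - u x) < ennreal \<delta>"
    using order_tendstoD(2)[OF \<phi>(2), of "ennreal \<delta>"] \<delta> by simp
  moreover have "\<forall>\<^sub>F k in sequentially. sobolev_seminorm s (\<phi> k) < d + \<delta>"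
    using order_tendstoD(2)[OF \<phi>(5), of "d + \<delta>"] \<delta> by simp
  ultimately have "\<forall>\<^sub>F k in sequentially. Lp_norm p (\<lambda>x. \<phi> k x - u x) < ennreal \<delta> \<and> sobolev_seminorm s (\<phi> k) < d + \<delta>"
    by (rule eventually_conj)
  then obtain k where k: "Lp_norm p (\<lambda>x. \<phi> k x - u x) < ennreal \<delta>" "sobolev_seminorm s (\<phi> k) < d + \<delta>"
    using eventually_happens'[OF sequentially_bot] by blast
  have "(\<integral>\<^sup>+x. ennreal (\<bar>\<phi> k x - u x\<bar> powr p) \<partial>lebesgue) \<le> ennreal (\<delta> powr p)"
    using k(1) p \<delta> unfolding Lp_norm_def real_norm_def by (rule ennpowr_less_imp_le)
  then show thesis using that[OF \<phi>(1,3,4) k(2)] by (simp add: p_def)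
qed

text \<open>Some test function lies within L^p distance 1 of \<open>u\<close>, and it is bounded
  with bounded support. Finiteness is what later allows a power of the L^p norm to be divided
  out.\<close>

lemma D_space_Lp:
  fixes u :: "real ^ 'n \<Rightarrow> real"
  assumes s: "0 < s" "s < real CARD('n) / 2" and u: "u \<in> D_space s"
  shows "(\<integral>\<^sup>+x. ennreal (\<bar>u x\<bar> powr sobolev_exponent TYPE('n) s) \<partial>lebesgue) < \<infinity>"
proof -
  define p where "p = sobolev_exponent TYPE('n) s"
  have p: "p > 0" using s by (simp add: p_def sobolev_exponent_def)
  obtain \<phi> where \<phi>: "test_function \<phi>" "(\<integral>\<^sup>+x. ennreal (\<bar>\<phi> x - u x\<bar> powr p) \<partial>lebesgue) \<le> ennreal (1 powr p)"
    unfolding p_def by (rule D_space_approx[OF s u, of 1]) auto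
  obtain R where R: "\<And>x. R < norm x \<Longrightarrow> \<phi> x = 0" by (rule test_function_support[OF \<phi>(1)]) blast
  obtain B where B: "B > 0" "\<And>x. \<bar>\<phi> x\<bar> \<le> B" by (rule test_function_bounded[OF \<phi>(1)]) blast
  have \<phi>m [measurable]: "\<phi> \<in> borel_measurable borel" by (rule test_function_borel_measurable[OF \<phi>(1)])
  have um: "u \<in> borel_measurable lebesgue" using u by (simp add: D_space_def)
  have "integrable lborel (\<lambda>x. \<bar>\<phi> x\<bar> powr p)"
    by (rule integrable_bounded_support[of _ "B powr p" R]) (use R B p in \<open>auto intro!: powr_mono2\<close>)
  then have fin: "(\<integral>\<^sup>+x. ennreal (\<bar>\<phi> x\<bar> powr p) \<partial>lebesgue) < \<infinity>"
    unfolding nn_integral_completion by (simp add: integrable_iff_bounded)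
  have "(\<integral>\<^sup>+x. ennreal (\<bar>u x\<bar> powr p) \<partial>lebesgue) \<le> ennreal (2 powr p) *
    ((\<integral>\<^sup>+x. ennreal (\<bar>\<phi> x\<bar> powr p) \<partial>lebesgue) + (\<integral>\<^sup>+x. ennreal (\<bar>\<phi> x - u x\<bar> powr p) \<partial>lebesgue))"
    by (rule nn_integral_powr_le_sum) (use p um \<phi>m in \<open>auto intro: measurable_completion\<close>)
  also have "\<dots> \<le> ennreal (2 powr p) * ((\<integral>\<^sup>+x. ennreal (\<bar>\<phi> x\<bar> powr p) \<partial>lebesgue) + ennreal (1 powr p))"
    by (intro mult_left_mono add_left_mono \<phi>(2)) auto
  also have "\<dots> < \<infinity>" using fin by (simp add: ennreal_mult_less_top)
  finally show ?thesis by (simp add: p_def)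
qed

text \<open>Apply the inequality for test functions to an approximant whose Morrey bound is
  \<open>M + (1 + \<omega>) * \<delta>\<close> and whose seminorm is below
  \<open>d + \<delta>\<close>, return to \<open>u\<close> at the price of \<open>2 powr p\<close>,
  and let \<delta> tend to 0. The added \<delta> also makes the Morrey constant positive when
  \<open>M\<close> is 0.\<close>

theorem refined_sobolev:
  fixes s p w :: real
  defines "p \<equiv> sobolev_exponent TYPE('n) s"
  defines "w \<equiv> (real CARD('n) - 2 * s) / 2"
  assumes s: "0 < s" "s < real CARD('n) / 2"
  obtains C where "C > 0"
    "\<And>(u :: real ^ 'n \<Rightarrow> real) M d. \<lbrakk>u \<in> D_space s; 0 \<le> M; D_norm s u = ennreal d; 0 \<le> d;
       \<And>x R. 0 < R \<Longrightarrow> (\<integral>\<^sup>+y\<in>ball x R. ennreal \<bar>u y\<bar> \<partial>lebesgue) \<le> ennreal (M * R powr (real CARD('n) - w))\<rbrakk> \<Longrightarrow>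
       (\<integral>\<^sup>+x. ennreal (\<bar>u x\<bar> powr p) \<partial>lebesgue) \<le> ennreal (C * M powr (p - 2) * d\<^sup>2)"
proof -
  define N where "N = real CARD('n)"
  have w: "w > 0" "w < N" using s by (auto simp: w_def N_def)
  have p: "p > 2" unfolding p_def sobolev_exponent_def using s by (simp add: field_simps)
  have pw: "p * w = N" unfolding p_def sobolev_exponent_def w_def N_def using s by simp
  \<comment> \<open>Identifies the frequency weight produced by the integration over levels with
    that of \<open>sobolev_energy s\<close>.\<close>
  have e2s: "(N - (N - w)) * (p - 2) = 2 * s"
  proof -
    have "(N - (N - w)) * (p - 2) = p * w - 2 * w" by (simp add: algebra_simps)
    then show ?thesis unfolding pw by (simp add: w_def N_def field_simps)
  qed
  define \<omega> where "\<omega> = unit_ball_vol N"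
  have \<omega>: "\<omega> \<ge> 0" by (simp add: \<omega>_def N_def)
  define P :: real where "P = (2 * pi) ^ CARD('n)"
  have P: "P > 0" by (simp add: P_def)
  obtain C where C: "C > 0" and test: "\<And>(f :: real ^ 'n \<Rightarrow> real) M. \<lbrakk>test_function f; 0 < M;
       \<And>x R. 0 < R \<Longrightarrow> (\<integral>\<^sup>+y. ennreal \<bar>f y\<bar> * indicator (ball x R) y \<partial>lborel) \<le> ennreal (M * R powr (N - w))\<rbrakk> \<Longrightarrow>
       (\<integral>\<^sup>+x. ennreal (\<bar>f x\<bar> powr p) \<partial>lborel) \<le> ennreal (C * M powr (p - 2)) * sobolev_energy s f"
    unfolding sobolev_energy_def e2s[symmetric]
    unfolding N_def by (rule refined_sobolev_test_function[where 'n='n, of "real CARD('n) - w" p]) (use w p in auto)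
  have "2 powr p * C * P > 0" using C P by simp
  moreover have "(\<integral>\<^sup>+x. ennreal (\<bar>u x\<bar> powr p) \<partial>lebesgue) \<le> ennreal (2 powr p * C * P * M powr (p - 2) * d\<^sup>2)"
    if u: "u \<in> D_space s" and M: "0 \<le> M" and d: "D_norm s u = ennreal d" "0 \<le> d"
      and mor: "\<And>x R. 0 < R \<Longrightarrow> (\<integral>\<^sup>+y\<in>ball x R. ennreal \<bar>u y\<bar> \<partial>lebesgue) \<le> ennreal (M * R powr (N - w))"
    for u :: "real ^ 'n \<Rightarrow> real" and M d
  proof -
    have um [measurable]: "u \<in> borel_measurable lebesgue" using u by (simp add: D_space_def)
    define F where "F \<delta> = 2 powr p * (C * (M + (1 + \<omega>) * \<delta>) powr (p - 2) * (P * (d + \<delta>)\<^sup>2) + \<delta> powr p)" for \<delta>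
    have bound: "(\<integral>\<^sup>+x. ennreal (\<bar>u x\<bar> powr p) \<partial>lebesgue) \<le> ennreal (F \<delta>)" if \<delta>: "\<delta> > 0" for \<delta>
    proof -
      obtain \<phi> d' where \<phi>: "test_function \<phi>" and d': "0 \<le> d'" "D_norm s u = ennreal d'"
        and sem': "sobolev_seminorm s \<phi> < d' + \<delta>"
        and X: "(\<integral>\<^sup>+x. ennreal (\<bar>\<phi> x - u x\<bar> powr p) \<partial>lebesgue) \<le> ennreal (\<delta> powr p)"
        unfolding p_def by (rule D_space_approx[OF s u \<delta>]) auto
      have "d' = d" using d d' by simp
      with sem' have sem: "sobolev_seminorm s \<phi> < d + \<delta>" by simp
      have \<phi>b: "\<phi> \<in> borel_measurable borel" by (rule test_function_borel_measurable[OF \<phi>])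
      then have \<phi>m [measurable]: "\<phi> \<in> borel_measurable lebesgue" by (auto intro: measurable_completion)
      have diff: "(\<integral>\<^sup>+y\<in>ball x R. ennreal \<bar>\<phi> y - u y\<bar> \<partial>lebesgue) \<le> ennreal ((1 + \<omega>) * \<delta> * R powr (N - w))"
        if R: "R > 0" for x R
      proof -
        have "(\<integral>\<^sup>+y\<in>ball x R. ennreal \<bar>\<phi> y - u y\<bar> \<partial>lebesgue)
           \<le> ennreal ((1 + unit_ball_vol DIM(real ^ 'n)) * \<delta> * R powr (DIM(real ^ 'n) - w))"
        \<comment> \<open>As \<open>p * w = N\<close>, the power of \<open>R\<close> in the
          hypothesis is \<open>R powr 0\<close>, so the global L^p error bounds the integral over
          every ball.\<close>
        proof (rule nn_integral_ball_le_powr[where q=p])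
          have "(\<integral>\<^sup>+y\<in>ball x R. ennreal (\<bar>\<phi> y - u y\<bar> powr p) \<partial>lebesgue) \<le> (\<integral>\<^sup>+x. ennreal (\<bar>\<phi> x - u x\<bar> powr p) \<partial>lebesgue)"
            by (rule nn_integral_mono) (auto simp: indicator_def)
          also note X
          finally show "(\<integral>\<^sup>+y\<in>ball x R. ennreal (\<bar>\<phi> y - u y\<bar> powr p) \<partial>lebesgue)
             \<le> ennreal (\<delta> powr p * R powr (DIM(real ^ 'n) - p * w))"
            using R pw by (simp add: N_def)
        qed (use p \<delta> R in auto)
        then show ?thesis by (simp add: N_def \<omega>_def)
      qed
      have mor\<phi>: "(\<integral>\<^sup>+y. ennreal \<bar>\<phi> y\<bar> * indicator (ball x R) y \<partial>lborel) \<le> ennreal ((M + (1 + \<omega>) * \<delta>) * R powr (N - w))"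
        if R: "R > 0" for x R
      proof -
        have [measurable]: "ball x R \<in> sets lebesgue" by simp
        have m: "(\<lambda>y. ennreal \<bar>u y\<bar> * indicator (ball x R) y) \<in> borel_measurable lebesgue"
          "(\<lambda>y. ennreal \<bar>\<phi> y - u y\<bar> * indicator (ball x R) y) \<in> borel_measurable lebesgue" by measurable
        have "(\<integral>\<^sup>+y\<in>ball x R. ennreal \<bar>\<phi> y\<bar> \<partial>lebesgue)
          \<le> (\<integral>\<^sup>+y. ennreal \<bar>u y\<bar> * indicator (ball x R) y + ennreal \<bar>\<phi> y - u y\<bar> * indicator (ball x R) y \<partial>lebesgue)"
          by (rule nn_integral_mono)
            (auto simp: indicator_def ennreal_plus[symmetric] intro!: ennreal_leI simp del: ennreal_plus)
        also have "\<dots> = (\<integral>\<^sup>+y\<in>ball x R. ennreal \<bar>u y\<bar> \<partial>lebesgue) + (\<integral>\<^sup>+y\<in>ball x R. ennreal \<bar>\<phi> y - u y\<bar> \<partial>lebesgue)"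
          by (rule nn_integral_add[OF m])
        also have "\<dots> \<le> ennreal (M * R powr (N - w)) + ennreal ((1 + \<omega>) * \<delta> * R powr (N - w))"
          by (intro add_mono mor diff R)
        also have "\<dots> = ennreal ((M + (1 + \<omega>) * \<delta>) * R powr (N - w))"
          using M \<omega> \<delta> by (simp add: ennreal_plus[symmetric] distrib_right del: ennreal_plus)
        finally show ?thesis by (simp only: nn_integral_completion)
      qed
      have "(\<integral>\<^sup>+x. ennreal (\<bar>\<phi> x\<bar> powr p) \<partial>lborel) \<le> ennreal (C * (M + (1 + \<omega>) * \<delta>) powr (p - 2)) * sobolev_energy s \<phi>"
        by (rule test[OF \<phi>]) (use M \<omega> \<delta> mor\<phi> in \<open>auto intro: add_nonneg_pos\<close>)
      also have "\<dots> \<le> ennreal (C * (M + (1 + \<omega>) * \<delta>) powr (p - 2)) * ennreal (P * (d + \<delta>)\<^sup>2)"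
        unfolding sobolev_energy_eq[OF \<phi> less_imp_le[OF s(1)]] P_def[symmetric]
        using P sem sobolev_seminorm_nonneg[of s \<phi>] by (intro mult_left_mono ennreal_leI power_mono) auto
      also have "\<dots> = ennreal (C * (M + (1 + \<omega>) * \<delta>) powr (p - 2) * (P * (d + \<delta>)\<^sup>2))"
        using C P by (intro ennreal_mult[symmetric]) auto
      finally have \<phi>p: "(\<integral>\<^sup>+x. ennreal (\<bar>\<phi> x\<bar> powr p) \<partial>lebesgue) \<le> ennreal (C * (M + (1 + \<omega>) * \<delta>) powr (p - 2) * (P * (d + \<delta>)\<^sup>2))"
        unfolding nn_integral_completion .
      have "(\<integral>\<^sup>+x. ennreal (\<bar>u x\<bar> powr p) \<partial>lebesgue) \<le> ennreal (2 powr p) *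
         ((\<integral>\<^sup>+x. ennreal (\<bar>\<phi> x\<bar> powr p) \<partial>lebesgue) + (\<integral>\<^sup>+x. ennreal (\<bar>\<phi> x - u x\<bar> powr p) \<partial>lebesgue))"
        by (rule nn_integral_powr_le_sum[OF um \<phi>m]) (use p in simp)
      also have "\<dots> \<le> ennreal (2 powr p) * (ennreal (C * (M + (1 + \<omega>) * \<delta>) powr (p - 2) * (P * (d + \<delta>)\<^sup>2)) + ennreal (\<delta> powr p))"
        by (intro mult_left_mono add_mono \<phi>p X) auto
      also have "\<dots> = ennreal (F \<delta>)"
        unfolding F_def using C P by (simp add: ennreal_mult[symmetric] ennreal_plus[symmetric] del: ennreal_plus)
      finally show ?thesis .
    qed
    have "(F \<longlongrightarrow> 2 powr p * (C * (M + (1 + \<omega>) * 0) powr (p - 2) * (P * (d + 0)\<^sup>2) + 0 powr p)) (at_right 0)"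
      unfolding F_def
    proof (intro tendsto_mult tendsto_add tendsto_powr' tendsto_const tendsto_power tendsto_ident_at)
      \<comment> \<open>\<open>M\<close> may be 0, and continuity of the power there relies on
        \<open>p > 2\<close>.\<close>
      show "M + (1 + \<omega>) * 0 \<noteq> 0 \<or> 0 < p - 2 \<and> (\<forall>\<^sub>F \<delta> in at_right 0. 0 \<le> M + (1 + \<omega>) * \<delta>)"
        using M p \<omega> by (auto intro!: eventually_at_rightI[of 0 1])
      show "(0::real) \<noteq> 0 \<or> 0 < p \<and> (\<forall>\<^sub>F \<delta>::real in at_right 0. 0 \<le> \<delta>)"
        using p by (auto intro!: eventually_at_rightI[of 0 1])
    qed simp
    then have lim: "((\<lambda>\<delta>. ennreal (F \<delta>)) \<longlongrightarrow> ennreal (2 powr p * C * P * M powr (p - 2) * d\<^sup>2)) (at_right 0)"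
      using p by (intro tendsto_ennrealI) (simp add: mult_ac)
    show ?thesis
      by (rule tendsto_lowerbound[OF lim]) (use bound in \<open>auto intro!: eventually_at_rightI[of 0 1]\<close>)
  qed
  ultimately show thesis unfolding N_def by (rule that)
qed


section \<open>Interpolation and conclusion\<close>

text \<open>Dividing \<open>sob\<close> by \<open>n powr (p - 2)\<close> leads to
  \<open>n \<le> C * d\<close>, and the \<open>p\<close>-th root of \<open>mor\<close> to
  \<open>n \<le> C * (\<mu> powr (1 - b) * d powr b)\<close> with \<open>b = 2 / p\<close>. A
  weighted geometric mean of the two reaches every power of \<open>d\<close> between
  \<open>b\<close> and 1. Roots of \<open>C\<close> are replaced by \<open>C \<ge> 1\<close> itself,
  which frees the constant from \<iota>.\<close>

lemma interpolate_two_bounds: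
  fixes n d \<mu> C p \<iota> :: real
  assumes nonneg: "0 \<le> n" "0 \<le> d" "0 \<le> \<mu>" and C: "1 \<le> C" and p: "p > 2" and \<iota>: "2 / p \<le> \<iota>" "\<iota> < 1"
    and sob: "n powr p \<le> C * n powr (p - 2) * d\<^sup>2"
    and mor: "n powr p \<le> C * \<mu> powr (p - 2) * d\<^sup>2"
  shows "n\<^sup>2 \<le> C\<^sup>2 * d powr (2 * \<iota>) * \<mu> powr (2 * (1 - \<iota>))"
proof (cases "n = 0")
  case True
  then show ?thesis by simp
next
  case False
  then have n: "n > 0" using nonneg by simp
  then have np: "n powr p > 0" by simp
  have d: "d > 0" using mor np nonneg by (cases "d = 0") auto
  have \<mu>: "\<mu> > 0" using mor np nonneg by (cases "\<mu> = 0") auto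
  define b where "b = 2 / p"
  have b: "0 < b" "b < 1" using p by (auto simp: b_def)
  \<comment> \<open>The weight for which \<open>\<tau> + b * (1 - \<tau>) = \<iota>\<close>.\<close>
  define \<tau> where "\<tau> = (\<iota> - b) / (1 - b)"
  have \<tau>: "0 \<le> \<tau>" "\<tau> \<le> 1" using \<iota> b by (auto simp: \<tau>_def b_def)
  have "n powr (p - 2) * n\<^sup>2 = n powr p" using n by (simp add: powr_diff powr_numeral)
  then have "n powr (p - 2) * n\<^sup>2 \<le> n powr (p - 2) * (C * d\<^sup>2)" using sob by (simp add: mult_ac)
  then have "n\<^sup>2 \<le> C * d\<^sup>2" using n by simp
  also have "\<dots> \<le> C\<^sup>2 * d\<^sup>2" using C by (intro mult_right_mono) (simp_all add: power2_eq_square)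
  finally have "n\<^sup>2 \<le> (C * d)\<^sup>2" by (simp add: power_mult_distrib)
  then have i: "n \<le> C * d" by (rule power2_le_imp_le) (use C d in simp)
  have "n = (n powr p) powr (1 / p)" using n p by (simp add: powr_powr)
  also have "\<dots> \<le> (C * \<mu> powr (p - 2) * d\<^sup>2) powr (1 / p)" using mor p by (intro powr_mono2) auto
  also have "\<dots> = C powr (1 / p) * (\<mu> powr (1 - b) * d powr b)"
  proof -
    have "(p - 2) * (1 / p) = 1 - b" using p by (simp add: b_def diff_divide_distrib)
    moreover have "(d\<^sup>2) powr (1 / p) = d powr b" using d by (simp add: b_def powr_numeral[symmetric] powr_powr del: powr_numeral)
    ultimately show ?thesis using C by (simp add: powr_mult powr_powr)
  qed
  also have "\<dots> \<le> C powr 1 * (\<mu> powr (1 - b) * d powr b)"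
    using C p by (intro mult_right_mono powr_mono) auto
  finally have ii: "n \<le> C * (\<mu> powr (1 - b) * d powr b)" using C by simp
  have "n = n powr \<tau> * n powr (1 - \<tau>)" using n by (simp add: powr_add[symmetric])
  also have "\<dots> \<le> (C * d) powr \<tau> * (C * (\<mu> powr (1 - b) * d powr b)) powr (1 - \<tau>)"
    using i ii n \<tau> by (intro mult_mono powr_mono2) auto
  also have "\<dots> = (C powr \<tau> * C powr (1 - \<tau>)) * (d powr \<tau> * d powr (b * (1 - \<tau>))) * \<mu> powr ((1 - b) * (1 - \<tau>))"
    using C d \<mu> by (simp add: powr_mult powr_powr)
  also have "C powr \<tau> * C powr (1 - \<tau>) = C" using C by (simp add: powr_add[symmetric])
  also have "d powr \<tau> * d powr (b * (1 - \<tau>)) = d powr (\<tau> * (1 - b) + b)"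
    unfolding powr_add[symmetric] by (simp add: algebra_simps)
  also have "\<tau> * (1 - b) + b = \<iota>" using b by (simp add: \<tau>_def)
  also have "(1 - b) * (1 - \<tau>) = 1 - \<iota>"   proof -
    have "(1 - b) * (1 - \<tau>) = (1 - b) - \<tau> * (1 - b)" by (simp add: algebra_simps)
    also have "\<tau> * (1 - b) = \<iota> - b" using b by (simp add: \<tau>_def)
    finally show ?thesis by simp
  qed
  finally have "n\<^sup>2 \<le> (C * d powr \<iota> * \<mu> powr (1 - \<iota>))\<^sup>2" using n by (intro power_mono) auto
  also have "\<dots> = C\<^sup>2 * (d powr \<iota>)\<^sup>2 * (\<mu> powr (1 - \<iota>))\<^sup>2" by (simp add: power_mult_distrib)
  also have "(d powr \<iota>)\<^sup>2 = d powr (2 * \<iota>)"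
    unfolding power2_eq_square powr_add[symmetric] by simp
  also have "(\<mu> powr (1 - \<iota>))\<^sup>2 = \<mu> powr (2 * (1 - \<iota>))"
    unfolding power2_eq_square powr_add[symmetric] by simp
  finally show ?thesis .
qed

lemma morrey_norm_ball:
  fixes u :: "real ^ 'n \<Rightarrow> real" and \<theta> w \<mu> R :: real
  assumes eq: "morrey_norm \<theta> w u = ennreal \<mu>" and \<mu>: "0 \<le> \<mu>" and \<theta>: "0 < \<theta>" and R: "0 < R"
  shows "(\<integral>\<^sup>+y\<in>ball x R. ennreal (\<bar>u y\<bar> powr \<theta>) \<partial>lebesgue) \<le> ennreal (\<mu> powr \<theta> * R powr (real CARD('n) - w))"
proof -
  define X where "X = (SUP R\<in>{0<..}. SUP x. ennreal (R powr (w - real CARD('n))) *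
               (\<integral>\<^sup>+y\<in>ball x R. ennreal (\<bar>u y\<bar> powr \<theta>) \<partial>lebesgue))"
  let ?I = "\<integral>\<^sup>+y\<in>ball x R. ennreal (\<bar>u y\<bar> powr \<theta>) \<partial>lebesgue"
  let ?r = "R powr (real CARD('n) - w)"
  have "ennpowr X (1 / \<theta>) = ennreal \<mu>" using eq by (simp add: morrey_norm_def X_def)
  then have X: "X = ennreal (\<mu> powr \<theta>)"
    using \<theta> \<mu> by (cases X) (auto simp: ennpowr_ennreal powr_powr)
  have "ennreal (R powr (w - real CARD('n))) * ?I \<le> (SUP x. ennreal (R powr (w - real CARD('n))) *
               (\<integral>\<^sup>+y\<in>ball x R. ennreal (\<bar>u y\<bar> powr \<theta>) \<partial>lebesgue))"
    by (rule SUP_upper) simp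
  also have "\<dots> \<le> X" unfolding X_def by (rule SUP_upper) (use R in simp)
  finally have "ennreal ?r * (ennreal (R powr (w - real CARD('n))) * ?I) \<le> ennreal ?r * ennreal (\<mu> powr \<theta>)"
    unfolding X by (rule mult_left_mono) simp
  also have "ennreal ?r * (ennreal (R powr (w - real CARD('n))) * ?I) = ?I"
    using R by (simp add: mult.assoc[symmetric] ennreal_mult[symmetric] powr_add[symmetric])
  finally show ?thesis by (simp add: ennreal_mult[symmetric] mult.commute)
qed

lemma ennpowr_le:
  assumes "J \<le> ennreal j" "0 \<le> j" "0 \<le> e"
  shows "ennpowr J e \<le> ennreal (j powr e)"
proof (cases J)
  case (real x)
  then show ?thesis using assms by (auto simp: ennpowr_ennreal intro!: ennreal_leI powr_mono2)
next
  case top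
  then show ?thesis using assms(1) by (simp add: top_unique)
qed

text \<open>Apply the diagonal inequality to \<open>\<bar>u\<bar> powr r\<close>: the relation
  \<open>r * q = p\<close> turns its \<open>q\<close>-th power integral into
  \<open>n powr p\<close>, and the exponents \<open>2 / q\<close> and \<open>1 / r\<close> then
  combine to \<open>n\<^sup>2\<close>.\<close>

lemma hls_double_integral:
  fixes s \<alpha> :: real
  assumes s: "0 < s" "s < real CARD('n) / 2" and \<alpha>: "0 < \<alpha>" "\<alpha> < real CARD('n)"
  defines "p \<equiv> sobolev_exponent TYPE('n) s" and "r \<equiv> hls_exponent TYPE('n) s \<alpha>"
  obtains C where "C > 0" "\<And>(u :: real ^ 'n \<Rightarrow> real) n. \<lbrakk>u \<in> borel_measurable lebesgue; 0 \<le> n;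
     (\<integral>\<^sup>+x. ennreal (\<bar>u x\<bar> powr p) \<partial>lebesgue) = ennreal (n powr p)\<rbrakk> \<Longrightarrow>
     ennpowr (\<integral>\<^sup>+y. \<integral>\<^sup>+x. ennreal (\<bar>u x\<bar> powr r * \<bar>u y\<bar> powr r / norm (x - y) powr \<alpha>) \<partial>lebesgue \<partial>lebesgue) (1 / r)
       \<le> ennreal (C * n\<^sup>2)"
proof -
  define N where "N = real CARD('n)"
  define q where "q = 2 * N / (2 * N - \<alpha>)"
  have N: "N > 0" "\<alpha> < N" "2 * s < N" using s \<alpha> by (auto simp: N_def)
  have r: "r > 0" unfolding r_def hls_exponent_def N_def[symmetric] using N by simp
  have q: "q > 0" unfolding q_def using N by simp
  have p: "p > 0" unfolding p_def sobolev_exponent_def N_def[symmetric] using N by simp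
  have rq: "r * q = p" unfolding r_def q_def p_def hls_exponent_def sobolev_exponent_def N_def[symmetric] using N by simp
  obtain C where C: "C > 0" and hls: "\<And>f :: real ^ 'n \<Rightarrow> real. \<And>A. \<lbrakk>f \<in> borel_measurable borel; \<And>x. 0 \<le> f x; 0 < A;
     (\<integral>\<^sup>+x. ennreal (f x powr q) \<partial>lborel) \<le> ennreal A\<rbrakk> \<Longrightarrow>
     (\<integral>\<^sup>+y. \<integral>\<^sup>+x. ennreal (f x * f y / norm (x - y) powr \<alpha>) \<partial>lborel \<partial>lborel) \<le> ennreal (C * A powr (2 / q))"
    unfolding q_def N_def
    by (rule hardy_littlewood_sobolev_diagonal[where 'a="real ^ 'n", of \<alpha>, unfolded DIM_cart DIM_real mult_1_right, OF \<alpha>]) blast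
  have "C powr (1 / r) > 0" using C by simp
  moreover have "ennpowr (\<integral>\<^sup>+y. \<integral>\<^sup>+x. ennreal (\<bar>u x\<bar> powr r * \<bar>u y\<bar> powr r / norm (x - y) powr \<alpha>) \<partial>lebesgue \<partial>lebesgue) (1 / r)
       \<le> ennreal (C powr (1 / r) * n\<^sup>2)"
    if u: "u \<in> borel_measurable lebesgue" and n: "0 \<le> n" and un: "(\<integral>\<^sup>+x. ennreal (\<bar>u x\<bar> powr p) \<partial>lebesgue) = ennreal (n powr p)"
    for u :: "real ^ 'n \<Rightarrow> real" and n
  proof -
    \<comment> \<open>The diagonal inequality is stated for Borel functions, while \<open>u\<close>
      is Lebesgue measurable. A Borel representative leaves the inner integral unchanged for each
      fixed outer value, and the outer integrand unchanged almost everywhere.\<close>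
    obtain v where v [measurable]: "v \<in> borel_measurable lborel" and uv: "AE x in lborel. u x = v x"
      using completion_ex_borel_measurable_real[OF u] by blast
    have A: "(\<integral>\<^sup>+x. ennreal ((\<bar>v x\<bar> powr r) powr q) \<partial>lborel) = ennreal (n powr p)"
    proof -
      have "(\<integral>\<^sup>+x. ennreal ((\<bar>v x\<bar> powr r) powr q) \<partial>lborel) = (\<integral>\<^sup>+x. ennreal (\<bar>u x\<bar> powr p) \<partial>lborel)"
        by (rule nn_integral_cong_AE) (use uv in eventually_elim, simp add: powr_powr rq)
      then show ?thesis using un by (simp add: nn_integral_completion)
    qed
    define J where "J = (\<integral>\<^sup>+y. \<integral>\<^sup>+x. ennreal (\<bar>v x\<bar> powr r * \<bar>v y\<bar> powr r / norm (x - y) powr \<alpha>) \<partial>lborel \<partial>lborel)"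
    have JJ: "(\<integral>\<^sup>+y. \<integral>\<^sup>+x. ennreal (\<bar>u x\<bar> powr r * \<bar>u y\<bar> powr r / norm (x - y) powr \<alpha>) \<partial>lebesgue \<partial>lebesgue) = J"
      unfolding J_def nn_integral_completion
    proof (rule nn_integral_cong_AE)
      have inner: "(\<integral>\<^sup>+x. ennreal (\<bar>u x\<bar> powr r * c / norm (x - y) powr \<alpha>) \<partial>lborel)
         = (\<integral>\<^sup>+x. ennreal (\<bar>v x\<bar> powr r * c / norm (x - y) powr \<alpha>) \<partial>lborel)" for c y
        by (rule nn_integral_cong_AE) (use uv in eventually_elim, simp)
      show "AE y in lborel. (\<integral>\<^sup>+x. ennreal (\<bar>u x\<bar> powr r * \<bar>u y\<bar> powr r / norm (x - y) powr \<alpha>) \<partial>lborel)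
         = (\<integral>\<^sup>+x. ennreal (\<bar>v x\<bar> powr r * \<bar>v y\<bar> powr r / norm (x - y) powr \<alpha>) \<partial>lborel)"
        using uv by eventually_elim (simp add: inner)
    qed
    \<comment> \<open>The bound \<open>A\<close> of the diagonal inequality must be positive while
      \<open>n\<close> may be 0, hence \<open>n powr p + \<delta>\<close>.\<close>
    have "J \<le> ennreal (C * (n powr p + \<delta>) powr (2 / q))" if "\<delta> > 0" for \<delta>
      unfolding J_def
    proof (rule hls)
      show "(\<lambda>x. \<bar>v x\<bar> powr r) \<in> borel_measurable borel" using v by simp
      show "(\<integral>\<^sup>+x. ennreal ((\<bar>v x\<bar> powr r) powr q) \<partial>lborel) \<le> ennreal (n powr p + \<delta>)"
        unfolding A using that by (intro ennreal_leI) simp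
      show "0 < n powr p + \<delta>" using that by (intro add_nonneg_pos) auto
    qed simp
    then have "J \<le> ennreal (C * (n powr p) powr (2 / q))"
      by (rule le_powr_of_le_add) (use q in auto)
    then have "ennpowr J (1 / r) \<le> ennreal ((C * (n powr p) powr (2 / q)) powr (1 / r))"
      by (rule ennpowr_le) (use C r in auto)
    also have "(C * (n powr p) powr (2 / q)) powr (1 / r) = C powr (1 / r) * n\<^sup>2"
    proof -
      have "p * (2 / q) * (1 / r) = 2" unfolding rq[symmetric] using q r by simp
      then have "((n powr p) powr (2 / q)) powr (1 / r) = n powr 2" by (simp only: powr_powr)
      also have "\<dots> = n\<^sup>2" using n by (cases "n = 0") (auto simp: powr_numeral)
      finally show ?thesis using C by (simp add: powr_mult)
    qed
    finally show ?thesis unfolding JJ .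
  qed
  ultimately show thesis by (rule that)
qed

theorem lemma3p1:
  fixes s \<alpha> :: real
  assumes "CARD('n::finite) \<ge> 3"
    and "0 < s" "s < real CARD('n) / 2"
    and "0 < \<alpha>" "\<alpha> < real CARD('n)"
  shows "\<exists>C\<^sub>3>0. \<forall>\<iota> \<theta> :: real.
    2 / sobolev_exponent TYPE('n) s \<le> \<iota> \<and> \<iota> < 1 \<and>
    1 \<le> \<theta> \<and> \<theta> < sobolev_exponent TYPE('n) s \<longrightarrow>
    (\<forall>u :: real ^ 'n \<Rightarrow> real. u \<in> D_space s \<longrightarrow>
      ennpowr (\<integral>\<^sup>+y. \<integral>\<^sup>+x.
          ennreal (\<bar>u x\<bar> powr hls_exponent TYPE('n) s \<alpha> * \<bar>u y\<bar> powr hls_exponent TYPE('n) s \<alpha>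
                   / norm (x - y) powr \<alpha>) \<partial>lebesgue \<partial>lebesgue)
        (1 / hls_exponent TYPE('n) s \<alpha>)
      \<le> ennreal C\<^sub>3 * ennpowr (D_norm s u) (2 * \<iota>)
          * ennpowr (morrey_norm \<theta> (\<theta> * (real CARD('n) - 2 * s) / 2) u) (2 * (1 - \<iota>)))"
proof -
  define p where "p = sobolev_exponent TYPE('n) s"
  define r where "r = hls_exponent TYPE('n) s \<alpha>"
  define N where "N = real CARD('n)"
  define w where "w = (N - 2 * s) / 2"
  have p: "p > 2" unfolding p_def sobolev_exponent_def using assms by (simp add: field_simps)
  have pw: "p * w = N" unfolding p_def sobolev_exponent_def w_def N_def using assms by simp
  define \<omega> where "\<omega> = unit_ball_vol N"
  have \<omega>: "\<omega> \<ge> 0" by (simp add: \<omega>_def N_def)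
  obtain C\<^sub>S where C\<^sub>S: "C\<^sub>S > 0" and sobolev: "\<And>(u :: real ^ 'n \<Rightarrow> real) M d. \<lbrakk>u \<in> D_space s; 0 \<le> M; D_norm s u = ennreal d; 0 \<le> d;
       \<And>x R. 0 < R \<Longrightarrow> (\<integral>\<^sup>+y\<in>ball x R. ennreal \<bar>u y\<bar> \<partial>lebesgue) \<le> ennreal (M * R powr (N - w))\<rbrakk> \<Longrightarrow>
       (\<integral>\<^sup>+x. ennreal (\<bar>u x\<bar> powr p) \<partial>lebesgue) \<le> ennreal (C\<^sub>S * M powr (p - 2) * d\<^sup>2)"
    unfolding p_def w_def N_def by (rule refined_sobolev[OF assms(2,3)]) blast
  obtain C\<^sub>H where C\<^sub>H: "C\<^sub>H > 0" and hls: "\<And>(u :: real ^ 'n \<Rightarrow> real) n. \<lbrakk>u \<in> borel_measurable lebesgue; 0 \<le> n;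
     (\<integral>\<^sup>+x. ennreal (\<bar>u x\<bar> powr p) \<partial>lebesgue) = ennreal (n powr p)\<rbrakk> \<Longrightarrow>
     ennpowr (\<integral>\<^sup>+y. \<integral>\<^sup>+x. ennreal (\<bar>u x\<bar> powr r * \<bar>u y\<bar> powr r / norm (x - y) powr \<alpha>) \<partial>lebesgue \<partial>lebesgue) (1 / r)
       \<le> ennreal (C\<^sub>H * n\<^sup>2)"
    unfolding p_def r_def by (rule hls_double_integral[OF assms(2-5)]) blast
  \<comment> \<open>The factor \<open>(1 + \<omega>) powr (p - 2)\<close> is the cost of passing
    from an exponent \<open>q\<close> to the exponent 1 in the Morrey bound; the maximum with 1
    serves the interpolation.\<close>
  define C where "C = max 1 (C\<^sub>S * (1 + \<omega>) powr (p - 2))"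
  have C: "1 \<le> C" "C\<^sub>S * (1 + \<omega>) powr (p - 2) \<le> C" by (simp_all add: C_def)
  show ?thesis
  proof (intro exI[of _ "C\<^sub>H * C\<^sup>2"] conjI allI impI)
    show "C\<^sub>H * C\<^sup>2 > 0" using C\<^sub>H C(1) by simp
  next
    fix \<iota> \<theta> :: real and u :: "real ^ 'n \<Rightarrow> real"
    assume "2 / sobolev_exponent TYPE('n) s \<le> \<iota> \<and> \<iota> < 1 \<and> 1 \<le> \<theta> \<and> \<theta> < sobolev_exponent TYPE('n) s"
    then have \<iota>: "2 / p \<le> \<iota>" "\<iota> < 1" and \<theta>: "1 \<le> \<theta>" by (auto simp: p_def)
    assume u: "u \<in> D_space s"
    then have um: "u \<in> borel_measurable lebesgue" by (simp add: D_space_def)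
    obtain d where d: "0 \<le> d" "D_norm s u = ennreal d" by (rule D_norm_limit[OF assms(2) u]) blast
    obtain A where A: "0 \<le> A" "(\<integral>\<^sup>+x. ennreal (\<bar>u x\<bar> powr p) \<partial>lebesgue) = ennreal A"
      using D_space_Lp[OF assms(2,3) u] unfolding p_def by (metis less_top_ennreal infinity_ennreal_def)
    define n where "n = A powr (1 / p)"
    have n: "0 \<le> n" "n powr p = A" using A p by (auto simp: n_def powr_powr)
    have up: "(\<integral>\<^sup>+x. ennreal (\<bar>u x\<bar> powr p) \<partial>lebesgue) = ennreal (n powr p)" using A n by simp
    \<comment> \<open>Applied twice: with \<open>q = p\<close> and \<open>K = n\<close>, and with
      \<open>q = \<theta>\<close> and \<open>K\<close> the given Morrey norm.\<close>
    have step: "n powr p \<le> C * K powr (p - 2) * d\<^sup>2"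
      if K: "0 \<le> K" and q: "1 \<le> q" and
        le: "\<And>x R. 0 < R \<Longrightarrow> (\<integral>\<^sup>+y\<in>ball x R. ennreal (\<bar>u y\<bar> powr q) \<partial>lebesgue) \<le> ennreal (K powr q * R powr (N - q * w))"
      for K q
    proof -
      have "(\<integral>\<^sup>+x. ennreal (\<bar>u x\<bar> powr p) \<partial>lebesgue) \<le> ennreal (C\<^sub>S * ((1 + \<omega>) * K) powr (p - 2) * d\<^sup>2)"
      proof (rule sobolev[OF u _ d(2,1)])
        show "(\<integral>\<^sup>+y\<in>ball x R. ennreal \<bar>u y\<bar> \<partial>lebesgue) \<le> ennreal ((1 + \<omega>) * K * R powr (N - w))" if "0 < R" for x R
          using nn_integral_ball_le_powr[OF um q K that, of x w] le[OF that, of x] by (simp add: N_def \<omega>_def)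
      qed (use \<omega> K in simp)
      then have "n powr p \<le> C\<^sub>S * ((1 + \<omega>) * K) powr (p - 2) * d\<^sup>2"
        unfolding up using C\<^sub>S by (simp add: ennreal_le_iff)
      also have "\<dots> = (C\<^sub>S * (1 + \<omega>) powr (p - 2)) * (K powr (p - 2) * d\<^sup>2)" using \<omega> K by (simp add: powr_mult)
      also have "\<dots> \<le> C * (K powr (p - 2) * d\<^sup>2)" using C(2) by (intro mult_right_mono) auto
      finally show ?thesis by (simp add: mult.assoc)
    qed
    \<comment> \<open>The ordinary Sobolev inequality before division by
      \<open>n powr (p - 2)\<close>: each ball integral is at most the whole integral, and
      \<open>N - p * w = 0\<close> removes the radius.\<close>
    have sob: "n powr p \<le> C * n powr (p - 2) * d\<^sup>2"
    proof (rule step[of n p])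
      fix x :: "real ^ 'n" and R :: real assume R: "0 < R"
      have "(\<integral>\<^sup>+y\<in>ball x R. ennreal (\<bar>u y\<bar> powr p) \<partial>lebesgue) \<le> (\<integral>\<^sup>+x. ennreal (\<bar>u x\<bar> powr p) \<partial>lebesgue)"
        by (rule nn_integral_mono) (auto simp: indicator_def)
      then show "(\<integral>\<^sup>+y\<in>ball x R. ennreal (\<bar>u y\<bar> powr p) \<partial>lebesgue) \<le> ennreal (n powr p * R powr (N - p * w))"
        using R up pw by simp
    qed (use n p in auto)
    let ?J = "ennpowr (\<integral>\<^sup>+y. \<integral>\<^sup>+x. ennreal (\<bar>u x\<bar> powr r * \<bar>u y\<bar> powr r / norm (x - y) powr \<alpha>) \<partial>lebesgue \<partial>lebesgue) (1 / r)"
    let ?m = "morrey_norm \<theta> (\<theta> * (real CARD('n) - 2 * s) / 2) u"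
    have J: "?J \<le> ennreal (C\<^sub>H * n\<^sup>2)" by (rule hls[OF um n(1) up])
    have "ennreal (C\<^sub>H * n\<^sup>2) \<le> ennreal (C\<^sub>H * C\<^sup>2) * ennpowr (D_norm s u) (2 * \<iota>) * ennpowr ?m (2 * (1 - \<iota>))"
    proof (cases ?m)
      case (real \<mu>)
      have "n powr p \<le> C * \<mu> powr (p - 2) * d\<^sup>2"
      proof (rule step[of \<mu> \<theta>])
        fix x :: "real ^ 'n" and R :: real assume R: "0 < R"
        show "(\<integral>\<^sup>+y\<in>ball x R. ennreal (\<bar>u y\<bar> powr \<theta>) \<partial>lebesgue) \<le> ennreal (\<mu> powr \<theta> * R powr (N - \<theta> * w))"
          using morrey_norm_ball[OF real(2,1) _ R, of x] \<theta> by (simp add: N_def w_def)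
      qed (use real \<theta> in auto)
      then have "n\<^sup>2 \<le> C\<^sup>2 * d powr (2 * \<iota>) * \<mu> powr (2 * (1 - \<iota>))"
        by (intro interpolate_two_bounds[OF n(1) d(1) real(1) C(1) p \<iota> sob])
      then have "C\<^sub>H * n\<^sup>2 \<le> C\<^sub>H * (C\<^sup>2 * d powr (2 * \<iota>) * \<mu> powr (2 * (1 - \<iota>)))"
        using C\<^sub>H by (intro mult_left_mono) auto
      then have "ennreal (C\<^sub>H * n\<^sup>2) \<le> ennreal (C\<^sub>H * C\<^sup>2 * d powr (2 * \<iota>) * \<mu> powr (2 * (1 - \<iota>)))"
        by (intro ennreal_leI) (simp add: mult.assoc)
      also have "\<dots> = ennreal (C\<^sub>H * C\<^sup>2) * ennreal (d powr (2 * \<iota>)) * ennreal (\<mu> powr (2 * (1 - \<iota>)))"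
        using C\<^sub>H by (simp add: ennreal_mult)
      finally show ?thesis unfolding real(2) d(2) using real(1) d(1) by (simp add: ennpowr_ennreal)
    next
      \<comment> \<open>An infinite Morrey norm makes the right side infinite unless
        \<open>d = 0\<close>. In that case the right side is 0, since
        \<open>0 * \<infinity> = 0\<close> in \<open>ennreal\<close>, and \<open>sob\<close> gives
        \<open>n = 0\<close>.\<close>
      case top
      show ?thesis
      proof (cases "d = 0")
        case True
        then have "n = 0" using sob n(1) by simp
        then show ?thesis by simp
      next
        case False
        then have "ennreal (C\<^sub>H * C\<^sup>2) * ennpowr (D_norm s u) (2 * \<iota>) \<noteq> 0"
          using C\<^sub>H C(1) d by (simp add: ennpowr_ennreal)
        then show ?thesis unfolding top by (simp add: ennreal_mult_top)
      qed
    qed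
    with J show "ennpowr (\<integral>\<^sup>+y. \<integral>\<^sup>+x.
          ennreal (\<bar>u x\<bar> powr hls_exponent TYPE('n) s \<alpha> * \<bar>u y\<bar> powr hls_exponent TYPE('n) s \<alpha>
                   / norm (x - y) powr \<alpha>) \<partial>lebesgue \<partial>lebesgue)
        (1 / hls_exponent TYPE('n) s \<alpha>)
      \<le> ennreal (C\<^sub>H * C\<^sup>2) * ennpowr (D_norm s u) (2 * \<iota>) * ennpowr ?m (2 * (1 - \<iota>))"
      unfolding r_def by (rule order_trans)
  qed
qed

end
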